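(* Let $x>0$. Then there exists $\zeta_x\in\mathbb{R}$ such that $$\frac{j_{xk,k}}{k}-\iota(x)=-\frac{\pi}{4k}\frac{f(x)}{\sqrt{f(x)^2-1}}+\frac{\zeta_x}{k^2}+o\!\left(\frac1{k^2}\right)$$ as $k\to\infty$. Moreover, $$\zeta_x=\frac{\pi}{4}\frac{f(x)}{\sqrt{f(x)^2-1}}\left(\frac1{2\pi^2}-\int_0^x\Theta_0(t)\,dt\right),$$ where $$\Theta_0(x)=-\frac{\pi}{8x^2}\,g''(f(x))\,\frac{f(x)}{\sqrt{f(x)^2-1}}-\frac{\partial^2F}{\partial s^2}(\iota(x),x,0)\,\frac2\pi\,\frac{\sqrt{f(x)^2-1}}{f(x)},$$ and $$\frac{\partial^2F}{\partial s^2}(\iota(x),x,0)=-\frac1{12\,\iota(x)^2}\int_0^\infty t^3K_1(t)e^{-\frac{x}{\iota(x)}t}\,dt=-\frac{1}{12x^2f(x)^2}\int_0^\infty t^3K_1(t)e^{-\frac{t}{f(x)}}\,dt,$$ $$g''(t)=\frac{3t\arccos\frac1t-\sqrt{1-\frac1{t^2}}-2t\sqrt{t^2-1}}{(t^2-1)^{5/2}}\qquad(t>1).$$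
   Context: For real $\nu\ge0$, $k\in\mathbb{N}=\{1,2,\dots\}$, $j_{\nu,k}$ is the $k$-th positive zero of the Bessel function of the first kind $J_\nu$. $f:(0,\infty)\to(1,\infty)$ is the inverse of the strictly decreasing bijection $(1,\infty)\to(0,\infty)$, $y\mapsto\dfrac{\pi}{\sqrt{y^2-1}-\arccos\frac1y}$. For $x>0$, $\iota(x)=x f(x)$, which equals $\lim_{k\to\infty}j_{xk,k}/k$. $g(t)=\dfrac{\arccos\frac1t}{\sqrt{1-\frac1{t^2}}}$ for $t>1$. $K_0,K_1$ are the modified Bessel functions of the second kind of orders $0,1$. For $y>x>0$ and $s\in\mathbb{R}$, $$F(y,x,s)=2y\int_0^\infty K_0\!\left(2yt\,\frac{\sinh(st)}{st}\right)e^{-2xt}\,dt,$$ with $\frac{\sinh(st)}{st}$ interpreted as $1$ for $s=0$. *)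

theory Defs
  imports "HOL-Analysis.Analysis" "HOL-Library.Landau_Symbols"
begin

section \<open>Bessel functions\<close>

text \<open>
  All Bessel functions are taken on the positive real axis, where \<open>powr\<close> is the real power.
  As \<^const>\<open>rGamma\<close> is the entire function \<open>1 / \<Gamma>\<close>, the series below are the usual ones for every
  real order; in particular \<open>besselI\<close> is correct for negative (also negative integer) order.
\<close>

definition besselJ :: "real \<Rightarrow> real \<Rightarrow> real" where
  "besselJ \<nu> z = (z / 2) powr \<nu> *
     (\<Sum>m. (- 1) ^ m * (z / 2) ^ (2 * m) / fact m * rGamma (real m + \<nu> + 1))"

definition besselI :: "real \<Rightarrow> real \<Rightarrow> real" where
  "besselI \<nu> z = (z / 2) powr \<nu> *
     (\<Sum>m. (z / 2) ^ (2 * m) / fact m * rGamma (real m + \<nu> + 1))"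

text \<open>
  For non-integer \<open>\<nu>\<close> the limit is the value at \<open>\<nu>\<close> of the (continuous) expression itself; for integer
  \<open>\<nu>\<close> it is the usual limiting definition.
\<close>

definition besselK :: "real \<Rightarrow> real \<Rightarrow> real" where
  "besselK \<nu> z =
     Lim (at \<nu>) (\<lambda>\<mu>. pi / 2 * (besselI (- \<mu>) z - besselI \<mu> z) / sin (\<mu> * pi))"

text \<open>
  The \<open>k\<close>-th positive zero, for \<open>k \<ge> 1\<close>. As \<open>card\<close> of an infinite set is \<open>0\<close>, the condition
  implies that there are only finitely many smaller positive zeros. The value at \<open>k = 0\<close> is
  irrelevant.
\<close>

definition besselJ_zero :: "real \<Rightarrow> nat \<Rightarrow> real" where
  "besselJ_zero \<nu> k =
     (THE z. z > 0 \<and> besselJ \<nu> z = 0 \<and> card {w. 0 < w \<and> w \<le> z \<and> besselJ \<nu> w = 0} = k)"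


section \<open>The auxiliary functions\<close>

definition f_fun :: "real \<Rightarrow> real" where
  "f_fun = inv_into {1<..} (\<lambda>y. pi / (sqrt (y\<^sup>2 - 1) - arccos (1 / y)))"

definition iota :: "real \<Rightarrow> real" where
  "iota x = x * f_fun x"

definition g_fun :: "real \<Rightarrow> real" where
  "g_fun t = arccos (1 / t) / sqrt (1 - 1 / t\<^sup>2)"

definition sinhc :: "real \<Rightarrow> real" where
  "sinhc u = (if u = 0 then 1 else sinh u / u)"

definition F_fun :: "real \<Rightarrow> real \<Rightarrow> real \<Rightarrow> real" where
  "F_fun y x s = 2 * y *
     (LBINT t:{0<..}. besselK 0 (2 * y * t * sinhc (s * t)) * exp (- 2 * x * t))"

definition Theta0 :: "real \<Rightarrow> real" where
  "Theta0 x =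
     - pi / (8 * x\<^sup>2) * deriv (deriv g_fun) (f_fun x) * (f_fun x / sqrt ((f_fun x)\<^sup>2 - 1))
     - deriv (deriv (F_fun (iota x) x)) 0 * (2 / pi) * (sqrt ((f_fun x)\<^sup>2 - 1) / f_fun x)"

end

theory Submission
  imports Defs "HOL-Real_Asymp.Real_Asymp"
begin

text \<open>
  Above its turning point \<open>\<nu>\<close>, the rescaled Bessel function \<open>(z\<^sup>2 - \<nu>\<^sup>2) powr (1/4) * J\<close> is an oscillation with
  frequency \<open>\<sigma> = sqrt (z\<^sup>2 - \<nu>\<^sup>2) / z\<close>, up to a small relative perturbation \<open>\<psi>\<close> (the Liouville--Green
  transformation). In polar coordinates its angle satisfies
  \<open>\<theta>' = \<sigma> * (1 + \<psi> * (cos \<theta>)\<^sup>2)\<close>, the zeros are the points where the angle is an odd multiple of \<open>pi / 2\<close>, and the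
  antiderivative of \<open>\<sigma>\<close> is \<open>\<nu> * \<Phi> (z / \<nu>)\<close>, where \<open>\<Phi> t = sqrt (t\<^sup>2 - 1) - arccos (1 / t)\<close> is the Debye phase. Averaging
  \<open>(cos \<theta>)\<^sup>2\<close> gives the next correction \<open>- d (z / \<nu>) / \<nu>\<close> with an explicit elementary \<open>d\<close> and an error of order
  \<open>1 / \<nu>\<^sup>2\<close> (\<open>Langle_error\<close>). So the \<open>k\<close>-th zero \<open>\<nu> * t\<close> solves
  \<open>\<nu> * \<Phi> t - d t / \<nu> = k * pi - pi / 4\<close> up to that error (\<open>besselJ_zero_Debye\<close>). For \<open>\<nu> = x * k\<close> the main part is
  \<open>\<Phi> t = pi / x\<close>, which says \<open>t = f x\<close>, and a second-order Taylor expansion of the inverse of \<open>\<Phi>\<close> yields the expansion of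
  the zero with the coefficient
  \<open>\<zeta> = f / q * d f / x - pi\<^sup>2 / (32 * x) * f / q ^ 4\<close>, where \<open>f\<close> is \<open>f x\<close> and \<open>q = sqrt (f\<^sup>2 - 1)\<close>
  (\<open>besselJ_zero_expansion\<close>).

  The phase constant \<open>- pi / 4\<close> requires a connection between 0 and infinity. It is supplied by the Laplace transform: Bessel's
  equation determines the transform of \<open>J\<close> up to a constant factor (\<open>laplace_besselJ_closed_form\<close>), and an Abelian theorem
  at the singularity \<open>p = \<i>\<close> reads off the phase of \<open>J\<close> at infinity modulo \<open>pi\<close> (\<open>phase_constant_cis\<close>). The
  multiple of \<open>pi\<close>, which is the same as the correct numbering of the zeros, follows from an interval beyond \<open>\<nu>\<close> that is
  free of zeros (\<open>besselJ_pos_initial\<close>) and on which the phase changes by a bounded amount less than \<open>pi\<close>.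

  It remains to recognize \<open>\<zeta>\<close> in the integral of \<open>Theta0\<close>. The moment of \<open>K1\<close> that gives the second derivative of \<open>F\<close> is
  elementary (\<open>K1_moment\<close>), and in the variable \<open>t = f x\<close> the function \<open>Theta0\<close> is the derivative with respect to \<open>x\<close> of
  \<open>\<Phi> t / (8 * q ^ 3) - 4 * \<Phi> t * d t / pi\<^sup>2\<close> with \<open>q = sqrt (t\<^sup>2 - 1)\<close> (\<open>Theta0_eq\<close>). This antiderivative tends to
  \<open>- 1 / (2 * pi\<^sup>2)\<close> as \<open>x\<close> tends to 0; inserting \<open>\<Phi> (f x) = pi / x\<close> identifies the two expressions for \<open>\<zeta>\<close>. The formula for
  the second derivative of \<open>F\<close> itself is differentiation under the integral sign, once the modified Bessel functions of
  orders 0 and 1, which are defined as limits in the order, are identified with their integral representation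
  (\<open>besselK_eq_kint\<close>).
\<close>

section \<open>Limits, derivatives and improper integrals\<close>

text \<open>
  Dominated convergence for a filter \<open>at z0 within S\<close> instead of a sequence: in a first-countable space
  such a limit may be tested along sequences.
\<close>

lemma integral_tendsto_within_dominated:
  fixes f :: "'a::first_countable_topology \<Rightarrow> 'b \<Rightarrow> 'c::{banach, second_countable_topology}"
  assumes meas: "\<And>z. z \<in> S \<Longrightarrow> z \<noteq> z0 \<Longrightarrow> f z \<in> borel_measurable M"
    and bound: "\<And>z t. z \<in> S \<Longrightarrow> z \<noteq> z0 \<Longrightarrow> t \<in> space M \<Longrightarrow> norm (f z t) \<le> w t"
    and w: "integrable M w"
    and g: "g \<in> borel_measurable M"
    and lim: "\<And>t. t \<in> space M \<Longrightarrow> ((\<lambda>z. f z t) \<longlongrightarrow> g t) (at z0 within S)"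
  shows "((\<lambda>z. integral\<^sup>L M (f z)) \<longlongrightarrow> integral\<^sup>L M g) (at z0 within S)"
proof (subst tendsto_at_iff_sequentially, intro allI impI)
  fix X :: "nat \<Rightarrow> 'a"
  assume X: "\<forall>i. X i \<in> S - {z0}" "X \<longlonglongrightarrow> z0"
  have "(\<lambda>i. integral\<^sup>L M (f (X i))) \<longlonglongrightarrow> integral\<^sup>L M g"
  proof (rule integral_dominated_convergence[where w=w])
    show "AE t in M. (\<lambda>i. f (X i) t) \<longlonglongrightarrow> g t"
    proof (rule AE_I2)
      fix t assume "t \<in> space M"
      from lim[OF this] X show "(\<lambda>i. f (X i) t) \<longlonglongrightarrow> g t"
        unfolding tendsto_at_iff_sequentially by (auto simp: o_def)
    qed
  qed (use X meas bound w g in \<open>auto intro!: AE_I2\<close>)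
  then show "((\<lambda>z. integral\<^sup>L M (f z)) \<circ> X) \<longlonglongrightarrow> integral\<^sup>L M g"
    by (simp add: o_def)
qed

text \<open>
  The difference quotients are dominated by \<open>g\<close>, so they may pass to the limit under the integral. A
  Lipschitz bound at the single point \<open>p0\<close> suffices; the second derivative of \<open>F\<close> needs this
  form, because its integrand is only controlled relative to its value at \<open>s = 0\<close>.
\<close>

lemma has_field_derivative_integral_Lipschitz:
  fixes f :: "'a::{real_normed_field, banach, second_countable_topology} \<Rightarrow> 'b \<Rightarrow> 'a"
  assumes r: "r > 0"
    and int: "\<And>p. p \<in> ball p0 r \<Longrightarrow> integrable M (f p)"
    and der: "\<And>t. t \<in> space M \<Longrightarrow> ((\<lambda>p. f p t) has_field_derivative f' t) (at p0)"
    and lip: "\<And>p t. p \<in> ball p0 r \<Longrightarrow> t \<in> space M \<Longrightarrow> norm (f p t - f p0 t) \<le> g t * norm (p - p0)"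
    and g: "integrable M g"
  shows "((\<lambda>p. integral\<^sup>L M (f p)) has_field_derivative integral\<^sup>L M f') (at p0)"
    and "integrable M f'"
proof -
  have p0: "p0 \<in> ball p0 r" using r by simp
  define Q where "Q p t = (f p t - f p0 t) / (p - p0)" for p t
  have Qint: "integrable M (Q p)" if "p \<in> ball p0 r" for p
    unfolding Q_def using int[OF that] int[OF p0] by auto
  have Qb: "norm (Q p t) \<le> g t" if "p \<in> ball p0 r" "p \<noteq> p0" "t \<in> space M" for p t
    using lip[OF that(1,3)] that(2) by (simp add: Q_def norm_divide field_simps)
  have Ql: "((\<lambda>p. Q p t) \<longlongrightarrow> f' t) (at p0)" if "t \<in> space M" for t
    using der[OF that] unfolding has_field_derivative_iff Q_def by simp
  have nt: "at p0 within ball p0 r = at p0"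
    using r by (intro at_within_open) auto
  have meas: "f' \<in> borel_measurable M"
  proof (rule borel_measurable_LIMSEQ_metric)
    define c where "c n = r / 2 / real (Suc n)" for n
    define X :: "nat \<Rightarrow> 'a" where "X n = p0 + of_real (c n)" for n
    have c: "0 < c n" "c n < r" for n
    proof -
      have "c n \<le> r / 2" using r by (simp add: c_def field_simps)
      then show "c n < r" using r by linarith
      show "0 < c n" using r by (simp add: c_def del: of_nat_Suc)
    qed
    have Xb: "X n \<in> ball p0 r" for n
      using c[of n] by (simp add: X_def dist_norm)
    have Xn: "X n \<noteq> p0" for n using c[of n] by (simp add: X_def)
    have "c \<longlonglongrightarrow> 0"
      unfolding c_def by (rule LIMSEQ_Suc[OF lim_const_over_n])
    then have "(\<lambda>n. of_real (c n) :: 'a) \<longlonglongrightarrow> of_real 0"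
      by (rule tendsto_of_real)
    from tendsto_add[OF tendsto_const[of p0] this] have Xl: "X \<longlonglongrightarrow> p0"
      unfolding X_def by simp
    show "Q (X n) \<in> borel_measurable M" for n using Qint[OF Xb] by auto
    show "(\<lambda>n. Q (X n) t) \<longlonglongrightarrow> f' t" if "t \<in> space M" for t
      using Ql[OF that] Xl Xn unfolding tendsto_at_iff_sequentially by (auto simp: o_def)
  qed
  have "((\<lambda>p. integral\<^sup>L M (Q p)) \<longlongrightarrow> integral\<^sup>L M f') (at p0 within ball p0 r)"
    by (rule integral_tendsto_within_dominated[where w=g])
       (use Qint Qb g meas Ql nt in auto)
  then have "((\<lambda>p. integral\<^sup>L M (Q p)) \<longlongrightarrow> integral\<^sup>L M f') (at p0)" using nt by simp
  moreover have "\<forall>\<^sub>F p in at p0. integral\<^sup>L M (Q p) = (integral\<^sup>L M (f p) - integral\<^sup>L M (f p0)) / (p - p0)"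
    unfolding eventually_at
    by (intro exI[of _ r] conjI r ballI impI)
       (use int[OF p0] int in \<open>auto simp: Q_def[abs_def] dist_commute\<close>)
  ultimately show "((\<lambda>p. integral\<^sup>L M (f p)) has_field_derivative integral\<^sup>L M f') (at p0)"
    unfolding has_field_derivative_iff by (rule Lim_transform_eventually)
  show "integrable M f'"
  proof (rule Bochner_Integration.integrable_bound[OF g meas], rule AE_I2)
    fix t assume t: "t \<in> space M"
    have "norm (f' t) \<le> g t"
    proof (rule tendsto_upperbound[OF tendsto_norm[OF Ql[OF t]]])
      show "\<forall>\<^sub>F p in at p0. norm (Q p t) \<le> g t"
        unfolding eventually_at
        by (intro exI[of _ r] conjI r ballI impI) (use Qb t in \<open>auto simp: dist_commute\<close>)
    qed simp
    then show "norm (f' t) \<le> norm (g t)" by simp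
  qed
qed

lemma has_field_derivative_integral_dominated:
  fixes f :: "'a::{real_normed_field, banach, second_countable_topology} \<Rightarrow> 'b \<Rightarrow> 'a"
  assumes r: "r > 0"
    and int: "\<And>p. p \<in> ball p0 r \<Longrightarrow> integrable M (f p)"
    and der: "\<And>p t. p \<in> ball p0 r \<Longrightarrow> t \<in> space M \<Longrightarrow> ((\<lambda>p. f p t) has_field_derivative f' p t) (at p)"
    and bd: "\<And>p t. p \<in> ball p0 r \<Longrightarrow> t \<in> space M \<Longrightarrow> norm (f' p t) \<le> g t"
    and g: "integrable M g"
  shows "((\<lambda>p. integral\<^sup>L M (f p)) has_field_derivative integral\<^sup>L M (f' p0)) (at p0)"
    and "integrable M (f' p0)"
proof -
  have lip: "norm (f p t - f p0 t) \<le> g t * norm (p - p0)" if "p \<in> ball p0 r" "t \<in> space M" for p t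
    by (rule field_differentiable_bound[of "ball p0 r" _ "\<lambda>p. f' p t"])
       (use that der bd r in \<open>auto intro: has_field_derivative_at_within\<close>)
  note * = has_field_derivative_integral_Lipschitz[OF r int _ lip g, of "f' p0"]
  show "((\<lambda>p. integral\<^sup>L M (f p)) has_field_derivative integral\<^sup>L M (f' p0)) (at p0)"
    by (rule *) (use der r in auto)
  show "integrable M (f' p0)"
    by (rule *) (use der r in auto)
qed

lemma integral_UNIV_FTC:
  fixes f F :: "real \<Rightarrow> 'a::euclidean_space"
  assumes "\<And>t. (F has_vector_derivative f t) (at t)" "\<And>t. isCont f t"
    and "integrable lborel f" "(F \<longlongrightarrow> A) at_bot" "(F \<longlongrightarrow> B) at_top"
  shows "integral\<^sup>L lborel f = B - A"
proof -
  have "(LBINT t=-\<infinity>..\<infinity>. f t) = B - A"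
    by (rule interval_integral_FTC_integrable[where F=F])
       (use assms in \<open>auto simp: ereal_tendsto_simps set_integrable_def\<close>)
  then show ?thesis
    by (simp add: interval_lebesgue_integral_def set_lebesgue_integral_def)
qed

text \<open>
  For a nonnegative derivative the limits of the antiderivative also give integrability.
\<close>

lemma integral_UNIV_FTC_nonneg:
  fixes f F :: "real \<Rightarrow> real"
  assumes "\<And>t. (F has_real_derivative f t) (at t)" "\<And>t. isCont f t"
    and "\<And>t. f t \<ge> 0" "(F \<longlongrightarrow> A) at_bot" "(F \<longlongrightarrow> B) at_top"
  shows "integrable lborel f" "integral\<^sup>L lborel f = B - A"
proof -
  have "set_integrable lborel (einterval (-\<infinity>) \<infinity>) f"
    by (rule interval_integral_FTC_nonneg(1)[where F=F])
       (use assms in \<open>auto simp: ereal_tendsto_simps\<close>)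
  then show i: "integrable lborel f" by (simp add: set_integrable_def)
  show "integral\<^sup>L lborel f = B - A"
    by (rule integral_UNIV_FTC[where F=F])
       (use assms i in \<open>auto simp: has_real_derivative_iff_has_vector_derivative\<close>)
qed

lemma integral_Ioi_FTC:
  fixes f F :: "real \<Rightarrow> 'a::euclidean_space"
  assumes "\<And>t. t > 0 \<Longrightarrow> (F has_vector_derivative f t) (at t)" "\<And>t. t > 0 \<Longrightarrow> isCont f t"
    and "set_integrable lborel {0<..} f" "(F \<longlongrightarrow> A) (at_right 0)" "(F \<longlongrightarrow> B) at_top"
  shows "(LBINT t:{0<..}. f t) = B - A"
proof -
  have e: "einterval 0 \<infinity> = {0<..}" by (auto simp: einterval_def)
  have "(LBINT t=0..\<infinity>. f t) = B - A"
    by (rule interval_integral_FTC_integrable[where F=F])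
       (use assms e in \<open>auto simp: ereal_tendsto_simps zero_ereal_def\<close>)
  then show ?thesis
    by (simp add: interval_lebesgue_integral_def e)
qed

section \<open>The power series and the ladder relations\<close>

text \<open>
  The entire function behind the Bessel functions. The sign \<open>\<epsilon>\<close> covers both families: with the
  prefactor of \<open>bessel_cyl\<close>, \<open>\<epsilon> = - 1\<close> gives \<open>J\<close> and \<open>\<epsilon> = 1\<close> gives \<open>I\<close>.
\<close>

definition bessel_ser :: "real \<Rightarrow> real \<Rightarrow> real \<Rightarrow> real" where
  "bessel_ser \<epsilon> \<nu> X = (\<Sum>m. (\<epsilon> ^ m / fact m * rGamma (real m + \<nu> + 1)) * X ^ m)"

definition bessel_cyl :: "real \<Rightarrow> real \<Rightarrow> real \<Rightarrow> real" where
  "bessel_cyl \<epsilon> \<nu> z = (z / 2) powr \<nu> * bessel_ser \<epsilon> \<nu> ((z / 2)\<^sup>2)"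

lemma besselJ_eq_cyl: "besselJ \<nu> z = bessel_cyl (- 1) \<nu> z"
  unfolding besselJ_def bessel_cyl_def bessel_ser_def
  by (rule arg_cong2[where f="(*)", OF refl suminf_cong]) (simp only: power_mult, simp)

lemma besselI_eq_cyl: "besselI \<nu> z = bessel_cyl 1 \<nu> z"
  unfolding besselI_def bessel_cyl_def bessel_ser_def
  by (rule arg_cong2[where f="(*)", OF refl suminf_cong]) (simp only: power_mult, simp)

lemma summable_bessel_ser:
  "summable (\<lambda>m. (\<epsilon> ^ m / fact m * rGamma (real m + \<nu> + 1)) * X ^ m)"
proof (rule summable_ratio_test[where c="1/2" and N="nat \<lceil>\<bar>\<nu>\<bar> + 2 * \<bar>\<epsilon> * X\<bar> + 1\<rceil>"])
  fix n assume "n \<ge> nat \<lceil>\<bar>\<nu>\<bar> + 2 * \<bar>\<epsilon> * X\<bar> + 1\<rceil>"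
  then have n: "real n \<ge> \<bar>\<nu>\<bar> + 2 * \<bar>\<epsilon> * X\<bar> + 1" by linarith
  define a where "a = real n + \<nu> + 1"
  have a1: "a \<ge> 1" and n2: "real n + 1 \<ge> 2 * \<bar>\<epsilon> * X\<bar>" using n unfolding a_def by linarith+
  have r: "rGamma (a + 1) = rGamma a / a"
    using rGamma_plus1[of a] a1 by (simp add: field_simps)
  have e: "real (Suc n) + \<nu> + 1 = a + 1" "real n + \<nu> + 1 = a" by (simp_all add: a_def)
  have "\<epsilon> ^ Suc n / fact (Suc n) * rGamma (real (Suc n) + \<nu> + 1) * X ^ Suc n
     = (\<epsilon> * X) / ((real n + 1) * a) * (\<epsilon> ^ n / fact n * rGamma (real n + \<nu> + 1) * X ^ n)"
    unfolding e r unfolding fact_Suc power_Suc of_nat_Suc using a1 by (simp add: mult_ac add.commute)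
  then have "norm (\<epsilon> ^ Suc n / fact (Suc n) * rGamma (real (Suc n) + \<nu> + 1) * X ^ Suc n)
     = \<bar>\<epsilon> * X\<bar> / ((real n + 1) * a) * norm (\<epsilon> ^ n / fact n * rGamma (real n + \<nu> + 1) * X ^ n)"
    using a1 by (simp only: norm_mult norm_divide) (simp add: abs_mult)
  also have "\<dots> \<le> 1 / 2 * norm (\<epsilon> ^ n / fact n * rGamma (real n + \<nu> + 1) * X ^ n)"
  proof (rule mult_right_mono)
    have "2 * \<bar>\<epsilon> * X\<bar> * 1 \<le> (real n + 1) * a"
      by (rule mult_mono) (use a1 n2 in auto)
    then show "\<bar>\<epsilon> * X\<bar> / ((real n + 1) * a) \<le> 1 / 2"
      using a1 by (simp add: divide_simps)
  qed simp
  finally show "norm (\<epsilon> ^ Suc n / fact (Suc n) * rGamma (real (Suc n) + \<nu> + 1) * X ^ Suc n)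
     \<le> 1 / 2 * norm (\<epsilon> ^ n / fact n * rGamma (real n + \<nu> + 1) * X ^ n)" .
qed simp

text \<open>
  Termwise differentiation shifts the order, since \<open>m / fact m = 1 / fact (m - 1)\<close>.
\<close>

lemma DERIV_bessel_ser:
  "(bessel_ser \<epsilon> \<nu> has_real_derivative \<epsilon> * bessel_ser \<epsilon> (\<nu> + 1) X) (at X)"
proof -
  let ?c = "\<lambda>m. \<epsilon> ^ m / fact m * rGamma (real m + \<nu> + 1)"
  have "diffs ?c n = \<epsilon> * (\<epsilon> ^ n / fact n * rGamma (real n + (\<nu> + 1) + 1))" for n
    by (simp add: diffs_def fact_Suc field_simps del: of_nat_Suc)
       (simp add: algebra_simps)
  then have "(\<Sum>n. diffs ?c n * X ^ n) = \<epsilon> * bessel_ser \<epsilon> (\<nu> + 1) X"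
    unfolding bessel_ser_def by (subst suminf_mult[symmetric, OF summable_bessel_ser]) (simp add: mult_ac)
  with termdiffs_strong_converges_everywhere[of ?c X, OF summable_bessel_ser] show ?thesis
    unfolding bessel_ser_def[abs_def] by simp
qed

text \<open>
  The recurrence \<open>rGamma (a) = a * rGamma (a + 1)\<close>, applied with \<open>a = m + \<nu>\<close>: its summand \<open>m\<close> gives the
  shifted series, its summand \<open>\<nu>\<close> the unshifted one.
\<close>

lemma bessel_ser_rec:
  "bessel_ser \<epsilon> (\<nu> - 1) X = \<nu> * bessel_ser \<epsilon> \<nu> X + \<epsilon> * X * bessel_ser \<epsilon> (\<nu> + 1) X"
proof -
  let ?c = "\<lambda>\<nu> m. \<epsilon> ^ m / fact m * rGamma (real m + \<nu> + 1)"
  have s: "(\<lambda>m. ?c \<nu> m * X ^ m) sums bessel_ser \<epsilon> \<nu> X" for \<nu>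
    unfolding bessel_ser_def by (rule summable_sums[OF summable_bessel_ser])
  have "(\<lambda>m. real m * (?c \<nu> m * X ^ m)) sums (\<epsilon> * X * bessel_ser \<epsilon> (\<nu> + 1) X)"
  proof -
    have "(\<lambda>m. real (Suc m) * (?c \<nu> (Suc m) * X ^ Suc m)) = (\<lambda>m. \<epsilon> * X * (?c (\<nu> + 1) m * X ^ m))"
    proof (rule ext)
      fix m
      have e: "real (Suc m) + \<nu> + 1 = real m + (\<nu> + 1) + 1" by simp
      show "real (Suc m) * (?c \<nu> (Suc m) * X ^ Suc m) = \<epsilon> * X * (?c (\<nu> + 1) m * X ^ m)"
        unfolding e by (simp add: fact_Suc divide_simps del: of_nat_Suc)
    qed
    then have "(\<lambda>m. real (Suc m) * (?c \<nu> (Suc m) * X ^ Suc m)) sums (\<epsilon> * X * bessel_ser \<epsilon> (\<nu> + 1) X)"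
      using sums_mult[OF s[of "\<nu> + 1"], of "\<epsilon> * X"] by simp
    then show ?thesis by (subst (asm) sums_Suc_iff) simp
  qed
  from sums_add[OF sums_mult[OF s[of \<nu>], of \<nu>] this]
  have "(\<lambda>m. (real m + \<nu>) * (?c \<nu> m * X ^ m)) sums (\<nu> * bessel_ser \<epsilon> \<nu> X + \<epsilon> * X * bessel_ser \<epsilon> (\<nu> + 1) X)"
    by (subst distrib_right, subst add.commute)
  also have "(\<lambda>m. (real m + \<nu>) * (?c \<nu> m * X ^ m)) = (\<lambda>m. ?c (\<nu> - 1) m * X ^ m)"
  proof (rule ext)
    fix m
    have "rGamma (real m + (\<nu> - 1) + 1) = (real m + \<nu>) * rGamma (real m + \<nu> + 1)"
      using rGamma_plus1[of "real m + \<nu>"] by simp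
    then show "(real m + \<nu>) * (?c \<nu> m * X ^ m) = ?c (\<nu> - 1) m * X ^ m" by simp
  qed
  finally show ?thesis using s[of "\<nu> - 1"] sums_unique2 by blast
qed

lemma bessel_ser_0: "bessel_ser \<epsilon> \<nu> 0 = rGamma (\<nu> + 1)"
  unfolding bessel_ser_def by (simp only: powser_zero) simp

lemma bessel_cyl_rec:
  assumes "z > 0"
  shows "bessel_cyl \<epsilon> (\<nu> - 1) z = 2 * \<nu> / z * bessel_cyl \<epsilon> \<nu> z + \<epsilon> * bessel_cyl \<epsilon> (\<nu> + 1) z"
proof -
  have a: "(z / 2) powr \<nu> = (z / 2) powr (\<nu> - 1) * (z / 2)"
    using assms powr_add[of "z/2" "\<nu> - 1" 1] by simp
  have b: "(z / 2) powr (\<nu> + 1) = (z / 2) powr (\<nu> - 1) * (z / 2) * (z / 2)"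
    using assms powr_add[of "z/2" "\<nu>" 1] by (simp add: a)
  show ?thesis
    using assms unfolding bessel_cyl_def bessel_ser_rec[of \<epsilon> \<nu>] a b
    by (simp add: field_simps power2_eq_square)
qed

lemma DERIV_bessel_cyl:
  assumes "z > 0"
  shows "(bessel_cyl \<epsilon> \<nu> has_real_derivative \<nu> / z * bessel_cyl \<epsilon> \<nu> z + \<epsilon> * bessel_cyl \<epsilon> (\<nu> + 1) z) (at z)"
proof -
  have p: "(z / 2) powr (\<nu> + 1) = (z / 2) powr \<nu> * (z / 2)"
    using assms powr_add[of "z/2" "\<nu>" 1] by simp
  have "((\<lambda>z. (z / 2) powr \<nu> * bessel_ser \<epsilon> \<nu> ((z / 2)\<^sup>2)) has_real_derivative
     (\<nu> * (z / 2) powr (\<nu> - 1) * (1 / 2)) * bessel_ser \<epsilon> \<nu> ((z / 2)\<^sup>2)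
     + (\<epsilon> * bessel_ser \<epsilon> (\<nu> + 1) ((z / 2)\<^sup>2) * (z / 2)) * (z / 2) powr \<nu>) (at z)"
    using assms
    by (auto intro!: derivative_eq_intros DERIV_chain2[OF DERIV_bessel_ser]
             simp: powr_diff field_simps power2_eq_square)
  then show ?thesis
    unfolding bessel_cyl_def[abs_def] p
    by (rule DERIV_cong) (use assms in \<open>simp add: powr_diff field_simps\<close>)
qed

text \<open>
  The other ladder relation; together with the raising one it encodes Bessel's equation as a first-order system.
\<close>

lemma DERIV_bessel_cyl':
  assumes "z > 0"
  shows "(bessel_cyl \<epsilon> \<nu> has_real_derivative bessel_cyl \<epsilon> (\<nu> - 1) z - \<nu> / z * bessel_cyl \<epsilon> \<nu> z) (at z)"
  using DERIV_bessel_cyl[OF assms, of \<epsilon> \<nu>] bessel_cyl_rec[OF assms, of \<epsilon> \<nu>]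
  by (simp add: field_simps)

lemma bessel_cyl_tendsto_0:
  "((\<lambda>z. z powr (- \<nu>) * bessel_cyl \<epsilon> \<nu> z) \<longlongrightarrow> 2 powr (- \<nu>) * rGamma (\<nu> + 1)) (at_right 0)"
proof -
  have c: "isCont (bessel_ser \<epsilon> \<nu>) X" for X
    using DERIV_bessel_ser DERIV_isCont by blast
  have "((\<lambda>z::real. (z / 2)\<^sup>2) \<longlongrightarrow> 0) (at_right 0)"
    by (auto intro!: tendsto_eq_intros)
  from isCont_tendsto_compose[OF c[of 0] this]
  have "((\<lambda>z. bessel_ser \<epsilon> \<nu> ((z / 2)\<^sup>2)) \<longlongrightarrow> rGamma (\<nu> + 1)) (at_right 0)"
    by (simp add: bessel_ser_0)
  then have "((\<lambda>z. 2 powr (- \<nu>) * bessel_ser \<epsilon> \<nu> ((z / 2)\<^sup>2)) \<longlongrightarrow> 2 powr (- \<nu>) * rGamma (\<nu> + 1)) (at_right 0)"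
    by (rule tendsto_mult_left)
  moreover have "\<forall>\<^sub>F z in at_right 0. 2 powr (- \<nu>) * bessel_ser \<epsilon> \<nu> ((z / 2)\<^sup>2) = z powr (- \<nu>) * bessel_cyl \<epsilon> \<nu> z"
    unfolding eventually_at_right_field
    by (intro exI[of _ 1]) (auto simp: bessel_cyl_def powr_divide powr_minus field_simps)
  ultimately show ?thesis by (rule Lim_transform_eventually)
qed

section \<open>The integral representation of the modified Bessel function of the second kind\<close>

text \<open>
  The integral of \<open>cosh (\<mu> * t) * exp (- z * cosh t)\<close> over the positive half-line, symmetrized to the whole
  line, where the affine substitutions below are available.
\<close>

definition bessel_kint :: "real \<Rightarrow> real \<Rightarrow> real" where
  "bessel_kint \<mu> z = (\<integral>t. exp (\<mu> * t - z * cosh t) \<partial>lborel) / 2"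

text \<open>
  An integrable majorant that is explicit in \<open>\<mu>\<close> and \<open>z\<close>: \<open>cosh t\<close> grows at least like \<open>t\<^sup>2 / 4\<close>, and
  completing the square absorbs the linear term.
\<close>

lemma exp_cosh_bound:
  fixes \<mu> t z :: real
  assumes "z > 0"
  shows "exp (\<mu> * t - z * cosh t) \<le> 2 * exp ((\<bar>\<mu>\<bar> + 1)\<^sup>2 / z) * inverse (1 + t\<^sup>2)"
proof -
  have e: "1 + \<bar>t\<bar> + t\<^sup>2 / 2 \<le> exp \<bar>t\<bar>"
    using exp_lower_Taylor_quadratic[of "\<bar>t\<bar>"] by simp
  have c: "cosh t \<ge> t\<^sup>2 / 4"
  proof -
    have "exp \<bar>t\<bar> / 2 \<le> cosh t"
      by (cases "t \<ge> 0") (auto simp: cosh_def)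
    with e show ?thesis using zero_le_power2[of t] by linarith
  qed
  have "\<mu> * t - z * cosh t \<le> (\<bar>\<mu>\<bar> + 1)\<^sup>2 / z - \<bar>t\<bar>"
  proof -
    have "0 \<le> z * (\<bar>t\<bar> / 2 - (\<bar>\<mu>\<bar> + 1) / z)\<^sup>2" using assms by simp
    also have "\<dots> = z * (t\<^sup>2 / 4) - (\<bar>\<mu>\<bar> + 1) * \<bar>t\<bar> + (\<bar>\<mu>\<bar> + 1)\<^sup>2 / z"
      using assms by (simp add: power2_diff power_divide field_simps power2_eq_square abs_mult_self_eq)
    finally have 1: "(\<bar>\<mu>\<bar> + 1) * \<bar>t\<bar> - z * (t\<^sup>2 / 4) \<le> (\<bar>\<mu>\<bar> + 1)\<^sup>2 / z" by linarith
    have "\<mu> * t \<le> \<bar>\<mu>\<bar> * \<bar>t\<bar>" by (metis abs_ge_self abs_mult)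
    moreover have "z * (t\<^sup>2 / 4) \<le> z * cosh t" using assms c by simp
    ultimately show ?thesis using 1 by (simp add: algebra_simps)
  qed
  then have "exp (\<mu> * t - z * cosh t) \<le> exp ((\<bar>\<mu>\<bar> + 1)\<^sup>2 / z) * exp (- \<bar>t\<bar>)"
    by (simp flip: exp_add)
  also have "\<dots> \<le> exp ((\<bar>\<mu>\<bar> + 1)\<^sup>2 / z) * (2 * inverse (1 + t\<^sup>2))"
  proof (rule mult_left_mono)
    have "1 + t\<^sup>2 > 0" by (simp add: add_pos_nonneg)
    moreover have "1 + t\<^sup>2 \<le> 2 * exp \<bar>t\<bar>" using e by simp
    ultimately show "exp (- \<bar>t\<bar>) \<le> 2 * inverse (1 + t\<^sup>2)"
      by (simp add: exp_minus field_simps)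
  qed simp
  finally show ?thesis by (simp add: mult_ac)
qed

lemma integrable_inverse_1_plus_square_lborel: "integrable lborel (\<lambda>t::real. inverse (1 + t\<^sup>2))"
proof (rule integral_UNIV_FTC_nonneg(1)[where F=arctan])
  show "isCont (\<lambda>t::real. inverse (1 + t\<^sup>2)) t" for t
    by (intro continuous_intros) (metis add_pos_nonneg less_irrefl zero_le_power2 zero_less_one)
qed (auto intro!: DERIV_arctan tendsto_arctan_at_top tendsto_arctan_at_bot)

lemma integrable_exp_cosh:
  fixes \<mu> z :: real
  assumes "z > 0"
  shows "integrable lborel (\<lambda>t. exp (\<mu> * t - z * cosh t))"
proof (rule Bochner_Integration.integrable_bound)
  show "integrable lborel (\<lambda>t. 2 * exp ((\<bar>\<mu>\<bar> + 1)\<^sup>2 / z) * inverse (1 + t\<^sup>2))"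
    by (intro integrable_mult_right integrable_inverse_1_plus_square_lborel)
  show "AE t in lborel. norm (exp (\<mu> * t - z * cosh t)) \<le> norm (2 * exp ((\<bar>\<mu>\<bar> + 1)\<^sup>2 / z) * inverse (1 + t\<^sup>2))"
    using exp_cosh_bound[OF assms, of \<mu>] by (auto intro!: AE_I2 order_trans[OF _ abs_ge_self])
qed (auto intro!: borel_measurable_continuous_onI continuous_intros)

lemma exp_cosh_tendsto_0:
  fixes \<mu> z :: real
  assumes "z > 0"
  shows "((\<lambda>t. exp (\<mu> * t - z * cosh t)) \<longlongrightarrow> 0) at_top"
    and "((\<lambda>t. exp (\<mu> * t - z * cosh t)) \<longlongrightarrow> 0) at_bot"
proof -
  let ?C = "2 * exp ((\<bar>\<mu>\<bar> + 1)\<^sup>2 / z)"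
  have top: "((\<lambda>t::real. ?C * inverse (1 + t\<^sup>2)) \<longlongrightarrow> ?C * 0) at_top"
    by (rule tendsto_mult_left) real_asymp
  have bot: "((\<lambda>t::real. ?C * inverse (1 + t\<^sup>2)) \<longlongrightarrow> ?C * 0) at_bot"
    by (rule tendsto_mult_left) real_asymp
  show "((\<lambda>t. exp (\<mu> * t - z * cosh t)) \<longlongrightarrow> 0) at_top"
    by (rule tendsto_sandwich[where f="\<lambda>_. 0" and h="\<lambda>t. ?C * inverse (1 + t\<^sup>2)"])
       (use exp_cosh_bound[OF assms] top in auto)
  show "((\<lambda>t. exp (\<mu> * t - z * cosh t)) \<longlongrightarrow> 0) at_bot"
    by (rule tendsto_sandwich[where f="\<lambda>_. 0" and h="\<lambda>t. ?C * inverse (1 + t\<^sup>2)"])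
       (use exp_cosh_bound[OF assms] bot in auto)
qed

lemma cosh_mult_exp: "cosh t * exp (\<mu> * t - a) = (exp ((\<mu> + 1) * t - a) + exp ((\<mu> - 1) * t - a)) / 2"
  for t :: real
  by (simp add: cosh_def field_simps exp_add exp_diff exp_minus)

lemma sinh_mult_exp: "sinh t * exp (\<mu> * t - a) = (exp ((\<mu> + 1) * t - a) - exp ((\<mu> - 1) * t - a)) / 2"
  for t :: real
  by (simp add: sinh_def field_simps exp_add exp_diff exp_minus)

lemma bessel_kint_minus: "bessel_kint (- \<mu>) z = bessel_kint \<mu> z"
  unfolding bessel_kint_def
  by (subst lborel_integral_real_affine[where c="-1" and t=0]) (auto simp: cosh_minus)

lemma bessel_kint_nonneg: "bessel_kint \<mu> z \<ge> 0"
  unfolding bessel_kint_def by (simp add: integral_nonneg_AE)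

lemma DERIV_bessel_kint_avg:
  assumes "z > 0"
  shows "(bessel_kint \<mu> has_real_derivative - (bessel_kint (\<mu> + 1) z + bessel_kint (\<mu> - 1) z) / 2) (at z)"
proof -
  define h where "h t = (exp ((\<mu> + 1) * t - z / 2 * cosh t) + exp ((\<mu> - 1) * t - z / 2 * cosh t)) / 2" for t
  have i: "integrable lborel h"
    unfolding h_def using assms by (intro Bochner_Integration.integrable_divide Bochner_Integration.integrable_add integrable_exp_cosh) auto
  have "((\<lambda>z. \<integral>t. exp (\<mu> * t - z * cosh t) \<partial>lborel) has_real_derivative
     (\<integral>t. - (cosh t * exp (\<mu> * t - z * cosh t)) \<partial>lborel)) (at z)"
  proof (rule has_field_derivative_integral_dominated[where r="z/2" and g=h])
    show "integrable lborel (\<lambda>t. exp (\<mu> * t - p * cosh t))" if "p \<in> ball z (z/2)" for p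
      using that by (intro integrable_exp_cosh) (auto simp: dist_real_def abs_if split: if_splits)
    show "((\<lambda>p. exp (\<mu> * t - p * cosh t)) has_real_derivative - (cosh t * exp (\<mu> * t - p * cosh t))) (at p)" for p t
      by (auto intro!: derivative_eq_intros)
    show "norm (- (cosh t * exp (\<mu> * t - p * cosh t))) \<le> h t" if "p \<in> ball z (z/2)" for p t
    proof -
      have "z / 2 * cosh t \<le> p * cosh t"
        using that by (intro mult_right_mono) (auto simp: dist_real_def abs_if split: if_splits)
      then have "cosh t * exp (\<mu> * t - p * cosh t) \<le> cosh t * exp (\<mu> * t - z / 2 * cosh t)"
        by (intro mult_left_mono) auto
      then show ?thesis unfolding h_def cosh_mult_exp[symmetric] by (simp add: abs_mult)
    qed
  qed (use assms i in auto)
  also have "(\<integral>t. - (cosh t * exp (\<mu> * t - z * cosh t)) \<partial>lborel) = - (bessel_kint (\<mu> + 1) z + bessel_kint (\<mu> - 1) z)"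
    unfolding cosh_mult_exp bessel_kint_def using assms
    by (simp add: integrable_exp_cosh add_divide_distrib)
  finally have d: "((\<lambda>z. \<integral>t. exp (\<mu> * t - z * cosh t) \<partial>lborel) has_real_derivative
     - (bessel_kint (\<mu> + 1) z + bessel_kint (\<mu> - 1) z)) (at z)" .
  show ?thesis unfolding bessel_kint_def[of \<mu>, abs_def] using DERIV_cdivide[OF d, of 2] by simp
qed

text \<open>
  Integration by parts: the derivative of \<open>exp (\<mu> * t - z * cosh t)\<close> has integral zero.
\<close>

lemma bessel_kint_rec:
  assumes "z > 0"
  shows "bessel_kint (\<mu> + 1) z = bessel_kint (\<mu> - 1) z + 2 * \<mu> / z * bessel_kint \<mu> z"
proof -
  have eq: "(\<mu> - z * sinh t) * exp (\<mu> * t - z * cosh t)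
    = \<mu> * exp (\<mu> * t - z * cosh t) - z * ((exp ((\<mu> + 1) * t - z * cosh t) - exp ((\<mu> - 1) * t - z * cosh t)) / 2)" for t
    unfolding sinh_mult_exp[symmetric] by (simp add: algebra_simps)
  have "(\<integral>t. (\<mu> - z * sinh t) * exp (\<mu> * t - z * cosh t) \<partial>lborel) = 0 - 0"
  proof (rule integral_UNIV_FTC[where F="\<lambda>t. exp (\<mu> * t - z * cosh t)"])
    show "((\<lambda>t. exp (\<mu> * t - z * cosh t)) has_vector_derivative (\<mu> - z * sinh t) * exp (\<mu> * t - z * cosh t)) (at t)" for t
      unfolding has_real_derivative_iff_has_vector_derivative[symmetric]
      by (auto intro!: derivative_eq_intros)
    show "integrable lborel (\<lambda>t. (\<mu> - z * sinh t) * exp (\<mu> * t - z * cosh t))"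
      unfolding eq by (intro Bochner_Integration.integrable_diff integrable_mult_right
        Bochner_Integration.integrable_divide integrable_exp_cosh assms)
  qed (use exp_cosh_tendsto_0[OF assms] in \<open>auto intro!: continuous_intros\<close>)
  then have "\<mu> * (2 * bessel_kint \<mu> z) - z * (bessel_kint (\<mu> + 1) z - bessel_kint (\<mu> - 1) z) = 0"
    unfolding eq bessel_kint_def using assms by (simp add: integrable_exp_cosh diff_divide_distrib)
  then show ?thesis using assms by (simp add: field_simps)
qed

text \<open>
  This form, with \<open>1 - \<mu>\<close> in place of \<open>\<mu> - 1\<close>, couples the orders \<open>\<mu>\<close> and \<open>1 - \<mu>\<close> only; for
  \<open>0 < \<mu> < 1\<close> both lie in that interval, where the behaviour at 0 is under control.
\<close>

lemma DERIV_bessel_kint: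
  assumes "z > 0"
  shows "(bessel_kint \<mu> has_real_derivative - bessel_kint (1 - \<mu>) z - \<mu> / z * bessel_kint \<mu> z) (at z)"
  by (rule DERIV_cong[OF DERIV_bessel_kint_avg[OF assms, of \<mu>]])
     (use bessel_kint_rec[OF assms, of \<mu>] bessel_kint_minus[of "1 - \<mu>" z] in \<open>simp add: field_simps\<close>)

text \<open>
  Euler's integral for \<open>Gamma\<close> after the substitution \<open>t = exp s\<close>.
\<close>

lemma integral_exp_exp:
  fixes \<mu> :: real
  assumes "\<mu> > 0"
  shows "integrable lborel (\<lambda>s. exp (\<mu> * s - exp s))"
    and "(\<integral>s. exp (\<mu> * s - exp s) \<partial>lborel) = Gamma \<mu>"
proof -
  let ?f = "\<lambda>t::real. t powr (\<mu> - 1) / exp t"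
  have hi0: "(?f has_integral Gamma \<mu>) {0..}" by (rule Gamma_integral_real[OF assms])
  have hi: "(?f has_integral Gamma \<mu>) {0<..}"
  proof -
    have "{t::real \<in> {0<..} - {0..}. ?f t \<noteq> 0} = {}" "{t::real \<in> {0..} - {0<..}. ?f t \<noteq> 0} = {}" by auto
    with hi0 show ?thesis by (subst has_integral_spike_set_eq[where T="{0..}"]) (simp_all only: negligible_empty)
  qed
  have ai: "?f absolutely_integrable_on {0<..}"
    using hi by (intro nonnegative_absolutely_integrable_1) auto
  have r: "exp ` (UNIV :: real set) = {0<..}" by (auto simp: image_iff) (metis exp_ln)
  have "(\<lambda>x. \<bar>exp x\<bar> * ?f (exp x)) absolutely_integrable_on UNIV \<and>
        integral UNIV (\<lambda>x. \<bar>exp x\<bar> * ?f (exp x)) = Gamma \<mu>"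
    by (subst has_absolute_integral_change_of_variables_1')
       (use ai hi r in \<open>auto intro!: derivative_eq_intros simp: inj_on_def has_integral_iff\<close>)
  moreover have "(\<lambda>x. \<bar>exp x\<bar> * ?f (exp x)) = (\<lambda>s. exp (\<mu> * s - exp s))"
    by (rule ext) (simp add: powr_def exp_diff left_diff_distrib)
  ultimately have *: "(\<lambda>s. exp (\<mu> * s - exp s)) absolutely_integrable_on UNIV"
     "integral UNIV (\<lambda>s. exp (\<mu> * s - exp s)) = Gamma \<mu>" by auto
  have m: "(\<lambda>s::real. exp (\<mu> * s - exp s)) \<in> borel_measurable lborel"
    by (auto intro!: borel_measurable_continuous_onI continuous_intros)
  show i: "integrable lborel (\<lambda>s. exp (\<mu> * s - exp s))"
    using *(1) integrable_completion[OF m] by (simp add: set_integrable_def)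
  show "(\<integral>s. exp (\<mu> * s - exp s) \<partial>lborel) = Gamma \<mu>"
    using *(2) integral_lborel[OF i] by simp
qed

text \<open>
  Translating \<open>t\<close> by \<open>ln (2 / z)\<close> isolates the singular factor \<open>z powr - \<mu>\<close>; the remaining integrand
  increases to that of \<open>Gamma \<mu>\<close> as \<open>z\<close> decreases to 0. This gives both the limit and the bound below.
\<close>

lemma bessel_kint_shift:
  assumes "z > 0"
  shows "z powr \<mu> * bessel_kint \<mu> z = 2 powr \<mu> / 2 * (\<integral>s. exp (\<mu> * s - exp s - z\<^sup>2 / 4 * exp (- s)) \<partial>lborel)"
proof -
  have e: "exp (\<mu> * (- ln (z / 2) + s) - z * cosh (- ln (z / 2) + s))
     = (2 / z) powr \<mu> * exp (\<mu> * s - exp s - z\<^sup>2 / 4 * exp (- s))" for s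
  proof -
    have "exp (- ln (z / 2) + s) = 2 / z * exp s" using assms by (simp add: exp_add exp_minus exp_diff)
    moreover have "exp (- (- ln (z / 2) + s)) = z / 2 * exp (- s)" using assms by (simp add: exp_diff exp_minus field_simps)
    ultimately have "z * cosh (- ln (z / 2) + s) = exp s + z\<^sup>2 / 4 * exp (- s)"
      unfolding cosh_def using assms by (simp add: field_simps power2_eq_square)
    moreover have "(2 / z) powr \<mu> = exp (- \<mu> * ln (z / 2))"
      using assms by (simp add: powr_def ln_div algebra_simps)
    ultimately show ?thesis by (simp add: algebra_simps flip: exp_add)
  qed
  have "bessel_kint \<mu> z = (2 / z) powr \<mu> * (\<integral>s. exp (\<mu> * s - exp s - z\<^sup>2 / 4 * exp (- s)) \<partial>lborel) / 2"
    unfolding bessel_kint_def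
    by (subst lborel_integral_real_affine[where c=1 and t="- ln (z/2)"], simp, unfold mult_1 e) simp
  then show ?thesis using assms by (simp add: powr_divide)
qed

lemma bessel_kint_tendsto_0:
  assumes "\<mu> > 0"
  shows "((\<lambda>z. z powr \<mu> * bessel_kint \<mu> z) \<longlongrightarrow> 2 powr \<mu> / 2 * Gamma \<mu>) (at_right 0)"
proof -
  have "((\<lambda>z. \<integral>s. exp (\<mu> * s - exp s - z\<^sup>2 / 4 * exp (- s)) \<partial>lborel) \<longlongrightarrow> (\<integral>s. exp (\<mu> * s - exp s) \<partial>lborel)) (at_right 0)"
  proof (rule integral_tendsto_within_dominated[where w="\<lambda>s. exp (\<mu> * s - exp s)"])
    show "((\<lambda>z. exp (\<mu> * s - exp s - z\<^sup>2 / 4 * exp (- s))) \<longlongrightarrow> exp (\<mu> * s - exp s)) (at_right 0)" for s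
      by (auto intro!: tendsto_eq_intros)
  qed (auto intro!: borel_measurable_continuous_onI continuous_intros integral_exp_exp assms)
  from tendsto_mult_left[OF this, of "2 powr \<mu> / 2"] integral_exp_exp(2)[OF assms]
  have "((\<lambda>z. 2 powr \<mu> / 2 * (\<integral>s. exp (\<mu> * s - exp s - z\<^sup>2 / 4 * exp (- s)) \<partial>lborel)) \<longlongrightarrow> 2 powr \<mu> / 2 * Gamma \<mu>) (at_right 0)"
    by simp
  moreover have "\<forall>\<^sub>F z in at_right 0. 2 powr \<mu> / 2 * (\<integral>s. exp (\<mu> * s - exp s - z\<^sup>2 / 4 * exp (- s)) \<partial>lborel) = z powr \<mu> * bessel_kint \<mu> z"
    unfolding eventually_at_right_field by (intro exI[of _ 1]) (simp add: bessel_kint_shift)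
  ultimately show ?thesis by (rule Lim_transform_eventually)
qed

lemma bessel_kint_le:
  assumes "\<mu> > 0" "z > 0"
  shows "z powr \<mu> * bessel_kint \<mu> z \<le> 2 powr \<mu> / 2 * Gamma \<mu>"
proof -
  have i: "integrable lborel (\<lambda>s. exp (\<mu> * s - exp s - z\<^sup>2 / 4 * exp (- s)))"
    by (rule Bochner_Integration.integrable_bound[OF integral_exp_exp(1)[OF assms(1)]])
       (auto intro!: borel_measurable_continuous_onI continuous_intros AE_I2)
  have "(\<integral>s. exp (\<mu> * s - exp s - z\<^sup>2 / 4 * exp (- s)) \<partial>lborel) \<le> Gamma \<mu>"
    unfolding integral_exp_exp(2)[OF assms(1), symmetric]
    by (rule integral_mono[OF i integral_exp_exp(1)[OF assms(1)]]) auto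
  then show ?thesis unfolding bessel_kint_shift[OF assms(2)] by simp
qed

lemma bessel_kint_mono_order:
  assumes "0 \<le> \<mu>" "\<mu> \<le> \<mu>'" "z > 0"
  shows "bessel_kint \<mu> z \<le> bessel_kint \<mu>' z"
proof -
  have c: "bessel_kint \<mu> z = (\<integral>t. cosh (\<mu> * t) * exp (- (z * cosh t)) \<partial>lborel) / 2" for \<mu>
  proof -
    have "cosh (\<mu> * t) * exp (- (z * cosh t)) = (exp (\<mu> * t - z * cosh t) + exp ((- \<mu>) * t - z * cosh t)) / 2" for t
      by (simp add: cosh_def[of "\<mu> * t"] field_simps exp_diff exp_minus)
    then have "(\<integral>t. cosh (\<mu> * t) * exp (- (z * cosh t)) \<partial>lborel) = (2 * bessel_kint \<mu> z + 2 * bessel_kint (- \<mu>) z) / 2"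
      unfolding bessel_kint_def
      using integrable_exp_cosh[OF assms(3), of \<mu>] integrable_exp_cosh[OF assms(3), of "- \<mu>"]
      by (simp add: add_divide_distrib)
    then show ?thesis by (simp add: bessel_kint_minus)
  qed
  have i: "integrable lborel (\<lambda>t. cosh (\<mu> * t) * exp (- (z * cosh t)))" for \<mu>
  proof -
    have "cosh (\<mu> * t) * exp (- (z * cosh t)) = (exp (\<mu> * t - z * cosh t) + exp ((- \<mu>) * t - z * cosh t)) / 2" for t
      by (simp add: cosh_def[of "\<mu> * t"] field_simps exp_diff exp_minus)
    then show ?thesis by (simp only:) (intro Bochner_Integration.integrable_divide
        Bochner_Integration.integrable_add integrable_exp_cosh assms)
  qed
  have "(\<integral>t. cosh (\<mu> * t) * exp (- (z * cosh t)) \<partial>lborel) \<le> (\<integral>t. cosh (\<mu>' * t) * exp (- (z * cosh t)) \<partial>lborel)"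
  proof (rule integral_mono[OF i i])
    fix t
    have "cosh (\<mu> * t) = cosh (\<mu> * \<bar>t\<bar>)" by (simp add: abs_if cosh_minus)
    also have "\<dots> \<le> cosh (\<mu>' * \<bar>t\<bar>)"
      using assms by (subst cosh_real_nonneg_le_iff) (auto intro: mult_right_mono)
    also have "\<dots> = cosh (\<mu>' * t)" by (simp add: abs_if cosh_minus)
    finally show "cosh (\<mu> * t) * exp (- (z * cosh t)) \<le> cosh (\<mu>' * t) * exp (- (z * cosh t))"
      by (simp add: mult_right_mono)
  qed
  then show ?thesis unfolding c by simp
qed

text \<open>
  The modified Bessel function of integer order is a limit in the order, so continuity in the order is needed.
\<close>

lemma bessel_kint_isCont_order:
  assumes "z > 0"
  shows "isCont (\<lambda>\<mu>. bessel_kint \<mu> z) \<mu>"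
proof -
  define w where "w t = exp ((\<bar>\<mu>\<bar> + 1) * t - z * cosh t) + exp ((- (\<bar>\<mu>\<bar> + 1)) * t - z * cosh t)" for t
  have nt: "at \<mu> within ball \<mu> 1 = at \<mu>" by (intro at_within_open) auto
  have "((\<lambda>\<mu>. \<integral>t. exp (\<mu> * t - z * cosh t) \<partial>lborel) \<longlongrightarrow> (\<integral>t. exp (\<mu> * t - z * cosh t) \<partial>lborel)) (at \<mu> within ball \<mu> 1)"
  proof (rule integral_tendsto_within_dominated[where w=w])
    show "norm (exp (\<mu>' * t - z * cosh t)) \<le> w t" if "\<mu>' \<in> ball \<mu> 1" for \<mu>' t
    proof -
      have "\<bar>\<mu>'\<bar> \<le> \<bar>\<mu>\<bar> + 1" using that by (auto simp: dist_real_def)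
      then have "\<bar>\<mu>'\<bar> * \<bar>t\<bar> \<le> (\<bar>\<mu>\<bar> + 1) * \<bar>t\<bar>" by (intro mult_right_mono) auto
      then have "\<mu>' * t \<le> (\<bar>\<mu>\<bar> + 1) * \<bar>t\<bar>"
        using abs_ge_self[of "\<mu>' * t"] unfolding abs_mult by linarith
      then have "exp (\<mu>' * t - z * cosh t) \<le> exp ((\<bar>\<mu>\<bar> + 1) * \<bar>t\<bar> - z * cosh t)" by simp
      also have "\<dots> \<le> w t" unfolding w_def by (cases "t \<ge> 0") (auto simp: algebra_simps)
      finally show ?thesis by simp
    qed
    show "integrable lborel w" unfolding w_def
      by (intro Bochner_Integration.integrable_add integrable_exp_cosh assms)
    show "((\<lambda>\<mu>. exp (\<mu> * t - z * cosh t)) \<longlongrightarrow> exp (\<mu> * t - z * cosh t)) (at \<mu> within ball \<mu> 1)" for t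
      by (auto intro!: tendsto_intros)
  qed (auto intro!: borel_measurable_continuous_onI continuous_intros)
  then show ?thesis unfolding isCont_def bessel_kint_def nt by (auto intro!: tendsto_divide)
qed

lemma rGamma_reflection_real: "rGamma x * rGamma (1 - x) = sin (pi * x) / pi" for x :: real
proof -
  have "complex_of_real (rGamma x * rGamma (1 - x)) = complex_of_real (sin (pi * x) / pi)"
  proof -
    have "complex_of_real (rGamma x * rGamma (1 - x)) = rGamma (complex_of_real x) * rGamma (1 - complex_of_real x)"
      by (metis of_real_mult rGamma_complex_of_real of_real_diff of_real_1)
    also have "\<dots> = sin (of_real pi * complex_of_real x) / of_real pi"
      by (rule rGamma_reflection_complex)
    also have "\<dots> = complex_of_real (sin (pi * x) / pi)"
      by (metis of_real_mult of_real_divide sin_of_real)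
    finally show ?thesis .
  qed
  then show ?thesis by (simp only: of_real_eq_iff)
qed

text \<open>
  The quotient whose limit in the order defines \<open>besselK\<close>.
\<close>

definition bessel_conn :: "real \<Rightarrow> real \<Rightarrow> real" where
  "bessel_conn \<mu> z = pi / 2 * (besselI (- \<mu>) z - besselI \<mu> z) / sin (\<mu> * pi)"

lemma bessel_conn_minus: "bessel_conn (- \<mu>) z = bessel_conn \<mu> z"
  by (simp add: bessel_conn_def minus_divide_left[symmetric] algebra_simps diff_divide_distrib)

lemma bessel_conn_one_minus:
  "bessel_conn (1 - \<mu>) z = pi / 2 * (besselI (\<mu> - 1) z - besselI (1 - \<mu>) z) / sin (\<mu> * pi)"
proof -
  have "sin ((1 - \<mu>) * pi) = sin (\<mu> * pi)" by (simp add: left_diff_distrib)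
  then show ?thesis by (simp add: bessel_conn_def)
qed

lemma DERIV_bessel_conn:
  assumes "z > 0"
  shows "(bessel_conn \<mu> has_real_derivative - bessel_conn (1 - \<mu>) z - \<mu> / z * bessel_conn \<mu> z) (at z)"
proof -
  have "((\<lambda>z. pi / 2 * (bessel_cyl 1 (- \<mu>) z - bessel_cyl 1 \<mu> z) / sin (\<mu> * pi)) has_real_derivative
     pi / 2 * (((- \<mu>) / z * bessel_cyl 1 (- \<mu>) z + 1 * bessel_cyl 1 (- \<mu> + 1) z)
        - (bessel_cyl 1 (\<mu> - 1) z - \<mu> / z * bessel_cyl 1 \<mu> z)) / sin (\<mu> * pi)) (at z)"
    by (intro DERIV_cdivide DERIV_cmult DERIV_diff DERIV_bessel_cyl DERIV_bessel_cyl' assms)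
  then show ?thesis
    unfolding bessel_conn_one_minus unfolding bessel_conn_def[abs_def] besselI_eq_cyl
    by (rule DERIV_cong) (simp add: algebra_simps add_divide_distrib diff_divide_distrib)
qed

lemma bessel_conn_rec:
  assumes "z > 0"
  shows "bessel_conn (\<mu> + 1) z = bessel_conn (\<mu> - 1) z + 2 * \<mu> / z * bessel_conn \<mu> z"
proof -
  have s: "sin ((\<mu> + 1) * pi) = - sin (\<mu> * pi)" "sin ((\<mu> - 1) * pi) = - sin (\<mu> * pi)"
    by (simp_all add: distrib_right left_diff_distrib)
  have 1: "besselI (- (\<mu> + 1)) z = - 2 * \<mu> / z * besselI (- \<mu>) z + besselI (1 - \<mu>) z"
  proof -
    have e: "- (\<mu> + 1) = - \<mu> - 1" "1 - \<mu> = - \<mu> + 1" by simp_all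
    show ?thesis using bessel_cyl_rec[OF assms, of 1 "- \<mu>"] unfolding e besselI_eq_cyl by simp
  qed
  have 2: "besselI (\<mu> + 1) z = besselI (\<mu> - 1) z - 2 * \<mu> / z * besselI \<mu> z"
    using bessel_cyl_rec[OF assms, of 1 "\<mu>"] by (simp add: besselI_eq_cyl add.commute)
  have 3: "- (\<mu> - 1) = 1 - \<mu>" by simp
  show ?thesis unfolding bessel_conn_def s 1 2 3
    by (simp add: algebra_simps add_divide_distrib diff_divide_distrib)
qed

lemma bessel_conn_tendsto_0:
  assumes "0 < \<mu>" "\<mu> < 1"
  shows "((\<lambda>z. z powr \<mu> * bessel_conn \<mu> z) \<longlongrightarrow> 2 powr \<mu> / 2 * Gamma \<mu>) (at_right 0)"
proof -
  have sp: "sin (\<mu> * pi) > 0" using assms by (intro sin_gt_zero) auto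
  have 1: "((\<lambda>z. z powr \<mu> * besselI (- \<mu>) z) \<longlongrightarrow> 2 powr \<mu> * rGamma (1 - \<mu>)) (at_right 0)"
    using bessel_cyl_tendsto_0[of "- \<mu>" 1] by (simp add: besselI_eq_cyl)
  have 2: "((\<lambda>z. z powr (2 * \<mu>) * (z powr (- \<mu>) * besselI \<mu> z)) \<longlongrightarrow> 0 * (2 powr (- \<mu>) * rGamma (\<mu> + 1))) (at_right 0)"
    unfolding besselI_eq_cyl
    by (intro tendsto_mult bessel_cyl_tendsto_0) (use assms in real_asymp)
  have 3: "\<forall>\<^sub>F z in at_right 0. z powr (2 * \<mu>) * (z powr (- \<mu>) * besselI \<mu> z) = z powr \<mu> * besselI \<mu> z"
    unfolding eventually_at_right_field
    by (intro exI[of _ 1]) (auto simp: powr_add[symmetric] mult.assoc[symmetric])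
  have 4: "((\<lambda>z. z powr \<mu> * besselI \<mu> z) \<longlongrightarrow> 0) (at_right 0)"
    using Lim_transform_eventually[OF 2 3] by simp
  have "((\<lambda>z. pi / 2 * (z powr \<mu> * besselI (- \<mu>) z - z powr \<mu> * besselI \<mu> z) / sin (\<mu> * pi))
     \<longlongrightarrow> pi / 2 * (2 powr \<mu> * rGamma (1 - \<mu>) - 0) / sin (\<mu> * pi)) (at_right 0)"
    by (intro tendsto_intros 1 4) (use sp in auto)
  moreover have "pi / 2 * (2 powr \<mu> * rGamma (1 - \<mu>) - 0) / sin (\<mu> * pi) = 2 powr \<mu> / 2 * Gamma \<mu>"
  proof -
    have "rGamma \<mu> * rGamma (1 - \<mu>) = sin (\<mu> * pi) / pi"
      using rGamma_reflection_real[of \<mu>] by (simp add: mult.commute)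
    moreover have "rGamma \<mu> = inverse (Gamma \<mu>)" by (simp add: rGamma_inverse_Gamma)
    moreover have "Gamma \<mu> > 0" using assms by simp
    ultimately show ?thesis using sp by (simp add: field_simps)
  qed
  moreover have "(\<lambda>z. pi / 2 * (z powr \<mu> * besselI (- \<mu>) z - z powr \<mu> * besselI \<mu> z) / sin (\<mu> * pi))
     = (\<lambda>z. z powr \<mu> * bessel_conn \<mu> z)"
    by (auto simp: bessel_conn_def fun_eq_iff algebra_simps diff_divide_distrib)
  ultimately show ?thesis by (simp only:)
qed

lemma bessel_ser_pos:
  assumes "\<nu> > - 1" "X \<ge> 0"
  shows "bessel_ser 1 \<nu> X > 0"
proof -
  have g: "rGamma (real m + \<nu> + 1) > 0" for m
    using assms by (simp add: rGamma_inverse_Gamma)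
  show ?thesis unfolding bessel_ser_def
    by (rule suminf_pos2[OF summable_bessel_ser[of 1], where i=0]) (use g g[of 0] assms in \<open>auto simp: less_imp_le\<close>)
qed

lemma besselI_pos:
  assumes "\<nu> > - 1" "z > 0"
  shows "besselI \<nu> z > 0"
  unfolding besselI_eq_cyl bessel_cyl_def using bessel_ser_pos[OF assms(1)] assms by simp

text \<open>
  The difference \<open>D\<close> of the two sides satisfies, in the orders \<open>\<mu>\<close> and \<open>1 - \<mu>\<close>, the same first-order system as the
  pair itself, and it is of smaller order at 0. The Wronskian-type combination \<open>W\<close> with \<open>I\<close> of orders \<open>\<mu>\<close> and
  \<open>\<mu> - 1\<close> is constant and vanishes at 0; hence \<open>D \<mu>\<close> is a constant multiple of \<open>besselI \<mu>\<close>, and its partner of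
  order \<open>1 - \<mu>\<close> would then be too singular at 0 unless the constant is zero.
\<close>

lemma bessel_conn_eq_kint_01:
  assumes "0 < \<mu>" "\<mu> < 1" "z > 0"
  shows "bessel_conn \<mu> z = bessel_kint \<mu> z"
proof -
  define D where "D \<mu> z = bessel_kint \<mu> z - bessel_conn \<mu> z" for \<mu> z
  have dD: "(D \<mu> has_real_derivative - D (1 - \<mu>) z - \<mu> / z * D \<mu> z) (at z)" if "z > 0" for \<mu> z
    unfolding D_def[abs_def]
    by (rule DERIV_cong[OF DERIV_diff[OF DERIV_bessel_kint[OF that] DERIV_bessel_conn[OF that]]])
       (simp add: algebra_simps)
  have D0: "((\<lambda>z. z powr \<mu> * D \<mu> z) \<longlongrightarrow> 0) (at_right 0)" if "0 < \<mu>" "\<mu> < 1" for \<mu>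
    using tendsto_diff[OF bessel_kint_tendsto_0[OF that(1)] bessel_conn_tendsto_0[OF that]]
    by (simp add: D_def algebra_simps)
  define I0 where "I0 = besselI \<mu>"
  define I1 where "I1 = besselI (\<mu> - 1)"
  have dI0: "(I0 has_real_derivative I1 z - \<mu> / z * I0 z) (at z)" if "z > 0" for z
    using DERIV_bessel_cyl'[OF that, of 1 \<mu>] by (simp add: I0_def I1_def besselI_eq_cyl[abs_def])
  have dI1: "(I1 has_real_derivative (\<mu> - 1) / z * I1 z + I0 z) (at z)" if "z > 0" for z
    using DERIV_bessel_cyl[OF that, of 1 "\<mu> - 1"] by (simp add: I0_def I1_def besselI_eq_cyl[abs_def])
  define W where "W z = z * (D (1 - \<mu>) z * I0 z + D \<mu> z * I1 z)" for z
  have I1lim: "((\<lambda>z. z powr (1 - \<mu>) * I1 z) \<longlongrightarrow> 2 powr (1 - \<mu>) * rGamma \<mu>) (at_right 0)"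
    using bessel_cyl_tendsto_0[of "\<mu> - 1" 1] by (simp add: I1_def besselI_eq_cyl)
  have I0lim: "((\<lambda>z. z powr \<mu> * I0 z) \<longlongrightarrow> 0) (at_right 0)"
  proof -
    have 2: "((\<lambda>z. z powr (2 * \<mu>) * (z powr (- \<mu>) * besselI \<mu> z)) \<longlongrightarrow> 0 * (2 powr (- \<mu>) * rGamma (\<mu> + 1))) (at_right 0)"
      unfolding besselI_eq_cyl
      by (intro tendsto_mult bessel_cyl_tendsto_0) (use assms in real_asymp)
    have 3: "\<forall>\<^sub>F z in at_right 0. z powr (2 * \<mu>) * (z powr (- \<mu>) * besselI \<mu> z) = z powr \<mu> * I0 z"
      unfolding eventually_at_right_field I0_def
      by (intro exI[of _ 1]) (auto simp: powr_add[symmetric] mult.assoc[symmetric])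
    show ?thesis using Lim_transform_eventually[OF 2 3] by simp
  qed
  have "(W has_real_derivative 0) (at z)" if z: "z > 0" for z
  proof -
    have d1: "(D (1 - \<mu>) has_real_derivative - D \<mu> z - (1 - \<mu>) / z * D (1 - \<mu>) z) (at z)"
      using dD[OF z, of "1 - \<mu>"] by simp
    show ?thesis unfolding W_def[abs_def]
      by (rule DERIV_cong[OF DERIV_mult[OF DERIV_ident DERIV_add[OF DERIV_mult[OF d1 dI0[OF z]] DERIV_mult[OF dD[OF z] dI1[OF z]]]]])
         (use z in \<open>simp add: field_simps\<close>)
  qed
  then obtain c where c: "W z = c" if "z > 0" for z
    using has_field_derivative_zero_constant[of "{0<..}" W]
    by (auto intro: has_field_derivative_at_within)
  have "(W \<longlongrightarrow> 0) (at_right 0)"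
  proof -
    have "((\<lambda>z. (z powr (1 - \<mu>) * D (1 - \<mu>) z) * (z powr \<mu> * I0 z) + (z powr \<mu> * D \<mu> z) * (z powr (1 - \<mu>) * I1 z))
       \<longlongrightarrow> 0 * 0 + 0 * (2 powr (1 - \<mu>) * rGamma \<mu>)) (at_right 0)"
      by (intro tendsto_intros D0 I0lim I1lim) (use assms in auto)
    moreover have "\<forall>\<^sub>F z in at_right 0. (z powr (1 - \<mu>) * D (1 - \<mu>) z) * (z powr \<mu> * I0 z) + (z powr \<mu> * D \<mu> z) * (z powr (1 - \<mu>) * I1 z) = W z"
      unfolding eventually_at_right_field
    proof (intro exI[of _ 1] conjI allI impI)
      fix z :: real assume "0 < z" "z < 1"
      then have "z powr (1 - \<mu>) * z powr \<mu> = z" by (simp flip: powr_add)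
      moreover have "(z powr (1 - \<mu>) * D (1 - \<mu>) z) * (z powr \<mu> * I0 z) + (z powr \<mu> * D \<mu> z) * (z powr (1 - \<mu>) * I1 z)
        = (z powr (1 - \<mu>) * z powr \<mu>) * (D (1 - \<mu>) z * I0 z + D \<mu> z * I1 z)" by (simp add: algebra_simps)
      ultimately show "(z powr (1 - \<mu>) * D (1 - \<mu>) z) * (z powr \<mu> * I0 z) + (z powr \<mu> * D \<mu> z) * (z powr (1 - \<mu>) * I1 z) = W z"
        by (simp add: W_def)
    qed simp
    ultimately show ?thesis using Lim_transform_eventually by fastforce
  qed
  moreover have "(W \<longlongrightarrow> c) (at_right 0)"
    by (rule Lim_transform_eventually[OF tendsto_const])
       (use c in \<open>auto simp: eventually_at_right_field intro!: exI[of _ 1]\<close>)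
  ultimately have c0: "c = 0" using tendsto_unique trivial_limit_at_right_real by blast
  have I0p: "I0 z > 0" if "z > 0" for z unfolding I0_def using assms that by (intro besselI_pos) auto
  have D1: "D (1 - \<mu>) z = - D \<mu> z * I1 z / I0 z" if "z > 0" for z
  proof -
    have "D (1 - \<mu>) z * I0 z + D \<mu> z * I1 z = 0" using c[OF that] c0 that by (simp add: W_def)
    then have "D (1 - \<mu>) z * I0 z = - D \<mu> z * I1 z" by linarith
    then show ?thesis using I0p[OF that] by (metis less_irrefl nonzero_mult_div_cancel_right)
  qed
  \<comment> \<open>As \<open>W\<close> vanishes, \<open>D \<mu>\<close> solves the same first-order linear equation as \<open>I0\<close>.\<close>
  have "((\<lambda>z. D \<mu> z / I0 z) has_real_derivative 0) (at z)" if z: "z > 0" for z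
    by (rule DERIV_cong[OF DERIV_divide[OF dD[OF z] dI0[OF z]]])
       (use I0p[OF z] D1[OF z] z in \<open>simp_all add: field_simps\<close>)
  then obtain r where r: "D \<mu> z / I0 z = r" if "z > 0" for z
    using has_field_derivative_zero_constant[of "{0<..}" "\<lambda>z. D \<mu> z / I0 z"]
    by (auto intro: has_field_derivative_at_within)
  \<comment> \<open>The limit of \<open>z powr (1 - \<mu>) * D (1 - \<mu>) z\<close> at 0 is computed in two ways to get \<open>r = 0\<close>.\<close>
  have "((\<lambda>z. - r * (z powr (1 - \<mu>) * I1 z)) \<longlongrightarrow> - r * (2 powr (1 - \<mu>) * rGamma \<mu>)) (at_right 0)"
    by (intro tendsto_intros I1lim)
  moreover have "\<forall>\<^sub>F z in at_right 0. - r * (z powr (1 - \<mu>) * I1 z) = z powr (1 - \<mu>) * D (1 - \<mu>) z"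
    unfolding eventually_at_right_field
  proof (intro exI[of _ 1] conjI allI impI)
    fix z :: real assume "0 < z" "z < 1"
    then show "- r * (z powr (1 - \<mu>) * I1 z) = z powr (1 - \<mu>) * D (1 - \<mu>) z"
    proof -
      have "D \<mu> z = r * I0 z" using r[of z] I0p[of z] \<open>0 < z\<close> by (simp add: divide_eq_eq)
      then have "D (1 - \<mu>) z = - r * I1 z" using D1[of z] I0p[of z] \<open>0 < z\<close> by simp
      then show ?thesis by simp
    qed
  qed simp
  ultimately have "((\<lambda>z. z powr (1 - \<mu>) * D (1 - \<mu>) z) \<longlongrightarrow> - r * (2 powr (1 - \<mu>) * rGamma \<mu>)) (at_right 0)"
    by (rule Lim_transform_eventually)
  moreover have "((\<lambda>z. z powr (1 - \<mu>) * D (1 - \<mu>) z) \<longlongrightarrow> 0) (at_right 0)"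
    by (rule D0) (use assms in auto)
  ultimately have "- r * (2 powr (1 - \<mu>) * rGamma \<mu>) = 0"
    using tendsto_unique trivial_limit_at_right_real by blast
  moreover have "rGamma \<mu> \<noteq> 0" using assms by (simp add: rGamma_inverse_Gamma less_imp_neq[symmetric])
  ultimately have "r = 0" by simp
  then have "D \<mu> z = 0" using r[OF assms(3)] I0p[OF assms(3)] by simp
  then show ?thesis by (simp add: D_def)
qed

text \<open>
  The recurrence in the order carries the identity from the interval between 0 and 1 to the next one, so that
  order 1 has a punctured neighbourhood in which it holds.
\<close>

lemma bessel_conn_eq_kint_12:
  assumes "1 < \<mu>" "\<mu> < 2" "z > 0"
  shows "bessel_conn \<mu> z = bessel_kint \<mu> z"
proof -
  have "bessel_conn (\<mu> - 2) z = bessel_kint (\<mu> - 2) z"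
    using bessel_conn_eq_kint_01[of "2 - \<mu>" z] bessel_conn_minus[of "2 - \<mu>" z] bessel_kint_minus[of "2 - \<mu>" z] assms
    by simp
  moreover have "bessel_conn (\<mu> - 1) z = bessel_kint (\<mu> - 1) z"
    by (rule bessel_conn_eq_kint_01) (use assms in auto)
  ultimately show ?thesis
    using bessel_conn_rec[OF assms(3), of "\<mu> - 1"] bessel_kint_rec[OF assms(3), of "\<mu> - 1"] by simp
qed

text \<open>
  The defining limit runs over orders different from \<open>\<nu>\<close>, where the quotient equals an integral that is continuous
  in the order.
\<close>

lemma besselK_eq_kint:
  assumes "z > 0" "\<And>\<mu>. \<mu> \<noteq> \<nu> \<Longrightarrow> \<bar>\<mu> - \<nu>\<bar> < 1 \<Longrightarrow> bessel_conn \<mu> z = bessel_kint \<mu> z"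
  shows "besselK \<nu> z = bessel_kint \<nu> z"
proof -
  have "((\<lambda>\<mu>. bessel_kint \<mu> z) \<longlongrightarrow> bessel_kint \<nu> z) (at \<nu>)"
    using bessel_kint_isCont_order[OF assms(1), of \<nu>] by (simp add: isCont_def)
  moreover have "\<forall>\<^sub>F \<mu> in at \<nu>. bessel_kint \<mu> z = bessel_conn \<mu> z"
    unfolding eventually_at by (intro exI[of _ 1]) (use assms(2) in \<open>auto simp: dist_real_def\<close>)
  ultimately have "((\<lambda>\<mu>. bessel_conn \<mu> z) \<longlongrightarrow> bessel_kint \<nu> z) (at \<nu>)"
    by (rule Lim_transform_eventually)
  then show ?thesis unfolding besselK_def bessel_conn_def by (intro tendsto_Lim) auto
qed

lemma besselK_0:
  assumes "z > 0"
  shows "besselK 0 z = bessel_kint 0 z"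
proof (rule besselK_eq_kint[OF assms])
  fix \<mu> :: real assume "\<mu> \<noteq> 0" "\<bar>\<mu> - 0\<bar> < 1"
  then show "bessel_conn \<mu> z = bessel_kint \<mu> z"
    using bessel_conn_eq_kint_01[of \<mu> z] bessel_conn_eq_kint_01[of "- \<mu>" z] assms
    by (cases "\<mu> > 0") (auto simp: bessel_conn_minus bessel_kint_minus)
qed

lemma besselK_1:
  assumes "z > 0"
  shows "besselK 1 z = bessel_kint 1 z"
proof (rule besselK_eq_kint[OF assms])
  fix \<mu> :: real assume "\<mu> \<noteq> 1" "\<bar>\<mu> - 1\<bar> < 1"
  then show "bessel_conn \<mu> z = bessel_kint \<mu> z"
    using bessel_conn_eq_kint_01[of \<mu> z] bessel_conn_eq_kint_12[of "\<mu>" z] assms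
    by (cases "\<mu> > 1") auto
qed

section \<open>The second derivative of F\<close>

text \<open>
  The logarithmic derivative of \<open>sinhc\<close>, the Langevin function \<open>coth u - 1 / u\<close>.
\<close>

definition sinhc_logderiv :: "real \<Rightarrow> real" where
  "sinhc_logderiv u = (if u = 0 then 0 else (u * cosh u - sinh u) / (u * sinh u))"

lemma sinh_ge: "u \<ge> 0 \<Longrightarrow> sinh u \<ge> u" for u :: real
proof -
  assume u: "u \<ge> 0"
  have "sinh 0 - 0 \<le> sinh u - u"
    by (rule DERIV_nonneg_imp_nondecreasing[OF u])
       (auto intro!: exI derivative_eq_intros simp: cosh_real_ge_1)
  then show ?thesis by simp
qed

lemma u_cosh_minus_sinh_bounds:
  fixes u :: real
  assumes "u \<ge> 0"
  shows "0 \<le> u * cosh u - sinh u" "u * cosh u - sinh u \<le> u\<^sup>2 * sinh u"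
proof -
  have "0 * cosh 0 - sinh 0 \<le> u * cosh u - sinh u"
    by (rule DERIV_nonneg_imp_nondecreasing[OF assms, where f="\<lambda>u. u * cosh u - sinh u"])
       (auto intro!: exI derivative_eq_intros)
  then show "0 \<le> u * cosh u - sinh u" by simp
  have "0\<^sup>2 * sinh 0 - (0 * cosh 0 - sinh 0) \<le> u\<^sup>2 * sinh u - (u * cosh u - sinh u)"
  proof (rule DERIV_nonneg_imp_nondecreasing[OF assms, where f="\<lambda>u. u\<^sup>2 * sinh u - (u * cosh u - sinh u)"])
    fix v :: real assume v: "0 \<le> v" "v \<le> u"
    show "\<exists>y. ((\<lambda>u. u\<^sup>2 * sinh u - (u * cosh u - sinh u)) has_real_derivative y) (at v) \<and> 0 \<le> y"
    proof (intro exI conjI)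
      show "((\<lambda>u. u\<^sup>2 * sinh u - (u * cosh u - sinh u)) has_real_derivative v * sinh v + v\<^sup>2 * cosh v) (at v)"
        by (auto intro!: derivative_eq_intros simp: algebra_simps)
      show "0 \<le> v * sinh v + v\<^sup>2 * cosh v" using v by (simp add: cosh_real_nonneg)
    qed
  qed
  then show "u * cosh u - sinh u \<le> u\<^sup>2 * sinh u" by simp
qed

lemma sinhc_logderiv_minus: "sinhc_logderiv (- u) = - sinhc_logderiv u"
  by (simp add: sinhc_logderiv_def cosh_minus sinh_minus minus_divide_left[symmetric] diff_divide_distrib)

lemma sinhc_minus: "sinhc (- u) = sinhc u"
  by (simp add: sinhc_def sinh_minus)

lemma sinhc_ge_1: "sinhc u \<ge> 1"
proof -
  have "sinhc v \<ge> 1" if "v \<ge> 0" for v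
    using that sinh_ge[of v] by (cases "v = 0") (auto simp: sinhc_def)
  from this[of u] this[of "- u"] show ?thesis by (cases "u \<ge> 0") (auto simp: sinhc_minus)
qed

lemma abs_sinhc_logderiv_le: "\<bar>sinhc_logderiv u\<bar> \<le> \<bar>u\<bar>"
proof -
  have "\<bar>sinhc_logderiv v\<bar> \<le> v" if "v > 0" for v
  proof -
    have s: "sinh v > 0" using that by simp
    have "v * cosh v - sinh v \<le> v * (v * sinh v)"
      using u_cosh_minus_sinh_bounds[of v] that by (simp add: power2_eq_square mult_ac)
    then show ?thesis using u_cosh_minus_sinh_bounds[of v] that s
      by (simp add: sinhc_logderiv_def divide_simps)
  qed
  from this[of u] this[of "- u"] show ?thesis
    by (cases u "0::real" rule: linorder_cases) (auto simp: sinhc_logderiv_minus sinhc_logderiv_def[of 0])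
qed

lemma sinhc_logderiv_lim: "((\<lambda>u. sinhc_logderiv u / u) \<longlongrightarrow> 1 / 3) (at 0)"
proof -
  have r: "((\<lambda>u. sinhc_logderiv u / u) \<longlongrightarrow> 1 / 3) (at_right 0)"
  proof (rule Lim_transform_eventually)
    show "((\<lambda>u::real. (u * cosh u - sinh u) / (u * sinh u) / u) \<longlongrightarrow> 1 / 3) (at_right 0)"
      by real_asymp
    show "\<forall>\<^sub>F u in at_right 0. (u * cosh u - sinh u) / (u * sinh u) / u = sinhc_logderiv u / u"
      unfolding eventually_at_right_field by (intro exI[of _ 1]) (auto simp: sinhc_logderiv_def)
  qed
  have "((\<lambda>u. sinhc_logderiv (- u) / (- u)) \<longlongrightarrow> 1 / 3) (at_left 0)"
    using r filterlim_at_left_to_right[of "\<lambda>u. sinhc_logderiv (- u) / (- u)" "nhds (1/3)" 0] by simp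
  then have "((\<lambda>u. sinhc_logderiv u / u) \<longlongrightarrow> 1 / 3) (at_left 0)"
    by (simp add: sinhc_logderiv_minus)
  with r show ?thesis by (simp add: filterlim_split_at)
qed

lemma DERIV_sinhc: "(sinhc has_real_derivative sinhc u * sinhc_logderiv u) (at u)"
proof (cases "u = 0")
  case False
  have "((\<lambda>u. sinh u / u) has_real_derivative (cosh u * u - sinh u) / (u * u)) (at u)"
    using False by (auto intro!: derivative_eq_intros)
  moreover have "(cosh u * u - sinh u) / (u * u) = sinhc u * sinhc_logderiv u"
    using False by (simp add: sinhc_def sinhc_logderiv_def field_simps)
  ultimately have "((\<lambda>u. sinh u / u) has_real_derivative sinhc u * sinhc_logderiv u) (at u)" by simp
  moreover have "\<forall>\<^sub>F v in nhds u. sinh v / v = sinhc v"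
    using False by (intro eventually_mono[OF t1_space_nhds[of u 0]]) (auto simp: sinhc_def)
  ultimately show ?thesis by (subst (asm) DERIV_cong_ev[OF refl _ refl]) auto
next
  case True
  have r: "((\<lambda>h. (sinhc h - 1) / h) \<longlongrightarrow> 0) (at_right 0)"
  proof (rule Lim_transform_eventually)
    show "((\<lambda>h::real. (sinh h / h - 1) / h) \<longlongrightarrow> 0) (at_right 0)" by real_asymp
    show "\<forall>\<^sub>F h in at_right 0. (sinh h / h - 1) / h = (sinhc h - 1) / h"
      unfolding eventually_at_right_field by (intro exI[of _ 1]) (auto simp: sinhc_def)
  qed
  have "((\<lambda>h. - ((sinhc (- h) - 1) / (- h))) \<longlongrightarrow> - 0) (at_left 0)"
    using r filterlim_at_left_to_right[of "\<lambda>h. (sinhc (- h) - 1) / (- h)" "nhds 0" 0]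
    by (intro tendsto_minus) simp
  then have "((\<lambda>h. (sinhc h - 1) / h) \<longlongrightarrow> 0) (at_left 0)"
    by (simp add: sinhc_minus)
  with r have "((\<lambda>h. (sinhc h - 1) / h) \<longlongrightarrow> 0) (at 0)" by (simp add: filterlim_split_at)
  then show ?thesis using True unfolding has_field_derivative_iff
    by (simp add: sinhc_def[of 0] sinhc_logderiv_def)
qed

lemma kint1_bound:
  assumes "w > 0"
  shows "0 \<le> w * bessel_kint 1 w" "w * bessel_kint 1 w \<le> 1"
  using bessel_kint_le[of 1 w] bessel_kint_nonneg[of 1 w] assms by auto

text \<open>
  The logarithmic singularity at 0 is bounded crudely by comparison with order 1/2; any integrable power is enough.
\<close>

lemma kint0_bound:
  assumes "w > 0"
  shows "bessel_kint 0 w \<le> 2 powr (1/2) / 2 * Gamma (1/2) * w powr (- 1 / 2)"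
proof -
  have "bessel_kint 0 w \<le> bessel_kint (1/2) w"
    by (rule bessel_kint_mono_order) (use assms in auto)
  also have "\<dots> = w powr (- 1 / 2) * (w powr (1/2) * bessel_kint (1/2) w)"
    using assms by (simp add: mult.assoc[symmetric] flip: powr_add)
  also have "\<dots> \<le> w powr (- 1 / 2) * (2 powr (1/2) / 2 * Gamma (1/2))"
    by (intro mult_left_mono bessel_kint_le) (use assms in auto)
  finally show ?thesis by (simp add: mult_ac)
qed

lemma continuous_on_kint: "continuous_on {0<..} (bessel_kint \<mu>)"
  by (intro continuous_at_imp_continuous_on ballI DERIV_isCont[OF DERIV_bessel_kint]) auto

lemma DERIV_kint0:
  assumes "z > 0"
  shows "(bessel_kint 0 has_real_derivative - bessel_kint 1 z) (at z)"
  using DERIV_bessel_kint[OF assms, of 0] by simp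

lemma set_integrable_powr_exp:
  fixes a c :: real
  assumes "a > - 1" "c > 0"
  shows "set_integrable lborel {0<..} (\<lambda>t. t powr a * exp (- c * t))"
proof -
  have "complex_set_integrable lebesgue {0<..} (\<lambda>t. complex_of_real t powr (complex_of_real (a + 1) - 1) / complex_of_real (exp (c * t)))"
    by (rule absolutely_integrable_Gamma_integral) (use assms in auto)
  then have "set_integrable lebesgue {0<..} (\<lambda>t. norm (complex_of_real t powr (complex_of_real (a + 1) - 1) / complex_of_real (exp (c * t))))"
    by (rule set_integrable_norm)
  moreover have "norm (complex_of_real t powr (complex_of_real (a + 1) - 1) / complex_of_real (exp (c * t))) = t powr a * exp (- c * t)" if "t > 0" for t
    using that by (simp add: norm_divide powr_of_real exp_minus field_simps norm_powr_real_powr)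
  ultimately have 1: "set_integrable lebesgue {0<..} (\<lambda>t. t powr a * exp (- c * t))"
    by (subst (asm) set_integrable_cong[OF refl]) auto
  have m: "(\<lambda>t. indicat_real {0<..} t *\<^sub>R (t powr a * exp (- c * t))) \<in> borel_measurable lborel"
    by measurable
  show ?thesis using 1 unfolding set_integrable_def using integrable_completion[OF m] by simp
qed

lemma set_integrable_power_exp:
  assumes "(c::real) > 0"
  shows "set_integrable lborel {0<..} (\<lambda>t. t ^ n * exp (- c * t))"
proof -
  have "set_integrable lborel {0<..} (\<lambda>t. t powr (real n) * exp (- c * t))"
    by (rule set_integrable_powr_exp) (use assms in auto)
  then show ?thesis by (subst (asm) set_integrable_cong[OF refl]) (auto simp: powr_realpow)
qed

context
  fixes y x :: real
  assumes y: "y > 0" and x: "x > 0"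
begin

text \<open>
  The argument of the Bessel function in the integrand of \<open>F\<close>.
\<close>

definition Farg :: "real \<Rightarrow> real \<Rightarrow> real" where "Farg s t = 2 * y * t * sinhc (s * t)"

lemma Farg_pos: "t > 0 \<Longrightarrow> Farg s t > 0"
  unfolding Farg_def using y sinhc_ge_1[of "s * t"] by simp

lemma DERIV_Farg: "((\<lambda>s. Farg s t) has_real_derivative Farg s t * (sinhc_logderiv (s * t) * t)) (at s)"
  unfolding Farg_def
  by (auto intro!: derivative_eq_intros DERIV_chain2[OF DERIV_sinhc] simp: algebra_simps)

lemma continuous_on_Farg: "continuous_on {0<..} (Farg s)"
proof (intro continuous_at_imp_continuous_on ballI)
  fix t :: real
  have "((\<lambda>t. 2 * y * t * sinhc (s * t)) has_real_derivative
     2 * y * sinhc (s * t) + sinhc (s * t) * sinhc_logderiv (s * t) * s * (2 * y * t)) (at t)"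
    by (auto intro!: derivative_eq_intros DERIV_chain2[OF DERIV_sinhc] simp: algebra_simps)
  then show "isCont (Farg s) t" unfolding Farg_def[abs_def] by (rule DERIV_isCont)
qed

lemma measurable_F_integrand:
  "(\<lambda>t. indicat_real {0<..} t *\<^sub>R (bessel_kint 0 (Farg s t) * exp (- 2 * x * t))) \<in> borel_measurable lborel"
proof -
  have "continuous_on {0<..} (\<lambda>t. bessel_kint 0 (Farg s t) * exp (- 2 * x * t))"
    by (intro continuous_intros continuous_on_compose2[OF continuous_on_kint continuous_on_Farg])
       (auto simp: Farg_pos)
  from borel_measurable_continuous_on_indicator[OF _ this] show ?thesis by simp
qed

lemma integrable_F_integrand:
  "set_integrable lborel {0<..} (\<lambda>t. bessel_kint 0 (Farg s t) * exp (- 2 * x * t))"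
proof -
  define C where "C = 2 powr (1/2) / 2 * Gamma (1/2) * (2 * y) powr (- 1 / 2)"
  have "set_integrable lborel {0<..} (\<lambda>t. C * (t powr (- 1/2) * exp (- (2 * x) * t)))"
    by (intro set_integrable_mult_right set_integrable_powr_exp) (use x in auto)
  then show ?thesis
    unfolding set_integrable_def
  proof (rule Bochner_Integration.integrable_bound[OF _ measurable_F_integrand], intro AE_I2)
    fix t :: real
    show "norm (indicat_real {0<..} t *\<^sub>R (bessel_kint 0 (Farg s t) * exp (- 2 * x * t)))
      \<le> norm (indicat_real {0<..} t *\<^sub>R (C * (t powr (- 1/2) * exp (- (2 * x) * t))))"
    proof (cases "t > 0")
      case True
      have "2 * y * t * 1 \<le> Farg s t" unfolding Farg_def
        by (intro mult_left_mono sinhc_ge_1) (use y True in auto)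
      then have "Farg s t powr (- 1 / 2) \<le> (2 * y * t) powr (- 1 / 2)"
        using y True by (intro powr_mono2') auto
      then have "2 powr (1/2) / 2 * Gamma (1/2) * Farg s t powr (- 1 / 2)
           \<le> 2 powr (1/2) / 2 * Gamma (1/2) * (2 * y * t) powr (- 1 / 2)"
        by (intro mult_left_mono) (auto intro!: less_imp_le)
      also have "\<dots> = C * t powr (- 1 / 2)" unfolding C_def using y True by (simp add: powr_mult)
      finally have "bessel_kint 0 (Farg s t) \<le> C * t powr (- 1 / 2)"
        using kint0_bound[OF Farg_pos[OF True], of s] by linarith
      moreover have "C \<ge> 0" unfolding C_def by (auto intro!: less_imp_le)
      ultimately show ?thesis using True bessel_kint_nonneg[of 0 "Farg s t"]
        by (simp add: abs_mult mult_right_mono)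
    qed simp
  qed
qed

text \<open>
  The integral obtained by differentiating under the integral sign; it is the derivative of \<open>F\<close> up to the factor \<open>2 * y\<close>.
\<close>

definition F1 :: "real \<Rightarrow> real" where
  "F1 s = (LBINT t:{0<..}. - (Farg s t * bessel_kint 1 (Farg s t) * (sinhc_logderiv (s * t) * t) * exp (- 2 * x * t)))"

text \<open>
  The two elementary bounds \<open>w * K1 w \<le> 1\<close> and \<open>\<bar>coth u - 1 / u\<bar> \<le> \<bar>u\<bar>\<close> combine to a bound that is linear in \<open>s\<close>.
  It serves both differentiations: as a majorant near an arbitrary \<open>s\<close>, and as the Lipschitz bound at \<open>s = 0\<close>.
\<close>

lemma F1_bound:
  assumes "t > 0"
  shows "\<bar>Farg s t * bessel_kint 1 (Farg s t) * (sinhc_logderiv (s * t) * t) * exp (- 2 * x * t)\<bar>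
     \<le> \<bar>s\<bar> * (t ^ 2 * exp (- (2 * x) * t))"
proof -
  have "\<bar>Farg s t * bessel_kint 1 (Farg s t)\<bar> * (\<bar>sinhc_logderiv (s * t)\<bar> * t * exp (- 2 * x * t))
    \<le> 1 * (\<bar>s * t\<bar> * t * exp (- 2 * x * t))"
    using kint1_bound[OF Farg_pos[OF assms], of s] abs_sinhc_logderiv_le[of "s * t"] assms
    by (intro mult_mono) auto
  then show ?thesis using assms by (simp add: abs_mult power2_eq_square mult_ac)
qed

lemma DERIV_F_integral:
  "((\<lambda>s. LBINT t:{0<..}. bessel_kint 0 (Farg s t) * exp (- 2 * x * t)) has_real_derivative F1 s) (at s)"
  "set_integrable lborel {0<..} (\<lambda>t. - (Farg s t * bessel_kint 1 (Farg s t) * (sinhc_logderiv (s * t) * t) * exp (- 2 * x * t)))"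
proof -
  define f where "f s t = indicat_real {0<..} t *\<^sub>R (bessel_kint 0 (Farg s t) * exp (- 2 * x * t))" for s t
  define f' where "f' s t = indicat_real {0<..} t *\<^sub>R
    (- (Farg s t * bessel_kint 1 (Farg s t) * (sinhc_logderiv (s * t) * t) * exp (- 2 * x * t)))" for s t
  define g where "g t = (\<bar>s\<bar> + 1) * (indicat_real {0<..} t *\<^sub>R (t ^ 2 * exp (- (2 * x) * t)))" for t
  have 1: "((\<lambda>p. f p t) has_real_derivative f' p t) (at p)" for p t
  proof (cases "t > 0")
    case True
    have "((\<lambda>p. bessel_kint 0 (Farg p t) * exp (- 2 * x * t)) has_real_derivative
        - bessel_kint 1 (Farg p t) * (Farg p t * (sinhc_logderiv (p * t) * t)) * exp (- 2 * x * t)) (at p)"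
      by (intro DERIV_cmult_right DERIV_chain2[OF DERIV_kint0[OF Farg_pos[OF True]] DERIV_Farg])
    then show ?thesis using True unfolding f_def f'_def by (simp add: mult_ac)
  qed (simp add: f_def f'_def)
  have 2: "norm (f' p t) \<le> g t" if "p \<in> ball s 1" for p t
  proof (cases "t > 0")
    case True
    have "\<bar>p\<bar> \<le> \<bar>s\<bar> + 1" using that by (auto simp: dist_real_def)
    then have "\<bar>p\<bar> * (t ^ 2 * exp (- (2 * x) * t)) \<le> (\<bar>s\<bar> + 1) * (t ^ 2 * exp (- (2 * x) * t))"
      by (intro mult_right_mono) auto
    from order_trans[OF F1_bound[OF True, of p] this] show ?thesis
      using True unfolding f'_def g_def by simp
  qed (simp add: f'_def g_def)
  have 3: "integrable lborel g" unfolding g_def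
    using set_integrable_power_exp[of "2 * x" 2] x by (intro integrable_mult_right) (simp add: set_integrable_def)
  have 4: "integrable lborel (f p)" for p
    using integrable_F_integrand[of p] unfolding f_def set_integrable_def .
  note * = has_field_derivative_integral_dominated[OF zero_less_one 4 1 2 3]
  show "((\<lambda>s. LBINT t:{0<..}. bessel_kint 0 (Farg s t) * exp (- 2 * x * t)) has_real_derivative F1 s) (at s)"
    using *(1) unfolding f_def[abs_def] f'_def F1_def set_lebesgue_integral_def by simp
  show "set_integrable lborel {0<..} (\<lambda>t. - (Farg s t * bessel_kint 1 (Farg s t) * (sinhc_logderiv (s * t) * t) * exp (- 2 * x * t)))"
    using *(2) unfolding f'_def set_integrable_def by simp
qed

lemma isCont_Farg: "isCont (\<lambda>s. Farg s t) s"
  using DERIV_isCont[OF DERIV_Farg] .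

text \<open>
  At \<open>s = 0\<close> the factor \<open>sinhc_logderiv (s * t) * t\<close> vanishes to first order with slope \<open>t\<^sup>2 / 3\<close>, so the integrand
  only has to be continuous in its other factors.
\<close>

lemma DERIV_F1:
  "(F1 has_real_derivative (LBINT t:{0<..}. - (2 * y * t * bessel_kint 1 (2 * y * t) * (t\<^sup>2 / 3) * exp (- 2 * x * t)))) (at 0)"
  "set_integrable lborel {0<..} (\<lambda>t. - (2 * y * t * bessel_kint 1 (2 * y * t) * (t\<^sup>2 / 3) * exp (- 2 * x * t)))"
proof -
  define f where "f s t = indicat_real {0<..} t *\<^sub>R
    (- (Farg s t * bessel_kint 1 (Farg s t) * (sinhc_logderiv (s * t) * t) * exp (- 2 * x * t)))" for s t
  define f' where "f' t = indicat_real {0<..} t *\<^sub>R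
    (- (2 * y * t * bessel_kint 1 (2 * y * t) * (t\<^sup>2 / 3) * exp (- 2 * x * t)))" for t
  define g where "g t = indicat_real {0<..} t *\<^sub>R (t ^ 2 * exp (- (2 * x) * t))" for t
  have 1: "((\<lambda>p. f p t) has_real_derivative f' t) (at 0)" for t
  proof (cases "t > 0")
    case True
    have F0: "Farg 0 t = 2 * y * t" by (simp add: Farg_def sinhc_def)
    have "((\<lambda>s. Farg s t) \<longlongrightarrow> 2 * y * t) (at 0)"
      using isCont_Farg[where t=t and s=0] F0 by (simp add: isCont_def)
    moreover have "isCont (bessel_kint 1) (2 * y * t)"
      by (rule DERIV_isCont[OF DERIV_bessel_kint]) (use y True in auto)
    ultimately have a: "((\<lambda>s. Farg s t * bessel_kint 1 (Farg s t)) \<longlongrightarrow> 2 * y * t * bessel_kint 1 (2 * y * t)) (at 0)"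
      by (intro tendsto_mult isCont_tendsto_compose[of _ "bessel_kint 1"])
    have b: "((\<lambda>s. sinhc_logderiv (s * t) / (s * t)) \<longlongrightarrow> 1 / 3) (at 0)"
      by (rule filterlim_compose[OF sinhc_logderiv_lim])
         (use True in \<open>auto intro!: filterlim_atI tendsto_eq_intros simp: eventually_at_filter\<close>)
    have "((\<lambda>s. - ((Farg s t * bessel_kint 1 (Farg s t)) * ((sinhc_logderiv (s * t) / (s * t)) * t\<^sup>2) * exp (- 2 * x * t)))
      \<longlongrightarrow> - ((2 * y * t * bessel_kint 1 (2 * y * t)) * (1 / 3 * t\<^sup>2) * exp (- 2 * x * t))) (at 0)"
      by (intro tendsto_intros a b)
    moreover have "\<forall>\<^sub>F s in at 0. - ((Farg s t * bessel_kint 1 (Farg s t)) * ((sinhc_logderiv (s * t) / (s * t)) * t\<^sup>2) * exp (- 2 * x * t))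
       = (f s t - f 0 t) / (s - 0)"
      using True by (auto simp: eventually_at_filter f_def sinhc_logderiv_def[of 0] power2_eq_square field_simps)
    ultimately have "((\<lambda>s. (f s t - f 0 t) / (s - 0)) \<longlongrightarrow> - ((2 * y * t * bessel_kint 1 (2 * y * t)) * (1 / 3 * t\<^sup>2) * exp (- 2 * x * t))) (at 0)"
      by (rule Lim_transform_eventually)
    then show ?thesis unfolding has_field_derivative_iff using True by (simp add: f'_def)
  qed (simp add: f_def f'_def)
  have f0: "f 0 t = 0" for t by (simp add: f_def sinhc_logderiv_def)
  have 2: "norm (f p t - f 0 t) \<le> g t * norm (p - 0)" for p t
    using F1_bound[of t p] unfolding f0 by (cases "t > 0") (auto simp: f_def g_def mult_ac)
  have 3: "integrable lborel g" unfolding g_def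
    using set_integrable_power_exp[of "2 * x" 2] x by (simp add: set_integrable_def)
  have 4: "integrable lborel (f p)" for p
    using DERIV_F_integral(2)[of p] unfolding f_def set_integrable_def .
  note * = has_field_derivative_integral_Lipschitz[OF zero_less_one 4 1 2 3]
  show "(F1 has_real_derivative (LBINT t:{0<..}. - (2 * y * t * bessel_kint 1 (2 * y * t) * (t\<^sup>2 / 3) * exp (- 2 * x * t)))) (at 0)"
    using *(1) unfolding f_def[abs_def] f'_def F1_def[abs_def] set_lebesgue_integral_def by simp
  show "set_integrable lborel {0<..} (\<lambda>t. - (2 * y * t * bessel_kint 1 (2 * y * t) * (t\<^sup>2 / 3) * exp (- 2 * x * t)))"
    using *(2) unfolding f'_def set_integrable_def by simp
qed

lemma F_fun_eq: "F_fun y x s = 2 * y * (LBINT t:{0<..}. bessel_kint 0 (Farg s t) * exp (- 2 * x * t))"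
  unfolding F_fun_def
  by (intro arg_cong2[where f="(*)"] refl set_lebesgue_integral_cong)
     (auto simp: Farg_pos besselK_0 simp flip: Farg_def)

lemma DERIV_F_fun: "(F_fun y x has_real_derivative 2 * y * F1 s) (at s)"
  unfolding F_fun_eq[abs_def] by (rule DERIV_cmult[OF DERIV_F_integral(1)])

lemma F_fun_second_deriv:
  "deriv (F_fun y x) differentiable (at 0)"
  "set_integrable lborel {0<..} (\<lambda>t. t ^ 3 * besselK 1 t * exp (- (x / y) * t))"
  "deriv (deriv (F_fun y x)) 0 = - (1 / (12 * y\<^sup>2)) * (LBINT t:{0<..}. t ^ 3 * besselK 1 t * exp (- (x / y) * t))"
proof -
  let ?I = "\<lambda>t. - (2 * y * t * bessel_kint 1 (2 * y * t) * (t\<^sup>2 / 3) * exp (- 2 * x * t))"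
  have e: "deriv (F_fun y x) = (\<lambda>s. 2 * y * F1 s)"
    using DERIV_imp_deriv[OF DERIV_F_fun] by auto
  have d: "(deriv (F_fun y x) has_real_derivative 2 * y * (LBINT t:{0<..}. ?I t)) (at 0)"
    unfolding e by (rule DERIV_cmult[OF DERIV_F1(1)])
  then show "deriv (F_fun y x) differentiable (at 0)" by (auto simp: real_differentiable_def)
  \<comment> \<open>The substitution of \<open>2 * y * t\<close> for the integration variable turns the integral into the stated moment.\<close>
  define h where "h t = indicat_real {0<..} t *\<^sub>R (t ^ 3 * besselK 1 t * exp (- (x / y) * t))" for t
  have hI: "indicat_real {0<..} t *\<^sub>R ?I t = - (1 / (12 * y\<^sup>2)) * h (0 + 2 * y * t)" for t
  proof (cases "t > 0")
    case True
    then show ?thesis using y unfolding h_def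
      by (simp add: besselK_1 power2_eq_square power3_eq_cube field_simps)
  qed (use y in \<open>simp add: h_def mult_less_0_iff zero_less_mult_iff\<close>)
  have "integrable lborel (\<lambda>t. indicat_real {0<..} t *\<^sub>R ?I t)"
    using DERIV_F1(2) unfolding set_integrable_def .
  then have "integrable lborel (\<lambda>t. h (0 + 2 * y * t))"
    unfolding hI using y integrable_mult_right[of "- (12 * y\<^sup>2)" lborel "\<lambda>t. - (1 / (12 * y\<^sup>2)) * h (0 + 2 * y * t)"]
    by simp
  then have "integrable lborel h"
    using lborel_integrable_real_affine_iff[of "2 * y" h 0] y by simp
  then show "set_integrable lborel {0<..} (\<lambda>t. t ^ 3 * besselK 1 t * exp (- (x / y) * t))"
    unfolding h_def set_integrable_def .
  have "(LBINT t:{0<..}. ?I t) = - (1 / (12 * y\<^sup>2)) * (\<integral>t. h (0 + 2 * y * t) \<partial>lborel)"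
    unfolding set_lebesgue_integral_def hI by simp
  also have "integral\<^sup>L lborel h = 2 * y * (\<integral>t. h (0 + 2 * y * t) \<partial>lborel)"
    using lborel_integral_real_affine[of "2 * y" h 0] y by simp
  then have "(\<integral>t. h (0 + 2 * y * t) \<partial>lborel) = integral\<^sup>L lborel h / (2 * y)"
    using y by simp
  finally have "2 * y * (LBINT t:{0<..}. ?I t) = - (1 / (12 * y\<^sup>2)) * integral\<^sup>L lborel h"
    using y by simp
  then show "deriv (deriv (F_fun y x)) 0 = - (1 / (12 * y\<^sup>2)) * (LBINT t:{0<..}. t ^ 3 * besselK 1 t * exp (- (x / y) * t))"
    using DERIV_imp_deriv[OF d] unfolding h_def set_lebesgue_integral_def by simp
qed

end

section \<open>A moment of K1\<close>

lemma integral_power3_exp: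
  fixes a :: real
  assumes a: "a > 0"
  shows "(LBINT t:{0<..}. t ^ 3 * exp (- a * t)) = 6 / a ^ 4"
proof -
  define c where "c = 1 / a"
  have ac: "a * c = 1" using a by (simp add: c_def)
  define F where "F t = - exp (- a * t) * (c * t ^ 3 + 3 * c\<^sup>2 * t\<^sup>2 + 6 * c ^ 3 * t + 6 * c ^ 4)" for t
  have "(LBINT t:{0<..}. t ^ 3 * exp (- a * t)) = 0 - (- 6 * c ^ 4)"
  proof (rule integral_Ioi_FTC[where F=F])
    fix t :: real
    show "(F has_vector_derivative t ^ 3 * exp (- a * t)) (at t)"
    proof -
      have "(F has_real_derivative a * exp (- a * t) * (c * t ^ 3 + 3 * c\<^sup>2 * t\<^sup>2 + 6 * c ^ 3 * t + 6 * c ^ 4)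
          + (3 * c * t\<^sup>2 + 6 * c\<^sup>2 * t + 6 * c ^ 3) * (- exp (- a * t))) (at t)"
        unfolding F_def by (auto intro!: derivative_eq_intros simp: algebra_simps)
      moreover have "a * E * (c * t ^ 3 + 3 * c\<^sup>2 * t\<^sup>2 + 6 * c ^ 3 * t + 6 * c ^ 4)
          + (3 * c * t\<^sup>2 + 6 * c\<^sup>2 * t + 6 * c ^ 3) * (- E) = t ^ 3 * E" for E
        using ac by algebra
      ultimately show ?thesis by (simp add: has_real_derivative_iff_has_vector_derivative)
    qed
    show "isCont (\<lambda>t. t ^ 3 * exp (- a * t)) t" by (intro continuous_intros)
  next
    show "(F \<longlongrightarrow> - 6 * c ^ 4) (at_right 0)"
      unfolding F_def by (auto intro!: tendsto_eq_intros)
    show "(F \<longlongrightarrow> 0) at_top" unfolding F_def using a by real_asymp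
  qed (rule set_integrable_power_exp[OF a])
  then show ?thesis by (simp add: c_def power_one_over)
qed

lemma cosh_plus_pos: "c > - 1 \<Longrightarrow> cosh \<tau> + c > 0" for c \<tau> :: real
  using cosh_real_ge_1[of \<tau>] by linarith

text \<open>
  Inserting the integral representation of \<open>besselK 1\<close> and exchanging the integrals (all integrands are nonnegative)
  leaves the elementary integral of \<open>t ^ 3 * exp (- (cosh \<tau> + c) * t)\<close>.
\<close>

lemma K1_moment_eq_integral:
  fixes c V :: real
  assumes c: "c > 0"
    and int: "integrable lborel (\<lambda>\<tau>. exp \<tau> / (cosh \<tau> + c) ^ 4)"
    and V: "(\<integral>\<tau>. exp \<tau> / (cosh \<tau> + c) ^ 4 \<partial>lborel) = V"
  shows "(LBINT t:{0<..}. t ^ 3 * besselK 1 t * exp (- c * t)) = 3 * V"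
proof -
  define G where "G t \<tau> = indicat_real {0<..} t * (t ^ 3 * exp (- c * t) * exp (1 * \<tau> - t * cosh \<tau>) / 2)" for t \<tau> :: real
  define h where "h t = indicat_real {0<..} t *\<^sub>R (t ^ 3 * besselK 1 t * exp (- c * t))" for t
  have hint: "integrable lborel h"
    using F_fun_second_deriv(2)[of 1 c] c unfolding h_def set_integrable_def by simp
  have hnn: "h t \<ge> 0" for t
    unfolding h_def by (cases "t > 0") (auto simp: besselK_1 bessel_kint_nonneg)
  have Gnn: "G t \<tau> \<ge> 0" for t \<tau> unfolding G_def by (cases "t > 0") auto
  have 1: "(\<integral>\<^sup>+\<tau>. ennreal (G t \<tau>) \<partial>lborel) = ennreal (h t)" for t
  proof (cases "t > 0")
    case True
    have i: "integrable lborel (G t)" unfolding G_def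
      by (intro integrable_mult_right Bochner_Integration.integrable_divide integrable_exp_cosh True)
    have "(\<integral>\<^sup>+\<tau>. ennreal (G t \<tau>) \<partial>lborel) = ennreal (integral\<^sup>L lborel (G t))"
      by (rule nn_integral_eq_integral[OF i]) (use Gnn in auto)
    also have "integral\<^sup>L lborel (G t) = h t"
      unfolding G_def h_def using True by (simp add: besselK_1 bessel_kint_def)
    finally show ?thesis .
  qed (simp add: G_def h_def)
  have 2: "(\<integral>\<^sup>+t. ennreal (G t \<tau>) \<partial>lborel) = ennreal (3 * (exp \<tau> / (cosh \<tau> + c) ^ 4))" for \<tau>
  proof -
    have p: "cosh \<tau> + c > 0" using cosh_plus_pos[of c \<tau>] c by simp
    have e: "G t \<tau> = exp \<tau> / 2 * (indicat_real {0<..} t *\<^sub>R (t ^ 3 * exp (- (cosh \<tau> + c) * t)))" for t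
      unfolding G_def by (simp add: algebra_simps exp_diff exp_add exp_minus divide_simps)
    have i: "integrable lborel (\<lambda>t. G t \<tau>)" unfolding e
      using set_integrable_power_exp[OF p, of 3] by (intro integrable_mult_right) (simp add: set_integrable_def)
    have "(\<integral>\<^sup>+t. ennreal (G t \<tau>) \<partial>lborel) = ennreal (\<integral>t. G t \<tau> \<partial>lborel)"
      by (rule nn_integral_eq_integral[OF i]) (use Gnn in auto)
    also have "(\<integral>t. G t \<tau> \<partial>lborel) = exp \<tau> / 2 * (LBINT t:{0<..}. t ^ 3 * exp (- (cosh \<tau> + c) * t))"
      unfolding e set_lebesgue_integral_def by simp
    also have "\<dots> = 3 * (exp \<tau> / (cosh \<tau> + c) ^ 4)"
      unfolding integral_power3_exp[OF p] by simp
    finally show ?thesis .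
  qed
  have m: "(\<lambda>(t, \<tau>). ennreal (G t \<tau>)) \<in> borel_measurable (lborel \<Otimes>\<^sub>M lborel)"
    unfolding G_def cosh_def by measurable
  have "ennreal (integral\<^sup>L lborel h) = (\<integral>\<^sup>+t. ennreal (h t) \<partial>lborel)"
    by (rule nn_integral_eq_integral[OF hint, symmetric]) (use hnn in auto)
  also have "\<dots> = (\<integral>\<^sup>+t. \<integral>\<^sup>+\<tau>. ennreal (G t \<tau>) \<partial>lborel \<partial>lborel)" by (simp add: 1)
  also have "\<dots> = (\<integral>\<^sup>+\<tau>. \<integral>\<^sup>+t. ennreal (G t \<tau>) \<partial>lborel \<partial>lborel)"
    by (rule lborel_pair.Fubini'[OF m, symmetric])
  also have "\<dots> = (\<integral>\<^sup>+\<tau>. ennreal (3 * (exp \<tau> / (cosh \<tau> + c) ^ 4)) \<partial>lborel)" by (simp add: 2)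
  also have "\<dots> = ennreal (\<integral>\<tau>. 3 * (exp \<tau> / (cosh \<tau> + c) ^ 4) \<partial>lborel)"
    using cosh_plus_pos[of c] c
    by (intro nn_integral_eq_integral integrable_mult_right int) (auto intro!: AE_I2 divide_nonneg_nonneg)
  also have "(\<integral>\<tau>. 3 * (exp \<tau> / (cosh \<tau> + c) ^ 4) \<partial>lborel) = 3 * V"
    using V by (simp only: integral_mult_right_zero)
  finally have "ennreal (integral\<^sup>L lborel h) = ennreal (3 * V)" .
  moreover have "integral\<^sup>L lborel h \<ge> 0" by (intro integral_nonneg_AE) (use hnn in auto)
  moreover have "V \<ge> 0" unfolding V[symmetric] using cosh_plus_pos[of c] c
    by (intro integral_nonneg_AE) (auto intro!: AE_I2 divide_nonneg_nonneg)
  ultimately show ?thesis unfolding h_def set_lebesgue_integral_def by simp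
qed

lemma arctan_cot: "0 < \<beta> \<Longrightarrow> \<beta> < pi \<Longrightarrow> arctan (cos \<beta> / sin \<beta>) = pi / 2 - \<beta>"
proof -
  assume "0 < \<beta>" "\<beta> < pi"
  then have "arctan (tan (pi / 2 - \<beta>)) = pi / 2 - \<beta>" by (intro arctan_tan) auto
  moreover have "tan (pi / 2 - \<beta>) = cos \<beta> / sin \<beta>" by (simp add: tan_def sin_diff cos_diff)
  ultimately show ?thesis by simp
qed

text \<open>
  The substitution \<open>X = exp \<tau>\<close> makes the integrand rational, with denominator a power of \<open>(X + c)\<^sup>2 + S\<close>. The
  constants \<open>\<kappa>\<close>, \<open>n3\<close>, \<open>n1\<close>, \<open>n0\<close> solve the linear system for an antiderivative consisting of a rational part and an
  arctangent (Hermite reduction); \<open>key\<close> is the resulting polynomial identity.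
\<close>

lemma K1_integral_elementary:
  fixes c :: real
  assumes c: "0 < c" "c < 1"
  defines "S \<equiv> 1 - c\<^sup>2"
  defines "\<kappa> \<equiv> (1 + 4 * c\<^sup>2) / (16 * S ^ 3)"
  defines "n3 \<equiv> (8 * \<kappa> * S - 1) / 3" and "n1 \<equiv> (11 * \<kappa> * S\<^sup>2 - S - 6 * c\<^sup>2) / 5"
    and "n0 \<equiv> (c * S + 2 * c ^ 3) / 3"
  shows "integrable lborel (\<lambda>\<tau>. exp \<tau> / (cosh \<tau> + c) ^ 4)"
    and "(\<integral>\<tau>. exp \<tau> / (cosh \<tau> + c) ^ 4 \<partial>lborel)
     = 16 * (\<kappa> / sqrt S * arccos c - (\<kappa> * c ^ 5 + n3 * c ^ 3 + c * c\<^sup>2 + n1 * c + n0))"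
proof -
  have S: "S > 0" unfolding S_def using c by (simp add: power_less_one_iff)
  define s where "s = sqrt S"
  have s: "s > 0" "s\<^sup>2 = S" using S by (auto simp: s_def)
  define N where "N u = \<kappa> * u ^ 5 + n3 * u ^ 3 + c * u\<^sup>2 + n1 * u + n0" for u
  define N' where "N' u = 5 * \<kappa> * u ^ 4 + 3 * n3 * u\<^sup>2 + 2 * c * u + n1" for u
  have key: "N' u * (u\<^sup>2 + S) - 6 * u * N u + \<kappa> * (u\<^sup>2 + S) ^ 3 = (u - c) ^ 4" for u
  proof -
    have k: "16 * \<kappa> * S ^ 3 = 1 + 4 * c\<^sup>2" unfolding \<kappa>_def using S by simp
    have e3: "3 * n3 = 8 * \<kappa> * S - 1" and e1: "5 * n1 = 11 * \<kappa> * S\<^sup>2 - S - 6 * c\<^sup>2"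
      and e0: "3 * n0 = c * S + 2 * c ^ 3" and Sd: "S = 1 - c\<^sup>2"
      unfolding n3_def n1_def n0_def S_def by auto
    show ?thesis unfolding N_def N'_def using k e3 e1 e0 Sd by algebra
  qed
  define P where "P X = (X + c)\<^sup>2 + S" for X
  have P: "P X > 0" for X using S by (simp add: P_def add_nonneg_pos)
  define H where "H X = N (X + c) / P X ^ 3 + \<kappa> / s * arctan ((X + c) / s)" for X
  have dH: "(H has_real_derivative X ^ 4 / P X ^ 4) (at X)" for X
  proof -
    have dN: "((\<lambda>X. N (X + c)) has_real_derivative N' (X + c)) (at X)"
      unfolding N_def N'_def by (rule derivative_eq_intros refl)+ (simp add: algebra_simps)
    have dP: "((\<lambda>X. P X ^ 3) has_real_derivative 3 * P X ^ 2 * (2 * (X + c))) (at X)"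
      unfolding P_def by (rule derivative_eq_intros refl)+ (simp add: algebra_simps)
    have dA: "((\<lambda>X. \<kappa> / s * arctan ((X + c) / s)) has_real_derivative \<kappa> / P X) (at X)"
    proof -
      have "((\<lambda>X. \<kappa> / s * arctan ((X + c) / s)) has_real_derivative \<kappa> / s * (inverse (1 + ((X + c) / s)\<^sup>2) * (1 / s))) (at X)"
        using s by (auto intro!: derivative_eq_intros)
      moreover have "\<kappa> / s * (inverse (1 + ((X + c) / s)\<^sup>2) * (1 / s)) = \<kappa> / P X"
      proof -
        have "1 + ((X + c) / s)\<^sup>2 = P X / s\<^sup>2" unfolding P_def using s S
          by (simp add: power_divide field_simps)
        then show ?thesis using s(1) P[of X] by (simp add: power2_eq_square)
      qed
      ultimately show ?thesis by simp
    qed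
    have "(H has_real_derivative (N' (X + c) * P X ^ 3 - N (X + c) * (3 * P X ^ 2 * (2 * (X + c)))) / (P X ^ 3 * P X ^ 3) + \<kappa> / P X) (at X)"
      unfolding H_def using P[of X] by (intro DERIV_add DERIV_divide dN dP dA) auto
    moreover have "(N' (X + c) * P X ^ 3 - N (X + c) * (3 * P X ^ 2 * (2 * (X + c)))) / (P X ^ 3 * P X ^ 3) + \<kappa> / P X
        = (N' (X + c) * P X - 6 * (X + c) * N (X + c) + \<kappa> * P X ^ 3) / P X ^ 4"
      using P[of X] by (simp add: divide_simps) algebra
    ultimately show ?thesis using key[of "X + c"] by (simp add: P_def)
  qed
  have e: "exp \<tau> / (cosh \<tau> + c) ^ 4 = 16 * (exp \<tau> ^ 4 / P (exp \<tau>) ^ 4 * exp \<tau>)" for \<tau>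
  proof -
    have "cosh \<tau> + c = P (exp \<tau>) / (2 * exp \<tau>)"
      unfolding P_def S_def cosh_def by (simp add: exp_minus field_simps power2_eq_square)
    then show ?thesis by (simp add: power_divide power_mult_distrib)
  qed
  have d: "((\<lambda>\<tau>. 16 * H (exp \<tau>)) has_real_derivative exp \<tau> / (cosh \<tau> + c) ^ 4) (at \<tau>)" for \<tau>
    unfolding e by (intro DERIV_cmult DERIV_chain2[OF dH] DERIV_exp)
  have top: "((\<lambda>\<tau>. 16 * H (exp \<tau>)) \<longlongrightarrow> 16 * (\<kappa> / s * (pi / 2))) at_top"
  proof -
    have "((\<lambda>u. \<kappa> * (u ^ 5 / (u\<^sup>2 + S) ^ 3) + n3 * (u ^ 3 / (u\<^sup>2 + S) ^ 3) + c * (u\<^sup>2 / (u\<^sup>2 + S) ^ 3) + n1 * (u / (u\<^sup>2 + S) ^ 3) + n0 * (1 / (u\<^sup>2 + S) ^ 3))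
       \<longlongrightarrow> \<kappa> * 0 + n3 * 0 + c * 0 + n1 * 0 + n0 * 0) at_top"
      by (intro tendsto_add tendsto_mult_left) (real_asymp+)
    also have "(\<lambda>u. \<kappa> * (u ^ 5 / (u\<^sup>2 + S) ^ 3) + n3 * (u ^ 3 / (u\<^sup>2 + S) ^ 3) + c * (u\<^sup>2 / (u\<^sup>2 + S) ^ 3) + n1 * (u / (u\<^sup>2 + S) ^ 3) + n0 * (1 / (u\<^sup>2 + S) ^ 3))
       = (\<lambda>u. N u / (u\<^sup>2 + S) ^ 3)"
      by (auto simp: N_def add_divide_distrib)
    finally have a: "((\<lambda>u. N u / (u\<^sup>2 + S) ^ 3) \<longlongrightarrow> 0) at_top" by simp
    have f: "filterlim (\<lambda>\<tau>. exp \<tau> + c) at_top at_top"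
      by real_asymp
    have b: "((\<lambda>\<tau>. arctan ((exp \<tau> + c) / s)) \<longlongrightarrow> pi / 2) at_top"
      by (rule filterlim_compose[OF tendsto_arctan_at_top])
         (use s in real_asymp)
    have "((\<lambda>\<tau>. 16 * (N (exp \<tau> + c) / ((exp \<tau> + c)\<^sup>2 + S) ^ 3 + \<kappa> / s * arctan ((exp \<tau> + c) / s))) \<longlongrightarrow> 16 * (0 + \<kappa> / s * (pi / 2))) at_top"
      by (intro tendsto_intros b filterlim_compose[OF a f])
    then show ?thesis unfolding H_def P_def by simp
  qed
  have bot: "((\<lambda>\<tau>. 16 * H (exp \<tau>)) \<longlongrightarrow> 16 * H 0) at_bot"
    by (intro tendsto_mult_left isCont_tendsto_compose[OF DERIV_isCont[OF dH]] exp_at_bot)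
  have c0: "cosh \<tau> + c > 0" for \<tau> using cosh_plus_pos[of c \<tau>] c by simp
  have cont: "isCont (\<lambda>\<tau>. exp \<tau> / (cosh \<tau> + c) ^ 4) \<tau>" for \<tau>
    using c0[of \<tau>] by (intro continuous_intros) auto
  have nn: "exp \<tau> / (cosh \<tau> + c) ^ 4 \<ge> 0" for \<tau> using c0[of \<tau>] by simp
  note * = integral_UNIV_FTC_nonneg[OF d cont nn bot top]
  show "integrable lborel (\<lambda>\<tau>. exp \<tau> / (cosh \<tau> + c) ^ 4)" by (rule *(1))
  have H0: "H 0 = N c + \<kappa> / s * arctan (c / s)" by (simp add: H_def P_def S_def)
  have at: "arctan (c / s) = pi / 2 - arccos c"
  proof -
    have b: "0 < arccos c" "arccos c < pi" using c arccos_lt_bounded[of c] by auto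
    have "cos (arccos c) = c" "sin (arccos c) = s" using c by (auto simp: s_def S_def sin_arccos)
    then show ?thesis using arctan_cot[OF b] by simp
  qed
  show "(\<integral>\<tau>. exp \<tau> / (cosh \<tau> + c) ^ 4 \<partial>lborel)
     = 16 * (\<kappa> / sqrt S * arccos c - (\<kappa> * c ^ 5 + n3 * c ^ 3 + c * c\<^sup>2 + n1 * c + n0))"
    unfolding *(2) H0 at by (simp add: N_def s_def algebra_simps)
qed

section \<open>The Debye phase\<close>

text \<open>
  The phase function of Debye's expansion of \<open>J\<close> of order \<open>\<nu>\<close> at \<open>\<nu> * t\<close>; it is \<open>pi\<close> divided by the function whose
  inverse is \<open>f_fun\<close>.
\<close>

definition Debye_phase :: "real \<Rightarrow> real" where
  "Debye_phase t = sqrt (t\<^sup>2 - 1) - arccos (1 / t)"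

lemma sq_gt_1: "t > 1 \<Longrightarrow> t\<^sup>2 - 1 > 0" for t :: real
  by (simp add: power2_eq_square) (metis less_trans mult_less_cancel_left2 not_less_iff_gr_or_eq zero_less_one less_1_mult)

lemma DERIV_sqrt_sq_minus_1:
  assumes "t > 1"
  shows "((\<lambda>t. sqrt (t\<^sup>2 - 1)) has_real_derivative t / sqrt (t\<^sup>2 - 1)) (at t)"
  using sq_gt_1[OF assms] by (auto intro!: derivative_eq_intros simp: divide_simps)

lemma sqrt_1_minus_inverse_sq: "t > 1 \<Longrightarrow> sqrt (1 - 1 / t\<^sup>2) = sqrt (t\<^sup>2 - 1) / t"
proof -
  assume t: "t > 1"
  then have "1 - 1 / t\<^sup>2 = (t\<^sup>2 - 1) / t\<^sup>2" by (simp add: field_simps)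
  then show ?thesis using t by (simp add: real_sqrt_divide)
qed

lemma DERIV_arccos_inverse:
  assumes "t > 1"
  shows "((\<lambda>t. arccos (1 / t)) has_real_derivative 1 / (t * sqrt (t\<^sup>2 - 1))) (at t)"
proof -
  have "((\<lambda>t. arccos (1 / t)) has_real_derivative inverse (- sqrt (1 - (1 / t)\<^sup>2)) * (- 1 / t\<^sup>2)) (at t)"
    using assms
    by (intro DERIV_chain2[OF DERIV_arccos]) (auto intro!: derivative_eq_intros simp: power2_eq_square field_simps)
  moreover have "inverse (- sqrt (1 - (1 / t)\<^sup>2)) * (- 1 / t\<^sup>2) = 1 / (t * sqrt (t\<^sup>2 - 1))"
    using assms sqrt_1_minus_inverse_sq[OF assms] sq_gt_1[OF assms]
    by (simp add: power_one_over[symmetric] power_divide field_simps power2_eq_square)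
  ultimately show ?thesis by simp
qed

lemma DERIV_Debye_phase:
  assumes "t > 1"
  shows "(Debye_phase has_real_derivative sqrt (t\<^sup>2 - 1) / t) (at t)"
proof -
  have "t / sqrt (t\<^sup>2 - 1) - 1 / (t * sqrt (t\<^sup>2 - 1)) = sqrt (t\<^sup>2 - 1) / t"
  proof -
    have "sqrt (t\<^sup>2 - 1) * sqrt (t\<^sup>2 - 1) = t\<^sup>2 - 1" "sqrt (t\<^sup>2 - 1) > 0" using sq_gt_1[OF assms] by auto
    then show ?thesis using assms by (simp add: divide_simps power2_eq_square)
  qed
  then show ?thesis unfolding Debye_phase_def[abs_def]
    using DERIV_diff[OF DERIV_sqrt_sq_minus_1[OF assms] DERIV_arccos_inverse[OF assms]] by simp
qed

lemma g_fun_derivs: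
  assumes t: "t > 1"
  shows "(g_fun has_real_derivative 1 / (t\<^sup>2 - 1) - arccos (1 / t) / sqrt (t\<^sup>2 - 1) ^ 3) (at t)"
    and "(deriv g_fun has_real_derivative
      (3 * t * arccos (1 / t) - sqrt (1 - 1 / t\<^sup>2) - 2 * t * sqrt (t\<^sup>2 - 1)) / sqrt (t\<^sup>2 - 1) ^ 5) (at t)"
proof -
  have op: "\<forall>\<^sub>F u in nhds t. u \<in> {1<..}" using t by (intro eventually_nhds_in_open) auto
  have 1: "(g_fun has_real_derivative 1 / (t\<^sup>2 - 1) - arccos (1 / t) / sqrt (t\<^sup>2 - 1) ^ 3) (at t)" if t: "t > 1" for t
  proof -
    have op: "\<forall>\<^sub>F u in nhds t. u \<in> {1<..}" using t by (intro eventually_nhds_in_open) auto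
    define q where "q = sqrt (t\<^sup>2 - 1)"
    have q: "q > 0" "q * q = t\<^sup>2 - 1" using sq_gt_1[OF t] by (auto simp: q_def)
    have "((\<lambda>t. arccos (1 / t) * t / sqrt (t\<^sup>2 - 1)) has_real_derivative
       ((1 / (t * q) * t + 1 * arccos (1 / t)) * q - arccos (1 / t) * t * (t / q)) / (q * q)) (at t)"
      unfolding q_def using q(1)
      by (intro DERIV_divide DERIV_mult DERIV_arccos_inverse DERIV_ident DERIV_sqrt_sq_minus_1 t) (simp add: q_def)
    also have "((1 / (t * q) * t + 1 * arccos (1 / t)) * q - arccos (1 / t) * t * (t / q)) / (q * q)
       = 1 / (t\<^sup>2 - 1) - arccos (1 / t) / q ^ 3"
    proof -
      have tt: "t\<^sup>2 = q * q + 1" using q by simp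
      show ?thesis using q t
        by (simp add: q(2)[symmetric] divide_simps) (use tt in algebra)
    qed
    finally have "((\<lambda>t. arccos (1 / t) * t / sqrt (t\<^sup>2 - 1)) has_real_derivative 1 / (t\<^sup>2 - 1) - arccos (1 / t) / q ^ 3) (at t)" .
    moreover have "\<forall>\<^sub>F u in nhds t. arccos (1 / u) * u / sqrt (u\<^sup>2 - 1) = g_fun u"
      using op by eventually_elim (simp add: g_fun_def sqrt_1_minus_inverse_sq)
    ultimately show ?thesis unfolding q_def by (subst (asm) DERIV_cong_ev[OF refl _ refl]) auto
  qed
  then show "(g_fun has_real_derivative 1 / (t\<^sup>2 - 1) - arccos (1 / t) / sqrt (t\<^sup>2 - 1) ^ 3) (at t)" using t .
  define q where "q = sqrt (t\<^sup>2 - 1)"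
  have q: "q > 0" "q * q = t\<^sup>2 - 1" using sq_gt_1[OF t] by (auto simp: q_def)
  have d1: "((\<lambda>u. 1 / (u\<^sup>2 - 1)) has_real_derivative - 2 * t / (q ^ 4)) (at t)"
    using q by (auto intro!: derivative_eq_intros simp: divide_simps power2_eq_square eval_nat_numeral) 
  have d3: "((\<lambda>u. sqrt (u\<^sup>2 - 1) ^ 3) has_real_derivative 3 * q ^ 2 * (t / q)) (at t)"
    unfolding q_def by (rule derivative_eq_intros DERIV_sqrt_sq_minus_1 t refl)+ (simp add: mult_ac)
  have "((\<lambda>u. 1 / (u\<^sup>2 - 1) - arccos (1 / u) / sqrt (u\<^sup>2 - 1) ^ 3) has_real_derivative
     - 2 * t / (q ^ 4) - (1 / (t * q) * q ^ 3 - arccos (1 / t) * (3 * q ^ 2 * (t / q))) / (q ^ 3 * q ^ 3)) (at t)"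
    unfolding q_def using d1 d3 q
    by (intro DERIV_diff DERIV_divide DERIV_arccos_inverse t) (simp_all add: q_def)
  also have "- 2 * t / (q ^ 4) - (1 / (t * q) * q ^ 3 - arccos (1 / t) * (3 * q ^ 2 * (t / q))) / (q ^ 3 * q ^ 3)
     = (3 * t * arccos (1 / t) - sqrt (1 - 1 / t\<^sup>2) - 2 * t * sqrt (t\<^sup>2 - 1)) / sqrt (t\<^sup>2 - 1) ^ 5"
    unfolding sqrt_1_minus_inverse_sq[OF t] q_def[symmetric]
    using q t by (simp add: divide_simps) (simp add: algebra_simps eval_nat_numeral)
  finally have "((\<lambda>u. 1 / (u\<^sup>2 - 1) - arccos (1 / u) / sqrt (u\<^sup>2 - 1) ^ 3) has_real_derivative
     (3 * t * arccos (1 / t) - sqrt (1 - 1 / t\<^sup>2) - 2 * t * sqrt (t\<^sup>2 - 1)) / sqrt (t\<^sup>2 - 1) ^ 5) (at t)" .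
  moreover have "\<forall>\<^sub>F u in nhds t. 1 / (u\<^sup>2 - 1) - arccos (1 / u) / sqrt (u\<^sup>2 - 1) ^ 3 = deriv g_fun u"
    using op by eventually_elim (use 1 DERIV_imp_deriv in force)
  ultimately show "(deriv g_fun has_real_derivative
      (3 * t * arccos (1 / t) - sqrt (1 - 1 / t\<^sup>2) - 2 * t * sqrt (t\<^sup>2 - 1)) / sqrt (t\<^sup>2 - 1) ^ 5) (at t)"
    by (subst (asm) DERIV_cong_ev[OF refl _ refl]) auto
qed

lemma sqrt_power5: "t > 1 \<Longrightarrow> sqrt (t\<^sup>2 - 1) ^ 5 = (t\<^sup>2 - 1) powr (5 / 2)" for t :: real
proof -
  assume t: "t > 1"
  have "sqrt (t\<^sup>2 - 1) ^ 5 = ((t\<^sup>2 - 1) powr (1 / 2)) powr (real 5)"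
    using sq_gt_1[OF t] by (subst powr_realpow) (auto simp: powr_half_sqrt)
  then show ?thesis by (simp add: powr_powr)
qed

text \<open>
  Here \<open>c = 1 / t\<close>. Grouping the terms by \<open>Debye_phase t\<close> makes the relation to the phase visible: up to the factor
  in front, the right-hand side is the derivative of \<open>Debye_phase t * (3 / q + 5 / q ^ 3)\<close>.
\<close>

lemma K1_moment:
  assumes t: "t > 1"
  defines "q \<equiv> sqrt (t\<^sup>2 - 1)"
  shows "(LBINT \<tau>:{0<..}. \<tau> ^ 3 * besselK 1 \<tau> * exp (- (1 / t) * \<tau>))
    = t ^ 4 / q\<^sup>2 * (q / t * (3 / q + 5 / q ^ 3) - Debye_phase t * t * (3 / q ^ 3 + 15 / q ^ 5))"
proof -
  have c: "0 < 1 / t" "1 / t < 1" using t by auto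
  have q: "q > 0" "q\<^sup>2 = t\<^sup>2 - 1" using sq_gt_1[OF t] by (auto simp: q_def)
  have S: "1 - (1 / t)\<^sup>2 = (q / t)\<^sup>2" using t by (simp add: q power_divide field_simps)
  have sS: "sqrt ((q / t)\<^sup>2) = q / t" using q t by simp
  define A where "A = arccos (1 / t)"
  have D: "Debye_phase t = q - A" by (simp add: Debye_phase_def q_def A_def)
  have tt: "t\<^sup>2 = q\<^sup>2 + 1" using q by simp
  show ?thesis
    unfolding K1_moment_eq_integral[OF c(1) K1_integral_elementary[OF c]] S sS A_def[symmetric] D
    using q(1) t
    apply (simp add: divide_simps)
    using tt by algebra
qed

section \<open>The inverse function f\<close>

lemma continuous_on_Debye_phase: "continuous_on {1..} Debye_phase"
  unfolding Debye_phase_def[abs_def]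
  by (intro continuous_intros) (auto intro: order_trans[of _ 0])

lemma Debye_phase_strict_mono:
  assumes "1 \<le> s" "s < t"
  shows "Debye_phase s < Debye_phase t"
proof (rule DERIV_pos_imp_increasing_open[OF assms(2)])
  fix u assume "s < u" "u < t"
  then show "\<exists>y. DERIV Debye_phase u :> y \<and> 0 < y"
    using DERIV_Debye_phase[of u] sq_gt_1[of u] assms by (intro exI[of _ "sqrt (u\<^sup>2 - 1) / u"]) auto
next
  show "continuous_on {s..t} Debye_phase"
    by (rule continuous_on_subset[OF continuous_on_Debye_phase]) (use assms in auto)
qed

lemma Debye_phase_1: "Debye_phase 1 = 0" by (simp add: Debye_phase_def)

lemma Debye_phase_pos: "t > 1 \<Longrightarrow> Debye_phase t > 0"
  using Debye_phase_strict_mono[of 1 t] Debye_phase_1 by simp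

lemma Debye_phase_ge: "t \<ge> 1 \<Longrightarrow> Debye_phase t \<ge> t - 1 - pi / 2"
proof -
  assume t: "t \<ge> 1"
  have "(t - 1)\<^sup>2 \<le> t\<^sup>2 - 1" using t by (simp add: power2_eq_square algebra_simps)
  then have "sqrt ((t - 1)\<^sup>2) \<le> sqrt (t\<^sup>2 - 1)" by (rule real_sqrt_le_mono)
  then have "t - 1 \<le> sqrt (t\<^sup>2 - 1)" using t by simp
  moreover have "arccos (1 / t) \<le> pi / 2" using t by (intro arccos_le_pi2) auto
  ultimately show ?thesis by (simp add: Debye_phase_def)
qed

lemma Debye_phase_surj:
  assumes "u > 0"
  obtains t where "t > 1" "Debye_phase t = u"
proof -
  define T where "T = u + 1 + pi / 2"
  have "T \<ge> 1" using assms by (simp add: T_def add_nonneg_nonneg)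
  moreover have "Debye_phase T \<ge> u" using Debye_phase_ge[OF \<open>T \<ge> 1\<close>] by (simp add: T_def)
  ultimately obtain t where "1 \<le> t" "t \<le> T" "Debye_phase t = u"
    using IVT'[of Debye_phase 1 u T] Debye_phase_1 assms
      continuous_on_subset[OF continuous_on_Debye_phase, of "{1..T}"] by auto
  moreover have "t \<noteq> 1" using \<open>Debye_phase t = u\<close> assms Debye_phase_1 by auto
  ultimately show ?thesis using that by force
qed

lemma f_fun_Debye: "f_fun = inv_into {1<..} (\<lambda>y. pi / Debye_phase y)"
  by (simp add: f_fun_def Debye_phase_def)

lemma inj_on_Debye: "inj_on (\<lambda>y. pi / Debye_phase y) {1<..}"
proof (rule linorder_inj_onI')
  fix s t :: real assume "s \<in> {1<..}" "t \<in> {1<..}" "s < t"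
  then have "pi / Debye_phase t < pi / Debye_phase s"
    using Debye_phase_strict_mono[of s t] Debye_phase_pos[of s] Debye_phase_pos[of t]
    by (intro divide_strict_left_mono) auto
  then show "pi / Debye_phase s \<noteq> pi / Debye_phase t" by (rule less_imp_neq[symmetric])
qed

lemma f_fun_left_inv: "t > 1 \<Longrightarrow> f_fun (pi / Debye_phase t) = t"
  unfolding f_fun_Debye using inv_into_f_f[OF inj_on_Debye, of t] by simp

lemma f_fun_props:
  assumes "x > 0"
  shows "f_fun x > 1" "Debye_phase (f_fun x) = pi / x"
proof -
  obtain t where t: "t > 1" "Debye_phase t = pi / x" using Debye_phase_surj[of "pi / x"] assms by auto
  then have "f_fun x = t" using f_fun_left_inv[OF t(1)] assms by simp
  then show "f_fun x > 1" "Debye_phase (f_fun x) = pi / x" using t by auto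
qed

text \<open>
  Implicit differentiation of \<open>Debye_phase (f_fun x) = pi / x\<close>.
\<close>

lemma DERIV_f_fun:
  assumes x: "x > 0"
  defines "t \<equiv> f_fun x"
  shows "(f_fun has_real_derivative - (Debye_phase t)\<^sup>2 * t / (pi * sqrt (t\<^sup>2 - 1))) (at x)"
proof -
  have t: "t > 1" "Debye_phase t = pi / x" unfolding t_def using f_fun_props[OF x] by auto
  have q: "sqrt (t\<^sup>2 - 1) > 0" using sq_gt_1[OF t(1)] by simp
  have P: "Debye_phase t > 0" by (rule Debye_phase_pos[OF t(1)])
  define D where "D = - pi * (sqrt (t\<^sup>2 - 1) / t) / (Debye_phase t * Debye_phase t)"
  have D: "D \<noteq> 0" unfolding D_def using q P t(1) by (metis divide_eq_0_iff less_irrefl mult_eq_0_iff neg_equal_0_iff_equal not_one_less_zero pi_neq_zero)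
  have "((\<lambda>y. pi / Debye_phase y) has_real_derivative D) (at t)"
    unfolding D_def using DERIV_Debye_phase[OF t(1)] P by (auto intro!: derivative_eq_intros)
  then have der: "((\<lambda>y. pi / Debye_phase y) has_derivative (*) D) (at t)"
    by (simp add: has_field_derivative_def)
  have cont: "continuous_on {1<..} (\<lambda>y. pi / Debye_phase y)"
    by (intro continuous_intros continuous_on_subset[OF continuous_on_Debye_phase])
       (use Debye_phase_pos in force)+
  have "(f_fun has_derivative (*) (inverse D)) (at (pi / Debye_phase t))"
    by (rule has_derivative_inverse_strong[where S="{1<..}" and x=t, OF _ _ cont _ der])
       (use t D f_fun_left_inv in \<open>auto simp: fun_eq_iff\<close>)
  then have "(f_fun has_real_derivative inverse D) (at (pi / Debye_phase t))"
    by (simp add: has_field_derivative_def)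
  moreover have "pi / Debye_phase t = x" using t x by simp
  moreover have "inverse D = - (Debye_phase t)\<^sup>2 * t / (pi * sqrt (t\<^sup>2 - 1))"
    unfolding D_def using P q t by (simp add: power2_eq_square divide_simps)
  ultimately show ?thesis by simp
qed

lemma f_fun_at_top: "filterlim f_fun at_top (at_right 0)"
  unfolding filterlim_at_top_gt[where c=1]
proof (intro allI impI)
  fix M :: real assume M: "M > 1"
  have P: "Debye_phase M > 0" by (rule Debye_phase_pos[OF M])
  show "\<forall>\<^sub>F x in at_right 0. M \<le> f_fun x"
    unfolding eventually_at_right_field
  proof (intro exI[of _ "pi / Debye_phase M"] conjI allI impI)
    fix x assume x: "0 < x" "x < pi / Debye_phase M"
    then have "x * Debye_phase M < x * Debye_phase (f_fun x)"
      using f_fun_props(2)[OF x(1)] P by (simp add: field_simps)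
    then have "Debye_phase M < Debye_phase (f_fun x)" using x by simp
    then show "M \<le> f_fun x"
      using Debye_phase_strict_mono[of "f_fun x" M] f_fun_props(1)[OF x(1)] by force
  qed (use P in auto)
qed

section \<open>Integrating Theta\<close>

text \<open>
  An antiderivative of \<open>Theta0\<close> in the variable \<open>t = f_fun x\<close>. The first term accounts for the part of \<open>Theta0\<close> that
  contains the second derivative of \<open>g_fun\<close>, the second one for the part with the second derivative of \<open>F_fun\<close>.
\<close>

definition Theta_prim :: "real \<Rightarrow> real" where
  "Theta_prim t = Debye_phase t / (8 * sqrt (t\<^sup>2 - 1) ^ 3)
     - Debye_phase t * (3 / sqrt (t\<^sup>2 - 1) + 5 / sqrt (t\<^sup>2 - 1) ^ 3) / (6 * pi\<^sup>2)"

definition Theta_prim' :: "real \<Rightarrow> real" where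
  "Theta_prim' t = (let q = sqrt (t\<^sup>2 - 1) in
     (3 * t * arccos (1 / t) - q / t - 2 * t * q) / (8 * q ^ 5)
     - (q / t * (3 / q + 5 / q ^ 3) - Debye_phase t * t * (3 / q ^ 3 + 15 / q ^ 5)) / (6 * pi\<^sup>2))"

lemma DERIV_Theta_prim:
  assumes t: "t > 1"
  shows "(Theta_prim has_real_derivative Theta_prim' t) (at t)"
proof -
  define q where "q = sqrt (t\<^sup>2 - 1)"
  have q: "q > 0" "q * q = t\<^sup>2 - 1" using sq_gt_1[OF t] by (auto simp: q_def)
  have dq: "((\<lambda>t. sqrt (t\<^sup>2 - 1)) has_real_derivative t / q) (at t)"
    unfolding q_def by (rule DERIV_sqrt_sq_minus_1[OF t])
  have dP: "(Debye_phase has_real_derivative q / t) (at t)"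
    unfolding q_def by (rule DERIV_Debye_phase[OF t])
  have d3: "((\<lambda>u. 1 / sqrt (u\<^sup>2 - 1) ^ 3) has_real_derivative - 3 * t / q ^ 5) (at t)"
  proof -
    have "((\<lambda>u. sqrt (u\<^sup>2 - 1) ^ 3) has_real_derivative 3 * (t / q * q\<^sup>2)) (at t)"
      using DERIV_power[OF dq, of 3] by (simp add: q_def)
    from DERIV_divide[OF DERIV_const[of 1] this] show ?thesis
      using q(1) unfolding q_def[symmetric]
      by (rule_tac DERIV_cong) (auto simp: divide_simps eval_nat_numeral q_def[symmetric])
  qed
  have d1: "((\<lambda>u. 1 / sqrt (u\<^sup>2 - 1)) has_real_derivative - t / q ^ 3) (at t)"
    using DERIV_divide[OF DERIV_const[of 1] dq] q(1) unfolding q_def[symmetric]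
    by (rule_tac DERIV_cong) (auto simp: divide_simps eval_nat_numeral q_def[symmetric])
  have "((\<lambda>u. Debye_phase u * (1 / sqrt (u\<^sup>2 - 1) ^ 3) / 8
       - Debye_phase u * (3 * (1 / sqrt (u\<^sup>2 - 1)) + 5 * (1 / sqrt (u\<^sup>2 - 1) ^ 3)) / (6 * pi\<^sup>2)) has_real_derivative
     (q / t * (1 / q ^ 3) + (- 3 * t / q ^ 5) * Debye_phase t) / 8
     - (q / t * (3 * (1 / q) + 5 * (1 / q ^ 3)) + (3 * (- t / q ^ 3) + 5 * (- 3 * t / q ^ 5)) * Debye_phase t) / (6 * pi\<^sup>2)) (at t)"
    unfolding q_def
    by (intro DERIV_diff DERIV_cdivide DERIV_mult DERIV_add DERIV_cmult dP[unfolded q_def] d1[unfolded q_def] d3[unfolded q_def])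
  moreover have "(\<lambda>u. Debye_phase u * (1 / sqrt (u\<^sup>2 - 1) ^ 3) / 8
       - Debye_phase u * (3 * (1 / sqrt (u\<^sup>2 - 1)) + 5 * (1 / sqrt (u\<^sup>2 - 1) ^ 3)) / (6 * pi\<^sup>2)) = Theta_prim"
    by (simp add: Theta_prim_def fun_eq_iff)
  moreover have "(q / t * (1 / q ^ 3) + (- 3 * t / q ^ 5) * Debye_phase t) / 8
     - (q / t * (3 * (1 / q) + 5 * (1 / q ^ 3)) + (3 * (- t / q ^ 3) + 5 * (- 3 * t / q ^ 5)) * Debye_phase t) / (6 * pi\<^sup>2)
     = Theta_prim' t"
  proof -
    define A where "A = arccos (1 / t)"
    have D: "Debye_phase t = q - A" by (simp add: Debye_phase_def q_def A_def)
    have tt: "t\<^sup>2 = q\<^sup>2 + 1" using q by (simp add: power2_eq_square)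
    have 1: "(q / t * (1 / q ^ 3) + (- 3 * t / q ^ 5) * (q - A)) / 8 = (3 * t * A - q / t - 2 * t * q) / (8 * q ^ 5)"
      using q(1) t by (simp add: divide_simps) (use tt in algebra)
    have 2: "q / t * (3 * (1 / q) + 5 * (1 / q ^ 3)) + (3 * (- t / q ^ 3) + 5 * (- 3 * t / q ^ 5)) * (q - A)
      = q / t * (3 / q + 5 / q ^ 3) - (q - A) * t * (3 / q ^ 3 + 15 / q ^ 5)"
      by (simp add: algebra_simps)
    show ?thesis unfolding Theta_prim'_def Let_def q_def[symmetric] A_def[symmetric] D 1 2 ..
  qed
  ultimately show ?thesis by (simp only:)
qed

text \<open>
  The last factor is the derivative of \<open>f_fun\<close>, so \<open>Theta0\<close> is an exact derivative along \<open>t = f_fun x\<close>.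
\<close>

lemma Theta0_eq:
  assumes x: "x > 0"
  defines "t \<equiv> f_fun x"
  shows "Theta0 x = Theta_prim' t * (- (Debye_phase t)\<^sup>2 * t / (pi * sqrt (t\<^sup>2 - 1)))"
proof -
  have t: "t > 1" "Debye_phase t = pi / x" unfolding t_def using f_fun_props[OF x] by auto
  define q where "q = sqrt (t\<^sup>2 - 1)"
  have q: "q > 0" using sq_gt_1[OF t(1)] by (simp add: q_def)
  have io: "iota x = x * t" by (simp add: iota_def t_def)
  have iop: "iota x > 0" using io x t by simp
  have xi: "x / iota x = 1 / t" using io x by simp
  define G where "G = (3 * t * arccos (1 / t) - q / t - 2 * t * q) / q ^ 5"
  define J where "J = q / t * (3 / q + 5 / q ^ 3) - Debye_phase t * t * (3 / q ^ 3 + 15 / q ^ 5)"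
  have g: "deriv (deriv g_fun) t = G"
    using DERIV_imp_deriv[OF g_fun_derivs(2)[OF t(1)]]
    unfolding sqrt_1_minus_inverse_sq[OF t(1)] G_def q_def .
  have F: "deriv (deriv (F_fun (iota x) x)) 0 = - (1 / (12 * (iota x)\<^sup>2)) * (t ^ 4 / q\<^sup>2 * J)"
    unfolding F_fun_second_deriv(3)[OF iop x] xi K1_moment[OF t(1)] q_def J_def ..
  have T: "Theta_prim' t = G / 8 - J / (6 * pi\<^sup>2)"
    unfolding Theta_prim'_def Let_def q_def[symmetric] G_def J_def by simp
  have "Theta0 x = - pi / (8 * x\<^sup>2) * G * (t / q) - - (1 / (12 * (x * t)\<^sup>2)) * (t ^ 4 / q\<^sup>2 * J) * (2 / pi) * (q / t)"
    unfolding Theta0_def t_def[symmetric] g F q_def[symmetric] unfolding io ..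
  also have "\<dots> = (G / 8 - J / (6 * pi\<^sup>2)) * (- (pi / x)\<^sup>2 * t / (pi * q))"
  proof -
    have 1: "- pi / (8 * x\<^sup>2) * G * (t / q) = G / 8 * (- (pi / x)\<^sup>2 * t / (pi * q))"
      using x t q by (simp add: power2_eq_square divide_simps)
    have 2: "1 / (12 * (x * t)\<^sup>2) * (t ^ 4 / q\<^sup>2 * J) * (2 / pi) * (q / t) = - (J / (6 * pi\<^sup>2)) * (- (pi / x)\<^sup>2 * t / (pi * q))"
      using x t(1) q by (simp add: eval_nat_numeral divide_simps)
    show ?thesis unfolding left_diff_distrib using 1 2 by linarith
  qed
  finally show ?thesis unfolding T t(2) q_def .
qed

lemma Debye_limits:
  shows "filterlim (\<lambda>t::real. sqrt (t\<^sup>2 - 1)) at_top at_top"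
    and "((\<lambda>t. 1 / sqrt (t\<^sup>2 - 1)) \<longlongrightarrow> (0::real)) at_top"
    and "((\<lambda>t. t / sqrt (t\<^sup>2 - 1)) \<longlongrightarrow> (1::real)) at_top"
    and "((\<lambda>t. arccos (1 / t)) \<longlongrightarrow> pi / 2) at_top"
    and "((\<lambda>t. Debye_phase t / sqrt (t\<^sup>2 - 1)) \<longlongrightarrow> 1) at_top"
proof -
  show 1: "filterlim (\<lambda>t::real. sqrt (t\<^sup>2 - 1)) at_top at_top" by real_asymp
  show 2: "((\<lambda>t. 1 / sqrt (t\<^sup>2 - 1)) \<longlongrightarrow> (0::real)) at_top" by real_asymp
  show "((\<lambda>t. t / sqrt (t\<^sup>2 - 1)) \<longlongrightarrow> (1::real)) at_top" by real_asymp
  have "((\<lambda>t. arccos (1 / t)) \<longlongrightarrow> arccos 0) at_top"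
  proof (rule isCont_tendsto_compose[where g=arccos])
    show "isCont arccos 0" by (rule isCont_arccos) auto
    show "((\<lambda>t::real. 1 / t) \<longlongrightarrow> 0) at_top" by real_asymp
  qed
  then show 3: "((\<lambda>t. arccos (1 / t)) \<longlongrightarrow> pi / 2) at_top" by simp
  have "((\<lambda>t. 1 - arccos (1 / t) * (1 / sqrt (t\<^sup>2 - 1))) \<longlongrightarrow> 1 - pi / 2 * 0) at_top"
    by (intro tendsto_diff tendsto_mult tendsto_const 2 3)
  moreover have "\<forall>\<^sub>F t in at_top. 1 - arccos (1 / t) * (1 / sqrt (t\<^sup>2 - 1)) = Debye_phase t / sqrt (t\<^sup>2 - 1)"
    using eventually_gt_at_top[of 1]
  proof eventually_elim
    case (elim t)
    define q where "q = sqrt (t\<^sup>2 - 1)"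
    have "q > 0" using sq_gt_1[OF elim] by (simp add: q_def)
    then show ?case unfolding Debye_phase_def q_def[symmetric] by (simp add: diff_divide_distrib)
  qed
  ultimately show "((\<lambda>t. Debye_phase t / sqrt (t\<^sup>2 - 1)) \<longlongrightarrow> 1) at_top"
    using Lim_transform_eventually by fastforce
qed

text \<open>
  This value at \<open>x = 0\<close>, where \<open>f_fun\<close> is infinite, is the origin of the term \<open>1 / (2 * pi\<^sup>2)\<close> in the theorem.
\<close>

lemma Theta_prim_at_top: "(Theta_prim \<longlongrightarrow> - 1 / (2 * pi\<^sup>2)) at_top"
proof -
  let ?q = "\<lambda>t. sqrt (t\<^sup>2 - 1)"
  have "((\<lambda>t. (Debye_phase t / ?q t) * (1 / ?q t)\<^sup>2 / 8
      - (Debye_phase t / ?q t) * (3 + 5 * (1 / ?q t)\<^sup>2) / (6 * pi\<^sup>2)) \<longlongrightarrow> 1 * 0\<^sup>2 / 8 - 1 * (3 + 5 * 0\<^sup>2) / (6 * pi\<^sup>2)) at_top"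
    by (intro tendsto_diff tendsto_mult tendsto_divide tendsto_add tendsto_power tendsto_const Debye_limits) auto
  moreover have "\<forall>\<^sub>F t in at_top. (Debye_phase t / ?q t) * (1 / ?q t)\<^sup>2 / 8
      - (Debye_phase t / ?q t) * (3 + 5 * (1 / ?q t)\<^sup>2) / (6 * pi\<^sup>2) = Theta_prim t"
    using eventually_gt_at_top[of 1]
  proof eventually_elim
    case (elim t)
    define q where "q = ?q t"
    have q: "q > 0" using sq_gt_1[OF elim] by (simp add: q_def)
    have "(P / q) * (1 / q)\<^sup>2 / 8 = P / (8 * q ^ 3)" "(P / q) * (3 + 5 * (1 / q)\<^sup>2) = P * (3 / q + 5 / q ^ 3)" for P
      using q by (simp_all add: field_simps eval_nat_numeral)
    then show ?case unfolding Theta_prim_def q_def[symmetric] by simp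
  qed
  ultimately have "(Theta_prim \<longlongrightarrow> 1 * 0\<^sup>2 / 8 - 1 * (3 + 5 * 0\<^sup>2) / (6 * pi\<^sup>2)) at_top"
    by (rule Lim_transform_eventually)
  then show ?thesis by simp
qed

text \<open>
  \<open>Theta0\<close> has a finite limit at 0, so it is integrable there.
\<close>

lemma Theta_integrand_at_top:
  "((\<lambda>t. Theta_prim' t * (- (Debye_phase t)\<^sup>2 * t / (pi * sqrt (t\<^sup>2 - 1)))) \<longlongrightarrow> 1 / (4 * pi\<^sup>2)) at_top"
proof -
  let ?q = "\<lambda>t. sqrt (t\<^sup>2 - 1)"
  let ?A = "\<lambda>t. arccos (1 / t)"
  \<comment> \<open>all quantities are expressed through the bounded ones \<open>p = \<Phi>/q\<close>, \<open>w = t/q\<close>, \<open>e = 1/q\<close> and \<open>A\<close>\<close>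
  define h where "h p w e A = - (p\<^sup>2 * w / pi) * ((3 * w * A * e - e\<^sup>2 / w - 2 * w) * e / 8
      - (3 * (A - e + A * e\<^sup>2) / w + 5 * e / w - 15 * p * w * e) / (6 * pi\<^sup>2))" for p w e A
  have "((\<lambda>t. h (Debye_phase t / ?q t) (t / ?q t) (1 / ?q t) (?A t)) \<longlongrightarrow> h 1 1 0 (pi / 2)) at_top"
    unfolding h_def
    by (intro tendsto_diff tendsto_mult tendsto_divide tendsto_add tendsto_power tendsto_const tendsto_minus Debye_limits) auto
  moreover have "h 1 1 0 (pi / 2) = 1 / (4 * pi\<^sup>2)" by (simp add: h_def power2_eq_square)
  moreover have "\<forall>\<^sub>F t in at_top. h (Debye_phase t / ?q t) (t / ?q t) (1 / ?q t) (?A t)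
     = Theta_prim' t * (- (Debye_phase t)\<^sup>2 * t / (pi * sqrt (t\<^sup>2 - 1)))"
    using eventually_gt_at_top[of 1]
  proof eventually_elim
    case (elim t)
    define q where "q = ?q t"
    define A where "A = ?A t"
    have q: "q > 0" using sq_gt_1[OF elim] by (simp add: q_def)
    have tt: "t * t = q * q + 1" using sq_gt_1[OF elim] by (simp add: q_def power2_eq_square)
    have D: "Debye_phase t = q - A" by (simp add: Debye_phase_def q_def A_def)
    define P where "P = q - A"
    have t0: "t > 0" using elim by simp
    have 1: "(3 * (t / q) * A * (1 / q) - (1 / q)\<^sup>2 / (t / q) - 2 * (t / q)) * (1 / q) / 8
       = q\<^sup>2 * ((3 * t * A - q / t - 2 * t * q) / (8 * q ^ 5))"
      using q t0 by (simp add: divide_simps eval_nat_numeral)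
    have 2: "3 * (A - 1 / q + A * (1 / q)\<^sup>2) / (t / q) + 5 * (1 / q) / (t / q) - 15 * (P / q) * (t / q) * (1 / q)
       = q\<^sup>2 * (q / t * (3 / q + 5 / q ^ 3) - P * t * (3 / q ^ 3 + 15 / q ^ 5))"
      using q t0 P_def by (simp add: divide_simps eval_nat_numeral) (use tt in algebra)
    show ?case
      unfolding h_def Theta_prim'_def Let_def q_def[symmetric] A_def[symmetric] D P_def[symmetric] 1 2
      using q t0 by (simp add: divide_simps eval_nat_numeral) 
  qed
  ultimately show ?thesis using Lim_transform_eventually by fastforce
qed

lemma isCont_Theta_integrand:
  assumes t: "t > 1"
  shows "isCont (\<lambda>t. Theta_prim' t * (- (Debye_phase t)\<^sup>2 * t / (pi * sqrt (t\<^sup>2 - 1)))) t"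
proof -
  have q: "sqrt (t\<^sup>2 - 1) > 0" using sq_gt_1[OF t] by simp
  have A: "((\<lambda>t. arccos (1 / t)) \<longlongrightarrow> arccos (1 / t)) (at t)"
    using DERIV_isCont[OF DERIV_arccos_inverse[OF t]] by (simp add: isCont_def)
  have P: "(Debye_phase \<longlongrightarrow> Debye_phase t) (at t)"
    using DERIV_isCont[OF DERIV_Debye_phase[OF t]] by (simp add: isCont_def)
  have Q: "((\<lambda>t. sqrt (t\<^sup>2 - 1)) \<longlongrightarrow> sqrt (t\<^sup>2 - 1)) (at t)"
    using DERIV_isCont[OF DERIV_sqrt_sq_minus_1[OF t]] by (simp add: isCont_def)
  show ?thesis unfolding isCont_def Theta_prim'_def Let_def
    by (intro tendsto_diff tendsto_mult tendsto_divide tendsto_add tendsto_power tendsto_const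
          tendsto_minus tendsto_ident_at A P Q) (use q t in \<open>simp_all del: real_sqrt_gt_0_iff real_sqrt_eq_zero_cancel_iff\<close>)
qed

text \<open>
  The fundamental theorem of calculus between 0 and \<open>x\<close>; in the proof, \<open>h\<close> extends \<open>Theta0\<close> continuously to 0, which gives integrability.
\<close>

lemma Theta0_integral:
  assumes x: "x > 0"
  shows "set_integrable lborel {0<..<x} Theta0"
    and "(LBINT t:{0<..<x}. Theta0 t) = Theta_prim (f_fun x) + 1 / (2 * pi\<^sup>2)"
proof -
  define T where "T t = Theta_prim' t * (- (Debye_phase t)\<^sup>2 * t / (pi * sqrt (t\<^sup>2 - 1)))" for t
  have TT: "Theta0 u = T (f_fun u)" if "u > 0" for u using Theta0_eq[OF that] by (simp add: T_def)
  have fc: "isCont f_fun u" if "u > 0" for u using DERIV_isCont[OF DERIV_f_fun[OF that]] .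
  have Tc: "isCont (\<lambda>u. T (f_fun u)) u" if "u > 0" for u
    using isCont_o2[OF fc[OF that], of T] isCont_Theta_integrand[OF f_fun_props(1)[OF that]]
    by (simp add: T_def[abs_def])
  have Thc: "isCont Theta0 u" if "u > 0" for u
  proof -
    have "\<forall>\<^sub>F v in nhds u. v \<in> {0<..}" using that by (intro eventually_nhds_in_open) auto
    then have "\<forall>\<^sub>F v in nhds u. T (f_fun v) = Theta0 v" by eventually_elim (simp add: TT)
    from isCont_cong[OF this] show ?thesis using Tc[OF that] by simp
  qed
  define h where "h u = (if u = 0 then 1 / (4 * pi\<^sup>2) else Theta0 u)" for u
  have "continuous_on {0..x} h"
    unfolding continuous_on_eq_continuous_within
  proof
    fix u assume u: "u \<in> {0..x}"
    show "continuous (at u within {0..x}) h"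
    proof (cases "u = 0")
      case True
      have "((\<lambda>u. T (f_fun u)) \<longlongrightarrow> 1 / (4 * pi\<^sup>2)) (at_right 0)"
        by (rule filterlim_compose[OF Theta_integrand_at_top[folded T_def] f_fun_at_top])
      moreover have "\<forall>\<^sub>F u in at_right 0. T (f_fun u) = h u"
        unfolding eventually_at_right_field by (intro exI[of _ 1]) (auto simp: h_def TT)
      ultimately have "(h \<longlongrightarrow> 1 / (4 * pi\<^sup>2)) (at_right 0)" by (rule Lim_transform_eventually)
      then show ?thesis using True x by (simp add: continuous_within h_def[of 0] at_within_Icc_at_right)
    next
      case False
      then have "u > 0" using u by simp
      have "\<forall>\<^sub>F v in nhds u. v \<in> {0<..}" using \<open>u > 0\<close> by (intro eventually_nhds_in_open) auto
      then have "\<forall>\<^sub>F v in nhds u. Theta0 v = h v" by eventually_elim (simp add: h_def)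
      from isCont_cong[OF this] have "isCont h u" using Thc[OF \<open>u > 0\<close>] by simp
      then show ?thesis by (rule continuous_at_imp_continuous_at_within)
    qed
  qed
  then have "set_integrable lborel {0..x} h"
    by (intro borel_integrable_atLeastAtMost') auto
  then have "set_integrable lborel {0<..<x} h"
    by (rule set_integrable_subset) auto
  then show 1: "set_integrable lborel {0<..<x} Theta0"
    by (subst (asm) set_integrable_cong[OF refl]) (auto simp: h_def)
  have e: "einterval 0 (ereal x) = {0<..<x}" by (auto simp: einterval_def)
  have "(LBINT t=0..ereal x. Theta0 t) = Theta_prim (f_fun x) - - 1 / (2 * pi\<^sup>2)"
  proof (rule interval_integral_FTC_integrable[where F="\<lambda>u. Theta_prim (f_fun u)"])
    fix u assume "0 < ereal u" "ereal u < ereal x"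
    then have u: "u > 0" by simp
    show "isCont Theta0 u" by (rule Thc[OF u])
    show "((\<lambda>u. Theta_prim (f_fun u)) has_vector_derivative Theta0 u) (at u)"
      unfolding has_real_derivative_iff_has_vector_derivative[symmetric] Theta0_eq[OF u]
      by (rule DERIV_chain2[OF DERIV_Theta_prim[OF f_fun_props(1)[OF u]] DERIV_f_fun[OF u]])
  next
    show "(((\<lambda>u. Theta_prim (f_fun u)) \<circ> real_of_ereal) \<longlongrightarrow> - 1 / (2 * pi\<^sup>2)) (at_right 0)"
      unfolding zero_ereal_def ereal_tendsto_simps
      by (rule filterlim_compose[OF Theta_prim_at_top f_fun_at_top])
    have "isCont (\<lambda>u. Theta_prim (f_fun u)) x"
      by (rule DERIV_isCont[OF DERIV_chain2[OF DERIV_Theta_prim[OF f_fun_props(1)[OF x]] DERIV_f_fun[OF x]]])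
    then show "(((\<lambda>u. Theta_prim (f_fun u)) \<circ> real_of_ereal) \<longlongrightarrow> Theta_prim (f_fun x)) (at_left (ereal x))"
      unfolding ereal_tendsto_simps isCont_def by (rule filterlim_mono) (auto simp: at_le)
  qed (use x 1 e in auto)
  then show "(LBINT t:{0<..<x}. Theta0 t) = Theta_prim (f_fun x) + 1 / (2 * pi\<^sup>2)"
    using x by (simp add: interval_lebesgue_integral_def e)
qed

section \<open>The zero-free interval and polar coordinates\<close>

text \<open>
  The zeros in a compact interval bounded away from 0 form a compact set, which has a least element.
\<close>

lemma first_zero:
  fixes f :: "real \<Rightarrow> real"
  assumes cont: "continuous_on {0<..} f" and pos: "\<forall>\<^sub>F z in at_right 0. f z > 0"
    and z1: "z1 > 0" "f z1 \<le> 0"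
  obtains z where "0 < z" "z \<le> z1" "f z = 0" "\<And>w. 0 < w \<Longrightarrow> w < z \<Longrightarrow> f w > 0"
proof -
  obtain e where e: "e > 0" "\<And>w. 0 < w \<Longrightarrow> w < e \<Longrightarrow> f w > 0"
    using pos unfolding eventually_at_right_field by auto
  define a where "a = min (e / 2) (z1 / 2)"
  have a: "0 < a" "a < e" "a < z1" using e z1 by (auto simp: a_def min_def)
  have c: "continuous_on {a..w} f" for w by (rule continuous_on_subset[OF cont]) (use a in auto)
  define S where "S = {z \<in> {a..z1}. f z = 0}"
  have "closed S" unfolding S_def by (rule continuous_closed_preimage_constant[OF c]) auto
  moreover have "bounded S" by (rule bounded_subset[of "{a..z1}"]) (auto simp: S_def)
  ultimately have "compact S" by (simp add: compact_eq_bounded_closed)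
  moreover have "S \<noteq> {}"
  proof -
    have "\<exists>x\<ge>a. x \<le> z1 \<and> f x = 0"
      by (rule IVT2'[of f]) (use a e z1 c in \<open>auto intro: less_imp_le\<close>)
    then show ?thesis by (auto simp: S_def)
  qed
  ultimately obtain z where z: "z \<in> S" "\<And>w. w \<in> S \<Longrightarrow> z \<le> w"
    using compact_attains_inf by metis
  show ?thesis
  proof (rule that[of z])
    show "0 < z" "z \<le> z1" "f z = 0" using z(1) a by (auto simp: S_def)
    fix w assume w: "0 < w" "w < z"
    show "f w > 0"
    proof (rule ccontr)
      assume n: "\<not> f w > 0"
      then have "w \<ge> a" using e(2)[of w] w a by force
      then have "\<exists>x\<ge>a. x \<le> w \<and> f x = 0"
        by (intro IVT2'[of f]) (use a e n c in \<open>auto intro: less_imp_le\<close>)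
      then obtain x where "x \<ge> a" "x \<le> w" "f x = 0" by auto
      then have "x \<in> S" using w z(1) by (auto simp: S_def)
      from z(2)[OF this] show False using w \<open>x \<le> w\<close> by simp
    qed
  qed
qed

text \<open>
  The Euler derivative \<open>z * J' z\<close>. In the pair \<open>J\<close> and \<open>z * J'\<close> Bessel's equation becomes a first-order system without
  a term of first order.
\<close>

definition besselJ_zderiv :: "real \<Rightarrow> real \<Rightarrow> real" where
  "besselJ_zderiv \<nu> z = \<nu> * besselJ \<nu> z - z * besselJ (\<nu> + 1) z"

lemma DERIV_besselJ:
  assumes "z > 0"
  shows "(besselJ \<nu> has_real_derivative besselJ_zderiv \<nu> z / z) (at z)"
  unfolding besselJ_eq_cyl[abs_def] besselJ_zderiv_def
  by (rule DERIV_cong[OF DERIV_bessel_cyl[OF assms]]) (use assms in \<open>simp add: field_simps\<close>)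

lemma DERIV_besselJ_zderiv:
  assumes "z > 0"
  shows "(besselJ_zderiv \<nu> has_real_derivative - ((z\<^sup>2 - \<nu>\<^sup>2) / z * besselJ \<nu> z)) (at z)"
proof -
  have 1: "(besselJ (\<nu> + 1) has_real_derivative besselJ \<nu> z - (\<nu> + 1) / z * besselJ (\<nu> + 1) z) (at z)"
    using DERIV_bessel_cyl'[OF assms, of "- 1" "\<nu> + 1"] by (simp add: besselJ_eq_cyl[abs_def])
  show ?thesis unfolding besselJ_zderiv_def[abs_def]
    by (rule DERIV_cong[OF DERIV_diff[OF DERIV_cmult[OF DERIV_besselJ[OF assms]] DERIV_mult[OF DERIV_ident 1]]])
       (use assms in \<open>simp add: besselJ_zderiv_def field_simps power2_eq_square\<close>)
qed

lemma besselJ_small: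
  assumes "\<nu> > 0"
  shows "\<forall>\<^sub>F z in at_right 0. besselJ \<nu> z > 0" "\<forall>\<^sub>F z in at_right 0. besselJ_zderiv \<nu> z > 0"
proof -
  have g: "rGamma (\<nu> + 1) > 0" using assms by (simp add: rGamma_inverse_Gamma)
  have l: "((\<lambda>z. z powr (- \<nu>) * besselJ \<nu> z) \<longlongrightarrow> 2 powr (- \<nu>) * rGamma (\<nu> + 1)) (at_right 0)"
    using bessel_cyl_tendsto_0[of \<nu> "- 1"] by (simp add: besselJ_eq_cyl)
  have l1: "((\<lambda>z. z powr (- (\<nu> + 1)) * besselJ (\<nu> + 1) z) \<longlongrightarrow> 2 powr (- (\<nu> + 1)) * rGamma (\<nu> + 1 + 1)) (at_right 0)"
    using bessel_cyl_tendsto_0[of "\<nu> + 1" "- 1"] by (simp add: besselJ_eq_cyl)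
  have p: "\<forall>\<^sub>F z::real in at_right 0. z > 0" by (simp add: eventually_at_right_less)
  have "\<forall>\<^sub>F z in at_right 0. z powr (- \<nu>) * besselJ \<nu> z > 0"
    by (rule order_tendstoD(1)[OF l]) (use g in simp)
  with p show "\<forall>\<^sub>F z in at_right 0. besselJ \<nu> z > 0"
    by eventually_elim (simp add: zero_less_mult_iff)
  have "((\<lambda>z. \<nu> * (z powr (- \<nu>) * besselJ \<nu> z) - z\<^sup>2 * (z powr (- (\<nu> + 1)) * besselJ (\<nu> + 1) z))
     \<longlongrightarrow> \<nu> * (2 powr (- \<nu>) * rGamma (\<nu> + 1)) - 0\<^sup>2 * (2 powr (- (\<nu> + 1)) * rGamma (\<nu> + 1 + 1))) (at_right 0)"
    by (intro tendsto_intros l l1)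
  then have "\<forall>\<^sub>F z in at_right 0. \<nu> * (z powr (- \<nu>) * besselJ \<nu> z) - z\<^sup>2 * (z powr (- (\<nu> + 1)) * besselJ (\<nu> + 1) z) > 0"
    by (rule order_tendstoD(1)) (use g assms in simp)
  with p show "\<forall>\<^sub>F z in at_right 0. besselJ_zderiv \<nu> z > 0"
  proof eventually_elim
    case (elim z)
    have "z powr (- (\<nu> + 1)) = z powr (- \<nu>) / z" using elim(1) by (simp add: powr_diff)
    then have "\<nu> * (z powr (- \<nu>) * besselJ \<nu> z) - z\<^sup>2 * (z powr (- (\<nu> + 1)) * besselJ (\<nu> + 1) z)
      = z powr (- \<nu>) * besselJ_zderiv \<nu> z"
      using elim(1) by (simp add: besselJ_zderiv_def algebra_simps power2_eq_square)
    then show ?case using elim by (simp add: zero_less_mult_iff)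
  qed
qed

lemma continuous_on_besselJ: "continuous_on {0<..} (besselJ \<nu>)"
  by (intro continuous_at_imp_continuous_on ballI DERIV_isCont[OF DERIV_besselJ]) auto

text \<open>
  The point \<open>b\<close> with \<open>sqrt (b\<^sup>2 - \<nu>\<^sup>2) = \<nu> powr (2/3)\<close>. The exponent is explained at \<open>zero_free_end_values\<close>.
\<close>

definition zero_free_end :: "real \<Rightarrow> real" where
  "zero_free_end \<nu> = sqrt (\<nu>\<^sup>2 + (\<nu> powr (2/3))\<^sup>2)"

lemma zero_free_end_gt: "\<nu> > 0 \<Longrightarrow> zero_free_end \<nu> > \<nu>"
  unfolding zero_free_end_def by (rule real_less_rsqrt) simp

text \<open>
  Sturm comparison. Up to \<open>\<nu>\<close> both \<open>J\<close> and \<open>z * J'\<close> increase from positive values. Beyond \<open>\<nu>\<close>, in the variable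
  \<open>ln z\<close> the equation reads \<open>J'' = - (z\<^sup>2 - \<nu>\<^sup>2) * J\<close>, whose coefficient is at most \<open>m\<^sup>2\<close> with \<open>m = \<nu> powr (2/3)\<close> up to the
  end of the interval. So \<open>J\<close> cannot vanish before \<open>cos (m * ln (z / \<nu>))\<close> does, and the choice of the exponent 2/3
  keeps that angle at most 1/2. At the first zero the comparison would force \<open>z * J' > 0\<close>, but \<open>J\<close> arrives there from above.
\<close>

lemma besselJ_pos_initial:
  assumes \<nu>: "\<nu> > 0" and z: "0 < z" "z \<le> zero_free_end \<nu>"
  shows "besselJ \<nu> z > 0"
proof (rule ccontr)
  define b where "b = zero_free_end \<nu>"
  define m where "m = \<nu> powr (2/3)"
  have m: "m > 0" using \<nu> by (simp add: m_def)
  have b2: "b\<^sup>2 = \<nu>\<^sup>2 + m\<^sup>2" by (simp add: b_def zero_free_end_def m_def)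
  have bnu: "b > \<nu>" using zero_free_end_gt[OF \<nu>] by (simp add: b_def)
  let ?J = "besselJ \<nu>" and ?W = "besselJ_zderiv \<nu>"
  assume "\<not> ?J z > 0"
  then obtain zs where zs: "0 < zs" "zs \<le> z" "?J zs = 0" and pos: "\<And>w. 0 < w \<Longrightarrow> w < zs \<Longrightarrow> ?J w > 0"
    using first_zero[OF continuous_on_besselJ besselJ_small(1)[OF \<nu>] z(1)] by (metis not_less)
  define t where "t = min zs \<nu>"
  have t: "0 < t" "t \<le> zs" "t \<le> \<nu>" using zs \<nu> by (auto simp: t_def)
  have posle: "?J w \<ge> 0" if "0 < w" "w \<le> zs" for w using pos[of w] zs(3) that by (cases "w = zs") auto
  have "\<forall>\<^sub>F w in at_right 0. ?J w > 0 \<and> ?W w > 0 \<and> w < t"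
    using besselJ_small[OF \<nu>] eventually_at_right_real[OF t(1)]
    by (auto elim!: eventually_elim2 simp: eventually_conj_iff)
  then obtain e where e: "e > 0" "\<And>w. 0 < w \<Longrightarrow> w < e \<Longrightarrow> ?J w > 0 \<and> ?W w > 0 \<and> w < t"
    unfolding eventually_at_right_field by auto
  have W: "?W w > 0" if w: "0 < w" "w \<le> t" for w
  proof -
    define w0 where "w0 = min (e / 2) w"
    have w0: "0 < w0" "w0 < e" "w0 \<le> w" using e w by (auto simp: w0_def)
    have "?W w0 \<le> ?W w"
    proof (rule DERIV_nonneg_imp_nondecreasing[OF w0(3)])
      fix u assume u: "w0 \<le> u" "u \<le> w"
      then have u0: "u > 0" using w0 by simp
      have "u\<^sup>2 \<le> \<nu>\<^sup>2" using u w t u0 by (intro power_mono) auto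
      then have "- ((u\<^sup>2 - \<nu>\<^sup>2) / u * ?J u) \<ge> 0"
        using posle[of u] u w t u0 by (simp add: mult_nonpos_nonneg divide_nonpos_pos)
      then show "\<exists>y. DERIV ?W u :> y \<and> 0 \<le> y" using DERIV_besselJ_zderiv[OF u0] by blast
    qed
    then show ?thesis using e(2)[OF w0(1,2)] by linarith
  qed
  have "?J t > 0"
  proof -
    define w0 where "w0 = min (e / 2) t"
    have w0: "0 < w0" "w0 < e" "w0 \<le> t" using e t by (auto simp: w0_def)
    have "?J w0 \<le> ?J t"
    proof (rule DERIV_nonneg_imp_nondecreasing[OF w0(3)])
      fix u assume u: "w0 \<le> u" "u \<le> t"
      then have u0: "u > 0" using w0 by simp
      have "?W u / u \<ge> 0" using W[of u] u u0 by simp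
      then show "\<exists>y. DERIV ?J u :> y \<and> 0 \<le> y" using DERIV_besselJ[OF u0] by blast
    qed
    then show ?thesis using e(2)[OF w0(1,2)] by linarith
  qed
  then have "t = \<nu>" "\<nu> < zs" using zs by (auto simp: t_def min_def split: if_splits)
  then have Wnu: "?W \<nu> > 0" using W[of \<nu>] \<nu> by simp
  have zsb: "zs \<le> b" using zs z by (simp add: b_def)
  \<comment> \<open>The Wronskian, in the variable \<open>ln u\<close>, of \<open>J\<close> and the comparison function \<open>cos (m * ln (u / \<nu>))\<close>.\<close>
  define X where "X u = ?W u * cos (m * ln (u / \<nu>)) + m * ?J u * sin (m * ln (u / \<nu>))" for u
  have angle: "0 \<le> m * ln (u / \<nu>)" "m * ln (u / \<nu>) \<le> 1 / 2" if u: "\<nu> \<le> u" "u \<le> b" for u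
  proof -
    have u0: "u > 0" "u / \<nu> > 0" "u / \<nu> \<ge> 1" using u \<nu> by auto
    show "0 \<le> m * ln (u / \<nu>)" using u0 m by simp
    have "2 * ln (u / \<nu>) = ln ((u / \<nu>)\<^sup>2)" using u0 by (simp add: ln_realpow)
    also have "\<dots> \<le> (u / \<nu>)\<^sup>2 - 1" using u0 by (intro ln_le_minus_one) auto
    also have "\<dots> \<le> (b / \<nu>)\<^sup>2 - 1" using u \<nu> u0 by (intro diff_right_mono power_mono divide_right_mono) auto
    also have "\<dots> = m\<^sup>2 / \<nu>\<^sup>2" using \<nu> by (simp add: power_divide b2 field_simps)
    finally have "m * (2 * ln (u / \<nu>)) \<le> m * (m\<^sup>2 / \<nu>\<^sup>2)" using m by (intro mult_left_mono) auto
    also have "m * (m\<^sup>2 / \<nu>\<^sup>2) = 1"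
    proof -
      have "m ^ 3 = \<nu> powr (2 / 3 * 3)" unfolding m_def powr_powr[symmetric] using \<nu> by (simp add: powr_realpow)
      also have "\<dots> = \<nu>\<^sup>2" using \<nu> by (simp add: powr_numeral)
      finally show ?thesis using \<nu> by (simp add: power3_eq_cube power2_eq_square)
    qed
    finally show "m * ln (u / \<nu>) \<le> 1 / 2" by simp
  qed
  have cosp: "cos (m * ln (u / \<nu>)) > 0" if "\<nu> \<le> u" "u \<le> b" for u
    using angle[OF that] pi_gt3 by (intro cos_gt_zero_pi) auto
  have "X \<nu> \<le> X zs"
  proof (rule DERIV_nonneg_imp_nondecreasing[where f=X and a=\<nu> and b=zs])
    show "\<nu> \<le> zs" using \<open>\<nu> < zs\<close> by simp
    fix u assume u: "\<nu> \<le> u" "u \<le> zs"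
    have u0: "u > 0" using u \<nu> by simp
    have dl: "((\<lambda>u. m * ln (u / \<nu>)) has_real_derivative m * (1 / u)) (at u)"
      using u0 \<nu> by (auto intro!: derivative_eq_intros)
    have "(X has_real_derivative
       (- ((u\<^sup>2 - \<nu>\<^sup>2) / u * ?J u)) * cos (m * ln (u / \<nu>)) + (- sin (m * ln (u / \<nu>)) * (m * (1 / u))) * ?W u
       + ((m * (?W u / u)) * sin (m * ln (u / \<nu>)) + (cos (m * ln (u / \<nu>)) * (m * (1 / u))) * (m * ?J u))) (at u)"
      unfolding X_def
      by (intro DERIV_add DERIV_mult DERIV_besselJ_zderiv DERIV_cmult DERIV_besselJ u0
            DERIV_chain2[OF DERIV_cos dl] DERIV_chain2[OF DERIV_sin dl])
    also have "(- ((u\<^sup>2 - \<nu>\<^sup>2) / u * ?J u)) * cos (m * ln (u / \<nu>)) + (- sin (m * ln (u / \<nu>)) * (m * (1 / u))) * ?W u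
       + ((m * (?W u / u)) * sin (m * ln (u / \<nu>)) + (cos (m * ln (u / \<nu>)) * (m * (1 / u))) * (m * ?J u))
       = (b\<^sup>2 - u\<^sup>2) / u * ?J u * cos (m * ln (u / \<nu>))"
      unfolding b2 using u0 by (simp add: field_simps power2_eq_square)
    finally have "(X has_real_derivative (b\<^sup>2 - u\<^sup>2) / u * ?J u * cos (m * ln (u / \<nu>))) (at u)" .
    moreover have "(b\<^sup>2 - u\<^sup>2) / u * ?J u * cos (m * ln (u / \<nu>)) \<ge> 0"
    proof -
      have "u\<^sup>2 \<le> b\<^sup>2" using u zsb u0 by (intro power_mono) auto
      then show ?thesis using posle[of u] u u0 cosp[of u] zsb by (intro mult_nonneg_nonneg) auto
    qed
    ultimately show "\<exists>y. DERIV X u :> y \<and> 0 \<le> y" by blast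
  qed
  moreover have "X \<nu> = ?W \<nu>" using \<nu> by (simp add: X_def)
  moreover have "X zs = ?W zs * cos (m * ln (zs / \<nu>))" by (simp add: X_def zs)
  ultimately have "?W zs * cos (m * ln (zs / \<nu>)) > 0" using Wnu by simp
  then have "?W zs > 0" using cosp[of zs] \<open>\<nu> < zs\<close> zsb by (simp add: zero_less_mult_iff)
  then have "?W zs / zs > 0" using zs by simp
  from DERIV_pos_inc_left[OF DERIV_besselJ[OF zs(1)] this]
  obtain d where d: "d > 0" "\<And>h. h > 0 \<Longrightarrow> h < d \<Longrightarrow> ?J (zs - h) < ?J zs" by auto
  define h where "h = min (d / 2) (zs / 2)"
  have "h > 0" "h < d" "h < zs" using d zs by (auto simp: h_def min_def)
  then show False using d(2)[of h] pos[of "zs - h"] zs(3) by simp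
qed

text \<open>
  Polar coordinates for the phase plane of a perturbed rotation. The angle is defined as an integral of the
  right-hand side of its own differential equation, in which \<open>(cos \<theta>)\<^sup>2\<close> is replaced by the known \<open>y\<^sup>2 / E\<close>. It remains
  to see that it is the polar angle of \<open>(y, - v)\<close>: the rotated coordinates \<open>P\<close> and \<open>R\<close> both solve \<open>u' = k * u\<close>, so \<open>R\<close>
  stays 0 and \<open>P\<close> stays \<open>sqrt E\<close>.
\<close>

lemma Pruefer_angle:
  fixes y v \<sigma> \<psi> :: "real \<Rightarrow> real"
  assumes dy: "\<And>z. z > a \<Longrightarrow> (y has_real_derivative \<sigma> z * v z) (at z)"
    and dv: "\<And>z. z > a \<Longrightarrow> (v has_real_derivative - \<sigma> z * (1 + \<psi> z) * y z) (at z)"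
    and E: "\<And>z. z > a \<Longrightarrow> (y z)\<^sup>2 + (v z)\<^sup>2 > 0"
    and cont: "continuous_on {a<..} \<sigma>" "continuous_on {a<..} \<psi>"
    and b: "b > a" "y b > 0"
  obtains \<theta> where
    "\<And>z. z > a \<Longrightarrow> (\<theta> has_real_derivative \<sigma> z * (1 + \<psi> z * (cos (\<theta> z))\<^sup>2)) (at z)"
    "\<And>z. z > a \<Longrightarrow> y z = sqrt ((y z)\<^sup>2 + (v z)\<^sup>2) * cos (\<theta> z)"
    "\<And>z. z > a \<Longrightarrow> v z = - sqrt ((y z)\<^sup>2 + (v z)\<^sup>2) * sin (\<theta> z)"
    "- pi / 2 < \<theta> b" "\<theta> b < pi / 2"
proof -
  define E where "E z = (y z)\<^sup>2 + (v z)\<^sup>2" for z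
  have E0: "E z > 0" if "z > a" for z using assms(3)[OF that] by (simp add: E_def)
  have cy: "continuous_on {a<..} y" by (intro continuous_at_imp_continuous_on ballI DERIV_isCont[OF dy]) auto
  have cv: "continuous_on {a<..} v" by (intro continuous_at_imp_continuous_on ballI DERIV_isCont[OF dv]) auto
  define h where "h z = \<sigma> z * (1 + \<psi> z * ((y z)\<^sup>2 / E z))" for z
  have ch: "continuous_on {a<..} h"
    unfolding h_def E_def by (intro continuous_intros cont cy cv) (use assms(3) in force)
  define c where "c = (a + b) / 2"
  have c: "a < c" "c < b" using b by (auto simp: c_def)
  define \<theta>b where "\<theta>b = - arctan (v b / y b)"
  \<comment> \<open>The antiderivative of \<open>h\<close> with value \<open>\<theta>b\<close> at \<open>b\<close>; the base point \<open>c\<close> lies between \<open>a\<close> and \<open>b\<close>.\<close>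
  define \<theta> where "\<theta> z = \<theta>b + (if z \<ge> c then integral {c..z} h else - integral {z..c} h) - integral {c..b} h" for z
  have d\<theta>: "(\<theta> has_real_derivative h z) (at z)" if z: "z > a" for z
  proof -
    define l where "l = (a + min z c) / 2"
    define u where "u = max z c + 1"
    have lu: "a < l" "l < z" "l < c" "z < u" "c < u" using z c by (auto simp: l_def u_def min_def max_def)
    have ci: "continuous_on {l..u} h" by (rule continuous_on_subset[OF ch]) (use lu in auto)
    have io: "h integrable_on {p..q}" if "l \<le> p" "q \<le> u" for p q
      by (intro integrable_continuous_interval continuous_on_subset[OF ci]) (use that in auto)
    have "((\<lambda>x. integral {l..x} h) has_real_derivative h z) (at z within {l..u})"
      by (rule integral_has_real_derivative[OF ci]) (use lu in auto)
    then have "((\<lambda>x. integral {l..x} h) has_real_derivative h z) (at z)"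
      using lu by (simp add: at_within_Icc_at)
    then have "((\<lambda>x. \<theta>b + (integral {l..x} h - integral {l..c} h) - integral {c..b} h) has_real_derivative h z) (at z)"
      by (auto intro!: derivative_eq_intros)
    moreover have "\<forall>\<^sub>F x in nhds z. x \<in> {l<..<u}" using lu by (intro eventually_nhds_in_open) auto
    then have "\<forall>\<^sub>F x in nhds z. \<theta>b + (integral {l..x} h - integral {l..c} h) - integral {c..b} h = \<theta> x"
    proof eventually_elim
      case (elim x)
      have "integral {l..c} h + integral {c..x} h = integral {l..x} h" if "c \<le> x"
        by (rule Henstock_Kurzweil_Integration.integral_combine) (use that elim lu io in auto)
      moreover have "integral {l..x} h + integral {x..c} h = integral {l..c} h" if "x \<le> c"
        by (rule Henstock_Kurzweil_Integration.integral_combine) (use that elim lu io in auto)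
      ultimately show ?case unfolding \<theta>_def by (cases "c \<le> x") auto
    qed
    ultimately show ?thesis by (subst (asm) DERIV_cong_ev[OF refl _ refl]) auto
  qed
  have \<theta>b: "\<theta> b = \<theta>b" using c by (simp add: \<theta>_def)
  define P where "P z = y z * cos (\<theta> z) - v z * sin (\<theta> z)" for z
  define R where "R z = y z * sin (\<theta> z) + v z * cos (\<theta> z)" for z
  define k where "k z = - (\<sigma> z * \<psi> z / E z * (y z * v z))" for z
  have dcos: "((\<lambda>z. cos (\<theta> z)) has_real_derivative - sin (\<theta> z) * h z) (at z)" if "z > a" for z
    by (rule DERIV_chain2[OF DERIV_cos d\<theta>[OF that]])
  have dsin: "((\<lambda>z. sin (\<theta> z)) has_real_derivative cos (\<theta> z) * h z) (at z)" if "z > a" for z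
    by (rule DERIV_chain2[OF DERIV_sin d\<theta>[OF that]])
  have h1: "\<sigma> z - h z = - (\<sigma> z * \<psi> z / E z * (y z)\<^sup>2)" for z
    unfolding h_def by (simp add: algebra_simps)
  have h2: "\<sigma> z * (1 + \<psi> z) - h z = \<sigma> z * \<psi> z / E z * (v z)\<^sup>2" if "z > a" for z
  proof -
    have EE: "(y z)\<^sup>2 + (v z)\<^sup>2 = E z" by (simp add: E_def)
    have "\<sigma> z * \<psi> z / E z * ((y z)\<^sup>2 + (v z)\<^sup>2) = \<sigma> z * \<psi> z" unfolding EE using E0[OF that] by simp
    then have "\<sigma> z * \<psi> z / E z * (v z)\<^sup>2 = \<sigma> z * \<psi> z - \<sigma> z * \<psi> z / E z * (y z)\<^sup>2"
      unfolding distrib_left by linarith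
    then show ?thesis unfolding h_def by (simp add: algebra_simps)
  qed
  have dP: "(P has_real_derivative k z * P z) (at z)" if z: "z > a" for z
  proof -
    have "(P has_real_derivative (\<sigma> z * v z) * cos (\<theta> z) + (- sin (\<theta> z) * h z) * y z
        - ((- \<sigma> z * (1 + \<psi> z) * y z) * sin (\<theta> z) + (cos (\<theta> z) * h z) * v z)) (at z)"
      unfolding P_def by (intro DERIV_diff DERIV_mult dy dv dcos dsin z)
    also have "(\<sigma> z * v z) * cos (\<theta> z) + (- sin (\<theta> z) * h z) * y z
        - ((- \<sigma> z * (1 + \<psi> z) * y z) * sin (\<theta> z) + (cos (\<theta> z) * h z) * v z)
      = (\<sigma> z - h z) * v z * cos (\<theta> z) + (\<sigma> z * (1 + \<psi> z) - h z) * y z * sin (\<theta> z)"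
      by (simp add: algebra_simps)
    also have "\<dots> = k z * P z"
      unfolding h1 h2[OF z] k_def P_def by (simp add: algebra_simps power2_eq_square diff_divide_distrib add_divide_distrib)
    finally show ?thesis .
  qed
  have dR: "(R has_real_derivative k z * R z) (at z)" if z: "z > a" for z
  proof -
    have "(R has_real_derivative (\<sigma> z * v z) * sin (\<theta> z) + (cos (\<theta> z) * h z) * y z
        + ((- \<sigma> z * (1 + \<psi> z) * y z) * cos (\<theta> z) + (- sin (\<theta> z) * h z) * v z)) (at z)"
      unfolding R_def by (intro DERIV_add DERIV_mult dy dv dcos dsin z)
    also have "(\<sigma> z * v z) * sin (\<theta> z) + (cos (\<theta> z) * h z) * y z
        + ((- \<sigma> z * (1 + \<psi> z) * y z) * cos (\<theta> z) + (- sin (\<theta> z) * h z) * v z)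
      = (\<sigma> z - h z) * v z * sin (\<theta> z) - (\<sigma> z * (1 + \<psi> z) - h z) * y z * cos (\<theta> z)"
      by (simp add: algebra_simps)
    also have "\<dots> = k z * R z"
      unfolding h1 h2[OF z] k_def R_def by (simp add: algebra_simps power2_eq_square diff_divide_distrib add_divide_distrib)
    finally show ?thesis .
  qed
  have PR: "(P z)\<^sup>2 + (R z)\<^sup>2 = E z" for z
  proof -
    have "(P z)\<^sup>2 + (R z)\<^sup>2 = ((y z)\<^sup>2 + (v z)\<^sup>2) * ((sin (\<theta> z))\<^sup>2 + (cos (\<theta> z))\<^sup>2)"
      unfolding P_def R_def by algebra
    then show ?thesis by (simp add: E_def)
  qed
  have init: "y b = sqrt (E b) * cos \<theta>b" "v b = - sqrt (E b) * sin \<theta>b"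
  proof -
    have "sqrt (E b) = y b * sqrt (1 + (v b / y b)\<^sup>2)"
    proof -
      have "E b = (y b)\<^sup>2 * (1 + (v b / y b)\<^sup>2)" using b by (simp add: E_def power_divide field_simps)
      then show ?thesis using b by (simp add: real_sqrt_mult)
    qed
    moreover have "sqrt (1 + (v b / y b)\<^sup>2) > 0" by (simp add: add_pos_nonneg)
    ultimately show "y b = sqrt (E b) * cos \<theta>b" "v b = - sqrt (E b) * sin \<theta>b"
      unfolding \<theta>b_def using b by (simp_all add: cos_arctan sin_arctan)
  qed
  have Pb: "P b = sqrt (E b)"
  proof -
    have "P b = sqrt (E b) * ((sin \<theta>b)\<^sup>2 + (cos \<theta>b)\<^sup>2)"
      unfolding P_def \<theta>b using init by algebra
    then show ?thesis by simp
  qed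
  have Rb: "R b = 0" unfolding R_def \<theta>b using init by (simp add: algebra_simps)
  \<comment> \<open>\<open>P\<close>, \<open>R\<close> solve the same first-order equation, so \<open>R / P\<close> would be constant; division by \<open>E\<close> avoids zeros of \<open>P\<close>\<close>
  have dE: "(E has_real_derivative 2 * k z * E z) (at z)" if z: "z > a" for z
  proof -
    have "((\<lambda>z. (P z)\<^sup>2 + (R z)\<^sup>2) has_real_derivative 2 * (k z * P z) * P z + 2 * (k z * R z) * R z) (at z)"
      using dP[OF z] dR[OF z] by (auto intro!: derivative_eq_intros)
    then show ?thesis unfolding PR by (rule DERIV_cong) (simp add: PR[symmetric] power2_eq_square algebra_simps)
  qed
  have R0: "R z = 0" if z: "z > a" for z
  proof -
    have "((\<lambda>z. (R z)\<^sup>2 / E z) has_real_derivative 0) (at z)" if z: "z > a" for z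
    proof -
      have dR2: "((\<lambda>z. (R z)\<^sup>2) has_real_derivative 2 * k z * (R z)\<^sup>2) (at z)"
        using dR[OF z] by (auto intro!: derivative_eq_intros simp: power2_eq_square)
      show ?thesis
        by (rule DERIV_cong[OF DERIV_divide[OF dR2 dE[OF z]]]) (use E0[OF z] in auto)
    qed
    then obtain q where q: "\<And>z. z > a \<Longrightarrow> (R z)\<^sup>2 / E z = q"
      using has_field_derivative_zero_constant[of "{a<..}" "\<lambda>z. (R z)\<^sup>2 / E z"]
      by (auto intro: has_field_derivative_at_within)
    have "q = 0" using q[OF b(1)] Rb by simp
    then show ?thesis using q[OF z] E0[OF z] by simp
  qed
  have P1: "P z = sqrt (E z)" if z: "z > a" for z
  proof -
    have "((\<lambda>z. P z / sqrt (E z)) has_real_derivative 0) (at z)" if z: "z > a" for z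
    proof -
      have "((\<lambda>z. sqrt (E z)) has_real_derivative k z * sqrt (E z)) (at z)"
      proof -
        have "((\<lambda>z. sqrt (E z)) has_real_derivative inverse (sqrt (E z)) / 2 * (2 * k z * E z)) (at z)"
          by (rule DERIV_chain2[OF DERIV_real_sqrt[OF E0[OF z]] dE[OF z]])
        moreover have "inverse (sqrt (E z)) / 2 * (2 * k z * E z) = k z * (E z / sqrt (E z))"
          by (simp add: inverse_eq_divide)
        moreover have "E z / sqrt (E z) = sqrt (E z)" using E0[OF z] by (simp add: real_div_sqrt)
        ultimately show ?thesis by (simp only:)
      qed
      from DERIV_divide[OF dP[OF z] this] E0[OF z] show ?thesis by (simp add: mult_ac)
    qed
    then obtain q where q: "\<And>z. z > a \<Longrightarrow> P z / sqrt (E z) = q"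
      using has_field_derivative_zero_constant[of "{a<..}" "\<lambda>z. P z / sqrt (E z)"]
      by (auto intro: has_field_derivative_at_within)
    have "q = 1" using q[OF b(1)] Pb E0[OF b(1)] by simp
    then show ?thesis using q[OF z] E0[OF z] by (simp add: divide_eq_eq)
  qed
  have y: "y z = sqrt (E z) * cos (\<theta> z)" and v: "v z = - sqrt (E z) * sin (\<theta> z)" if z: "z > a" for z
  proof -
    have "P z * cos (\<theta> z) + R z * sin (\<theta> z) = y z * ((sin (\<theta> z))\<^sup>2 + (cos (\<theta> z))\<^sup>2)"
      unfolding P_def R_def by algebra
    then show "y z = sqrt (E z) * cos (\<theta> z)" using P1[OF z] R0[OF z] by simp
    have "R z * cos (\<theta> z) - P z * sin (\<theta> z) = v z * ((sin (\<theta> z))\<^sup>2 + (cos (\<theta> z))\<^sup>2)"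
      unfolding P_def R_def by algebra
    then show "v z = - sqrt (E z) * sin (\<theta> z)" using P1[OF z] R0[OF z] by simp
  qed
  show ?thesis
  proof (rule that[of \<theta>])
    show "(\<theta> has_real_derivative \<sigma> z * (1 + \<psi> z * (cos (\<theta> z))\<^sup>2)) (at z)" if z: "z > a" for z
    proof -
      have "(y z)\<^sup>2 / E z = (cos (\<theta> z))\<^sup>2"
        unfolding y[OF z] using E0[OF z] by (simp add: power_mult_distrib)
      then show ?thesis using d\<theta>[OF z] by (simp add: h_def)
    qed
    show "- pi / 2 < \<theta> b" "\<theta> b < pi / 2" unfolding \<theta>b \<theta>b_def using arctan_bounded[of "v b / y b"] by auto
    show "y z = sqrt ((y z)\<^sup>2 + (v z)\<^sup>2) * cos (\<theta> z)" if "z > a" for z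
      using y[OF that] unfolding E_def .
    show "v z = - sqrt ((y z)\<^sup>2 + (v z)\<^sup>2) * sin (\<theta> z)" if "z > a" for z
      using v[OF that] unfolding E_def .
  qed
qed

lemma mono_bounded_tendsto_at_top:
  fixes f :: "real \<Rightarrow> real"
  assumes mono: "\<And>x y. b \<le> x \<Longrightarrow> x \<le> y \<Longrightarrow> f x \<le> f y" and bd: "\<And>x. b \<le> x \<Longrightarrow> f x \<le> B"
  obtains l where "(f \<longlongrightarrow> l) at_top" "\<And>x. b \<le> x \<Longrightarrow> f x \<le> l" "l \<le> B"
proof -
  define l where "l = (SUP x\<in>{b..}. f x)"
  have bdd: "bdd_above (f ` {b..})" using bd by (auto intro!: bdd_aboveI)
  have le: "f x \<le> l" if "b \<le> x" for x unfolding l_def by (rule cSUP_upper[OF _ bdd]) (use that in auto)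
  have lB: "l \<le> B" unfolding l_def by (rule cSUP_least) (use bd in auto)
  have "(f \<longlongrightarrow> l) at_top"
  proof (rule increasing_tendsto)
    show "\<forall>\<^sub>F x in at_top. f x \<le> l" using eventually_ge_at_top[of b] by eventually_elim (rule le)
    fix y assume "y < l"
    then obtain x0 where x0: "b \<le> x0" "y < f x0" unfolding l_def less_cSUP_iff[OF _ bdd, simplified] by auto
    show "\<forall>\<^sub>F x in at_top. y < f x"
      using eventually_ge_at_top[of x0] by eventually_elim (use x0 mono in force)
  qed
  with le lB show ?thesis using that by blast
qed

section \<open>The phase of the Bessel function\<close>

context
  fixes \<nu> :: real
  assumes \<nu>: "\<nu> > 0"
begin

text \<open>
  Liouville--Green variables above the turning point \<open>\<nu>\<close>: \<open>Ly\<close> is the rescaled Bessel function, \<open>L\<sigma>\<close> is the local frequency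
  and \<open>Ls\<close> the accumulated phase, \<open>L\<psi>\<close> is the relative error of the approximation by pure oscillation, and \<open>L\<delta>\<close> is
  minus half the antiderivative of \<open>L\<sigma> * L\<psi>\<close>, normalized to vanish at infinity. It is also Debye's first correction
  to the phase.
\<close>

definition LD :: "real \<Rightarrow> real" where "LD z = z\<^sup>2 - \<nu>\<^sup>2"
definition Lr :: "real \<Rightarrow> real" where "Lr z = sqrt (sqrt (LD z))"
definition Ly :: "real \<Rightarrow> real" where "Ly z = Lr z * besselJ \<nu> z"
definition Lv :: "real \<Rightarrow> real" where
  "Lv z = (besselJ_zderiv \<nu> z + z\<^sup>2 / (2 * LD z) * besselJ \<nu> z) / Lr z"
definition L\<sigma> :: "real \<Rightarrow> real" where "L\<sigma> z = sqrt (LD z) / z"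
definition L\<psi> :: "real \<Rightarrow> real" where "L\<psi> z = z\<^sup>2 * (z\<^sup>2 + 4 * \<nu>\<^sup>2) / (4 * LD z ^ 3)"
definition L\<delta> :: "real \<Rightarrow> real" where "L\<delta> z = 1 / (8 * sqrt (LD z)) + 5 * \<nu>\<^sup>2 / (24 * sqrt (LD z) ^ 3)"
definition Ls :: "real \<Rightarrow> real" where "Ls z = \<nu> * Debye_phase (z / \<nu>)"
definition LE :: "real \<Rightarrow> real" where "LE z = (Ly z)\<^sup>2 + (Lv z)\<^sup>2"

lemma LD_pos: "z > \<nu> \<Longrightarrow> LD z > 0"
  unfolding LD_def using \<nu> by (simp add: power_strict_mono)

lemma Lr_pos: "z > \<nu> \<Longrightarrow> Lr z > 0"
  unfolding Lr_def using LD_pos by simp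

lemma Lr_sq: "z > \<nu> \<Longrightarrow> Lr z * Lr z = sqrt (LD z)"
  unfolding Lr_def using LD_pos[of z] by simp

lemma Lr_4: "z > \<nu> \<Longrightarrow> Lr z ^ 4 = LD z"
proof -
  assume z: "z > \<nu>"
  have "Lr z ^ 4 = (Lr z * Lr z) * (Lr z * Lr z)" by (simp add: eval_nat_numeral)
  also have "\<dots> = LD z" unfolding Lr_sq[OF z] using LD_pos[OF z] by simp
  finally show ?thesis .
qed

lemma DERIV_LD: "(LD has_real_derivative 2 * z) (at z)"
  unfolding LD_def by (auto intro!: derivative_eq_intros)

lemma DERIV_sqrt_LD: "z > \<nu> \<Longrightarrow> ((\<lambda>z. sqrt (LD z)) has_real_derivative z / sqrt (LD z)) (at z)"
  by (rule DERIV_cong[OF DERIV_chain2[OF DERIV_real_sqrt DERIV_LD]])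
     (use LD_pos[of z] in \<open>auto simp: inverse_eq_divide\<close>)

lemma DERIV_Lr:
  assumes z: "z > \<nu>"
  shows "(Lr has_real_derivative z / (2 * Lr z ^ 3)) (at z)"
proof -
  have "(Lr has_real_derivative inverse (sqrt (sqrt (LD z))) / 2 * (z / sqrt (LD z))) (at z)"
    unfolding Lr_def[abs_def] using LD_pos[OF z]
    by (intro DERIV_chain2[OF DERIV_real_sqrt DERIV_sqrt_LD[OF z]]) simp
  moreover have "inverse (sqrt (sqrt (LD z))) / 2 * (z / sqrt (LD z)) = z / (2 * Lr z ^ 3)"
    unfolding Lr_sq[OF z, symmetric] Lr_def[symmetric] using Lr_pos[OF z]
    by (simp add: field_simps eval_nat_numeral)
  ultimately show ?thesis by simp
qed

lemma DERIV_Ly: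
  assumes z: "z > \<nu>"
  shows "(Ly has_real_derivative L\<sigma> z * Lv z) (at z)"
proof -
  have z0: "z > 0" using z \<nu> by simp
  have "(Ly has_real_derivative z / (2 * Lr z ^ 3) * besselJ \<nu> z + besselJ_zderiv \<nu> z / z * Lr z) (at z)"
    unfolding Ly_def by (intro DERIV_mult DERIV_Lr DERIV_besselJ z z0)
  moreover have "z / (2 * Lr z ^ 3) * besselJ \<nu> z + besselJ_zderiv \<nu> z / z * Lr z = L\<sigma> z * Lv z"
    unfolding L\<sigma>_def Lv_def Lr_sq[OF z, symmetric] unfolding Lr_4[OF z, symmetric] using Lr_pos[OF z] z0
    by (simp add: field_simps eval_nat_numeral)
  ultimately show ?thesis by simp
qed

text \<open>
  With \<open>DERIV_Ly\<close>, this is Bessel's equation as a rotation with speed \<open>L\<sigma>\<close>, perturbed by the relative amount \<open>L\<psi>\<close>.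
\<close>

lemma DERIV_Lv:
  assumes z: "z > \<nu>"
  shows "(Lv has_real_derivative - L\<sigma> z * (1 + L\<psi> z) * Ly z) (at z)"
proof -
  have z0: "z > 0" using z \<nu> by simp
  have D: "LD z > 0" and r: "Lr z > 0" using LD_pos[OF z] Lr_pos[OF z] by auto
  define J where "J = besselJ \<nu> z"
  define W where "W = besselJ_zderiv \<nu> z"
  define d where "d = LD z"
  define R where "R = Lr z"
  have Rd: "R ^ 4 = d" "R > 0" "d > 0" "\<nu>\<^sup>2 = z\<^sup>2 - d"
    unfolding R_def d_def using Lr_4[OF z] D r by (auto simp: LD_def)
  have d1: "((\<lambda>z. z\<^sup>2 / (2 * LD z)) has_real_derivative (2 * z * (2 * d) - z\<^sup>2 * (2 * (2 * z))) / ((2 * d) * (2 * d))) (at z)"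
    unfolding d_def using D
    by (intro DERIV_divide DERIV_cmult DERIV_LD) (auto intro!: derivative_eq_intros)
  have "(Lv has_real_derivative
     ((- ((z\<^sup>2 - \<nu>\<^sup>2) / z * J) + ((2 * z * (2 * d) - z\<^sup>2 * (2 * (2 * z))) / ((2 * d) * (2 * d)) * J + W / z * (z\<^sup>2 / (2 * d)))) * R
      - (W + z\<^sup>2 / (2 * d) * J) * (z / (2 * R ^ 3))) / (R * R)) (at z)"
    unfolding Lv_def[abs_def] J_def W_def R_def d_def using r
    by (intro DERIV_divide DERIV_add DERIV_mult d1[unfolded d_def] DERIV_besselJ DERIV_besselJ_zderiv DERIV_Lr z z0) auto
  moreover have "((- ((z\<^sup>2 - \<nu>\<^sup>2) / z * J) + ((2 * z * (2 * d) - z\<^sup>2 * (2 * (2 * z))) / ((2 * d) * (2 * d)) * J + W / z * (z\<^sup>2 / (2 * d)))) * R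
      - (W + z\<^sup>2 / (2 * d) * J) * (z / (2 * R ^ 3))) / (R * R) = - (R * R / z) * (1 + z\<^sup>2 * (z\<^sup>2 + 4 * \<nu>\<^sup>2) / (4 * d ^ 3)) * (R * J)"
    unfolding Rd(4) Rd(1)[symmetric] using Rd(2) z0
    by (simp add: divide_simps) algebra
  ultimately show ?thesis
    unfolding L\<sigma>_def L\<psi>_def Ly_def Lr_sq[OF z, symmetric] J_def R_def d_def by simp
qed

lemma DERIV_L\<delta>:
  assumes z: "z > \<nu>"
  shows "(L\<delta> has_real_derivative - (L\<sigma> z * L\<psi> z / 2)) (at z)"
proof -
  define q where "q = sqrt (LD z)"
  have q: "q > 0" "q ^ 2 = LD z" unfolding q_def using LD_pos[OF z] by auto
  have z0: "z > 0" using z \<nu> by simp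
  have dq: "((\<lambda>z. sqrt (LD z)) has_real_derivative z / q) (at z)"
    unfolding q_def by (rule DERIV_sqrt_LD[OF z])
  have dq3: "((\<lambda>z. 24 * sqrt (LD z) ^ 3) has_real_derivative 24 * (3 * (z / q * q\<^sup>2))) (at z)"
    using DERIV_cmult[OF DERIV_power[OF dq, of 3], of 24] by (simp add: q_def)
  have "(L\<delta> has_real_derivative (0 * (8 * q) - 1 * (8 * (z / q))) / ((8 * q) * (8 * q))
     + (0 * (24 * q ^ 3) - 5 * \<nu>\<^sup>2 * (24 * (3 * (z / q * q\<^sup>2)))) / ((24 * q ^ 3) * (24 * q ^ 3))) (at z)"
    unfolding L\<delta>_def[abs_def] using q(1)
    by (intro DERIV_add DERIV_divide[where g="\<lambda>z. 8 * sqrt (LD z)" and x=z, folded q_def]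
        DERIV_divide[where g="\<lambda>z. 24 * sqrt (LD z) ^ 3" and x=z, folded q_def] DERIV_const DERIV_cmult dq dq3) auto
  moreover have "(0 * (8 * q) - 1 * (8 * (z / q))) / ((8 * q) * (8 * q))
     + (0 * (24 * q ^ 3) - 5 * \<nu>\<^sup>2 * (24 * (3 * (z / q * q\<^sup>2)))) / ((24 * q ^ 3) * (24 * q ^ 3))
     = - (q / z * (z\<^sup>2 * (z\<^sup>2 + 4 * \<nu>\<^sup>2) / (4 * (q\<^sup>2) ^ 3)) / 2)"
  proof -
    have n: "z\<^sup>2 = q\<^sup>2 + \<nu>\<^sup>2" using q by (simp add: LD_def)
    show ?thesis using q(1) z0 by (simp add: divide_simps) (use n in algebra)
  qed
  ultimately show ?thesis unfolding L\<sigma>_def L\<psi>_def q(2) by (simp add: q_def)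
qed

lemma DERIV_Ls:
  assumes z: "z > \<nu>"
  shows "(Ls has_real_derivative L\<sigma> z) (at z)"
proof -
  have t: "z / \<nu> > 1" using z \<nu> by simp
  have "((\<lambda>z. Debye_phase (z / \<nu>)) has_real_derivative sqrt ((z / \<nu>)\<^sup>2 - 1) / (z / \<nu>) * (1 / \<nu>)) (at z)"
    by (rule DERIV_chain2[where f=Debye_phase and g="\<lambda>z. z / \<nu>", OF DERIV_Debye_phase[OF t]]) (use \<nu> in \<open>auto intro!: derivative_eq_intros\<close>)
  from DERIV_cmult[OF this, of \<nu>]
  have "(Ls has_real_derivative \<nu> * (sqrt ((z / \<nu>)\<^sup>2 - 1) / (z / \<nu>) * (1 / \<nu>))) (at z)"
    unfolding Ls_def[abs_def] .
  moreover have "sqrt ((z / \<nu>)\<^sup>2 - 1) = sqrt (LD z) / \<nu>"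
  proof -
    have "(z / \<nu>)\<^sup>2 - 1 = LD z / \<nu>\<^sup>2" unfolding LD_def using \<nu> by (simp add: power_divide field_simps)
    then show ?thesis using \<nu> by (simp add: real_sqrt_divide)
  qed
  ultimately show ?thesis unfolding L\<sigma>_def using \<nu> z by (simp add: field_simps)
qed

lemma L\<sigma>_pos: "z > \<nu> \<Longrightarrow> L\<sigma> z > 0"
  unfolding L\<sigma>_def using LD_pos[of z] \<nu> by simp

lemma L\<psi>_pos: "z > \<nu> \<Longrightarrow> L\<psi> z > 0"
  unfolding L\<psi>_def using LD_pos[of z] \<nu> by (intro divide_pos_pos mult_pos_pos add_pos_pos) auto

lemma L\<delta>_pos: "z > \<nu> \<Longrightarrow> L\<delta> z > 0"
  unfolding L\<delta>_def using LD_pos[of z] \<nu> by (intro add_pos_pos) auto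

lemma DERIV_L\<psi>:
  assumes z: "z > \<nu>"
  shows "(L\<psi> has_real_derivative - (z * (z ^ 4 + 10 * z\<^sup>2 * \<nu>\<^sup>2 + 4 * \<nu> ^ 4) / (2 * LD z ^ 4))) (at z)"
proof -
  define d where "d = LD z"
  have d: "d > 0" "z\<^sup>2 = d + \<nu>\<^sup>2" unfolding d_def using LD_pos[OF z] by (auto simp: LD_def)
  have d1: "((\<lambda>z. z\<^sup>2 * (z\<^sup>2 + 4 * \<nu>\<^sup>2)) has_real_derivative 4 * z ^ 3 + 8 * \<nu>\<^sup>2 * z) (at z)"
    by (auto intro!: derivative_eq_intros simp: eval_nat_numeral algebra_simps)
  have d2: "((\<lambda>z. 4 * LD z ^ 3) has_real_derivative 4 * (3 * (2 * z * d\<^sup>2))) (at z)"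
    using DERIV_cmult[OF DERIV_power[OF DERIV_LD, of 3], of 4 z] by (simp add: d_def)
  have "(L\<psi> has_real_derivative ((4 * z ^ 3 + 8 * \<nu>\<^sup>2 * z) * (4 * d ^ 3) - z\<^sup>2 * (z\<^sup>2 + 4 * \<nu>\<^sup>2) * (4 * (3 * (2 * z * d\<^sup>2)))) / ((4 * d ^ 3) * (4 * d ^ 3))) (at z)"
    unfolding L\<psi>_def[abs_def]
    using DERIV_divide[OF d1 d2] d(1) by (simp add: d_def)
  moreover have "((4 * z ^ 3 + 8 * \<nu>\<^sup>2 * z) * (4 * d ^ 3) - z\<^sup>2 * (z\<^sup>2 + 4 * \<nu>\<^sup>2) * (4 * (3 * (2 * z * d\<^sup>2)))) / ((4 * d ^ 3) * (4 * d ^ 3))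
     = - (z * (z ^ 4 + 10 * z\<^sup>2 * \<nu>\<^sup>2 + 4 * \<nu> ^ 4) / (2 * d ^ 4))"
    using d(1) by (simp add: divide_simps) (use d(2) in algebra)
  ultimately show ?thesis by (simp add: d_def)
qed

lemma L\<psi>_mono:
  assumes "\<nu> < z1" "z1 \<le> z2"
  shows "L\<psi> z2 \<le> L\<psi> z1"
proof (rule DERIV_nonpos_imp_nonincreasing[OF assms(2)])
  fix z assume z: "z1 \<le> z" "z \<le> z2"
  then have zn: "z > \<nu>" using assms by simp
  have "- (z * (z ^ 4 + 10 * z\<^sup>2 * \<nu>\<^sup>2 + 4 * \<nu> ^ 4) / (2 * LD z ^ 4)) \<le> 0"
    using zn \<nu> by simp
  then show "\<exists>y. DERIV L\<psi> z :> y \<and> y \<le> 0" using DERIV_L\<psi>[OF zn] by blast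
qed

text \<open>
  The logarithmic derivative of the squared amplitude is at most \<open>L\<sigma> * L\<psi>\<close> in absolute value, by
  \<open>2 * \<bar>Ly * Lv\<bar> \<le> LE\<close>, and \<open>L\<sigma> * L\<psi>\<close> has the antiderivative \<open>- 2 * L\<delta>\<close>. So the amplitude neither vanishes nor
  blows up, and it converges.
\<close>

lemma LE_mono:
  assumes z: "\<nu> < z1" "z1 \<le> z2"
  shows "LE z1 * exp (- 2 * L\<delta> z1) \<le> LE z2 * exp (- 2 * L\<delta> z2)"
    and "LE z2 * exp (2 * L\<delta> z2) \<le> LE z1 * exp (2 * L\<delta> z1)"
proof -
  have dE: "(LE has_real_derivative - 2 * L\<sigma> z * L\<psi> z * Ly z * Lv z) (at z)" if "z > \<nu>" for z
  proof -
    have "(LE has_real_derivative 2 * (L\<sigma> z * Lv z) * Ly z + 2 * (- L\<sigma> z * (1 + L\<psi> z) * Ly z) * Lv z) (at z)"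
      unfolding LE_def using DERIV_Ly[OF that] DERIV_Lv[OF that] by (auto intro!: derivative_eq_intros)
    then show ?thesis by (rule DERIV_cong) (simp add: algebra_simps)
  qed
  have am: "\<bar>2 * Ly z * Lv z\<bar> \<le> LE z" for z
    using sum_squares_bound[of "Ly z" "Lv z"] sum_squares_bound[of "Ly z" "- Lv z"]
    by (auto simp: LE_def abs_le_iff)
  show "LE z1 * exp (- 2 * L\<delta> z1) \<le> LE z2 * exp (- 2 * L\<delta> z2)"
  proof (rule DERIV_nonneg_imp_nondecreasing[OF z(2), where f="\<lambda>z. LE z * exp (- 2 * L\<delta> z)"])
    fix z assume "z1 \<le> z" "z \<le> z2"
    then have zn: "z > \<nu>" using z by simp
    have "((\<lambda>z. LE z * exp (- 2 * L\<delta> z)) has_real_derivative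
       (- 2 * L\<sigma> z * L\<psi> z * Ly z * Lv z) * exp (- 2 * L\<delta> z) + (exp (- 2 * L\<delta> z) * (- 2 * - (L\<sigma> z * L\<psi> z / 2))) * LE z) (at z)"
      by (intro DERIV_mult dE zn DERIV_chain2[OF DERIV_exp] DERIV_cmult DERIV_L\<delta>)
    moreover have "(- 2 * L\<sigma> z * L\<psi> z * Ly z * Lv z) * exp (- 2 * L\<delta> z) + (exp (- 2 * L\<delta> z) * (- 2 * - (L\<sigma> z * L\<psi> z / 2))) * LE z
      = L\<sigma> z * L\<psi> z * exp (- 2 * L\<delta> z) * (LE z - 2 * Ly z * Lv z)" by (simp add: algebra_simps)
    moreover have "\<dots> \<ge> 0" using am[of z] L\<sigma>_pos[OF zn] L\<psi>_pos[OF zn] by (intro mult_nonneg_nonneg) auto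
    ultimately show "\<exists>y. DERIV (\<lambda>z. LE z * exp (- 2 * L\<delta> z)) z :> y \<and> 0 \<le> y" by metis
  qed
  show "LE z2 * exp (2 * L\<delta> z2) \<le> LE z1 * exp (2 * L\<delta> z1)"
  proof (rule DERIV_nonpos_imp_nonincreasing[OF z(2), where f="\<lambda>z. LE z * exp (2 * L\<delta> z)"])
    fix z assume "z1 \<le> z" "z \<le> z2"
    then have zn: "z > \<nu>" using z by simp
    have "((\<lambda>z. LE z * exp (2 * L\<delta> z)) has_real_derivative
       (- 2 * L\<sigma> z * L\<psi> z * Ly z * Lv z) * exp (2 * L\<delta> z) + (exp (2 * L\<delta> z) * (2 * - (L\<sigma> z * L\<psi> z / 2))) * LE z) (at z)"
      by (intro DERIV_mult dE zn DERIV_chain2[OF DERIV_exp] DERIV_cmult DERIV_L\<delta>)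
    moreover have "(- 2 * L\<sigma> z * L\<psi> z * Ly z * Lv z) * exp (2 * L\<delta> z) + (exp (2 * L\<delta> z) * (2 * - (L\<sigma> z * L\<psi> z / 2))) * LE z
      = - (L\<sigma> z * L\<psi> z * exp (2 * L\<delta> z) * (LE z + 2 * Ly z * Lv z))" by (simp add: algebra_simps)
    moreover have "\<dots> \<le> 0" using am[of z] L\<sigma>_pos[OF zn] L\<psi>_pos[OF zn]
      by (simp only: neg_le_0_iff_le, intro mult_nonneg_nonneg) auto
    ultimately show "\<exists>y. DERIV (\<lambda>z. LE z * exp (2 * L\<delta> z)) z :> y \<and> y \<le> 0" by metis
  qed
qed

lemma Ly_initial_pos: "Ly (zero_free_end \<nu>) > 0"
  unfolding Ly_def using Lr_pos[OF zero_free_end_gt[OF \<nu>]] besselJ_pos_initial[OF \<nu>, of "zero_free_end \<nu>"]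
    zero_free_end_gt[OF \<nu>] \<nu> by simp

lemma LE_pos:
  assumes z: "z > \<nu>"
  shows "LE z > 0"
proof -
  define b where "b = zero_free_end \<nu>"
  have b: "b > \<nu>" "LE b > 0"
    using zero_free_end_gt[OF \<nu>] Ly_initial_pos by (auto simp: b_def LE_def intro!: add_pos_nonneg)
  show ?thesis
  proof (cases "z \<le> b")
    case True
    have "0 < LE b * exp (2 * L\<delta> b)" using b by simp
    also have "\<dots> \<le> LE z * exp (2 * L\<delta> z)" by (rule LE_mono(2)) (use z True in auto)
    finally show ?thesis by (simp add: zero_less_mult_iff)
  next
    case False
    have "0 < LE b * exp (- 2 * L\<delta> b)" using b by simp
    also have "\<dots> \<le> LE z * exp (- 2 * L\<delta> z)" by (rule LE_mono(1)) (use b False in auto)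
    finally show ?thesis by (simp add: zero_less_mult_iff)
  qed
qed

lemma L_limits: "(L\<delta> \<longlongrightarrow> 0) at_top" "(L\<psi> \<longlongrightarrow> 0) at_top"
  unfolding L\<delta>_def[abs_def] L\<psi>_def[abs_def] LD_def by real_asymp+

lemma LE_tendsto: obtains A where "A > 0" "(LE \<longlongrightarrow> A) at_top"
proof -
  define b where "b = zero_free_end \<nu>"
  have b: "b > \<nu>" using zero_free_end_gt[OF \<nu>] by (simp add: b_def)
  have bd: "LE z * exp (- 2 * L\<delta> z) \<le> LE b * exp (2 * L\<delta> b)" if "b \<le> z" for z
  proof -
    have "LE z * exp (- 2 * L\<delta> z) \<le> LE z * exp (2 * L\<delta> z)"
      using LE_pos[of z] L\<delta>_pos[of z] b that by (intro mult_left_mono) auto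
    also have "\<dots> \<le> LE b * exp (2 * L\<delta> b)" by (rule LE_mono(2)) (use b that in auto)
    finally show ?thesis .
  qed
  obtain A where A: "((\<lambda>z. LE z * exp (- 2 * L\<delta> z)) \<longlongrightarrow> A) at_top" "\<And>x. b \<le> x \<Longrightarrow> LE x * exp (- 2 * L\<delta> x) \<le> A"
    by (rule mono_bounded_tendsto_at_top[of b "\<lambda>z. LE z * exp (- 2 * L\<delta> z)", OF LE_mono(1) bd]) (use b in auto)
  have "0 < LE b * exp (- 2 * L\<delta> b)" using LE_pos[OF b] by simp
  then have "A > 0" using A(2)[of b] by simp
  have "((\<lambda>z. LE z * exp (- 2 * L\<delta> z) * exp (2 * L\<delta> z)) \<longlongrightarrow> A * exp (2 * 0)) at_top"
    by (intro tendsto_intros A L_limits)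
  moreover have eq: "(\<lambda>z. LE z * exp (- 2 * L\<delta> z) * exp (2 * L\<delta> z)) = LE"
    by (rule ext) (simp add: mult.assoc flip: exp_add)
  ultimately have "(LE \<longlongrightarrow> A * exp (2 * 0)) at_top" by (simp only: eq)
  then have "(LE \<longlongrightarrow> A) at_top" by simp
  with \<open>A > 0\<close> that show ?thesis by blast
qed

text \<open>
  The angle is pinned down, among its translates by multiples of \<open>2 * pi\<close>, at the end of the zero-free interval,
  where \<open>Ly\<close> is positive.
\<close>

definition Langle :: "(real \<Rightarrow> real) \<Rightarrow> bool" where
  "Langle \<theta> \<longleftrightarrow> (\<forall>z>\<nu>. (\<theta> has_real_derivative L\<sigma> z * (1 + L\<psi> z * (cos (\<theta> z))\<^sup>2)) (at z)
      \<and> Ly z = sqrt (LE z) * cos (\<theta> z) \<and> Lv z = - sqrt (LE z) * sin (\<theta> z))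
    \<and> - pi / 2 < \<theta> (zero_free_end \<nu>) \<and> \<theta> (zero_free_end \<nu>) < pi / 2"

lemma Langle_exists: obtains \<theta> where "Langle \<theta>"
proof (rule Pruefer_angle[of \<nu> Ly L\<sigma> Lv L\<psi> "zero_free_end \<nu>"])
  have "continuous_on {\<nu><..} LD" unfolding LD_def[abs_def] by (intro continuous_intros)
  then show "continuous_on {\<nu><..} L\<sigma>" "continuous_on {\<nu><..} L\<psi>"
    unfolding L\<sigma>_def[abs_def] L\<psi>_def[abs_def] using \<nu> by (auto intro!: continuous_intros dest: LD_pos)
  fix \<theta> assume "\<And>z. \<nu> < z \<Longrightarrow> (\<theta> has_real_derivative L\<sigma> z * (1 + L\<psi> z * (cos (\<theta> z))\<^sup>2)) (at z)"
    "\<And>z. \<nu> < z \<Longrightarrow> Ly z = sqrt ((Ly z)\<^sup>2 + (Lv z)\<^sup>2) * cos (\<theta> z)"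
    "\<And>z. \<nu> < z \<Longrightarrow> Lv z = - sqrt ((Ly z)\<^sup>2 + (Lv z)\<^sup>2) * sin (\<theta> z)"
    "- pi / 2 < \<theta> (zero_free_end \<nu>)" "\<theta> (zero_free_end \<nu>) < pi / 2"
  then show thesis using that[of \<theta>] unfolding Langle_def LE_def by blast
qed (use DERIV_Ly DERIV_Lv LE_pos zero_free_end_gt[OF \<nu>] Ly_initial_pos in \<open>auto simp: LE_def\<close>)

text \<open>
  The derivative of \<open>\<theta> - Ls\<close> is \<open>L\<sigma> * L\<psi> * (cos \<theta>)\<^sup>2\<close>, which lies between 0 and \<open>L\<sigma> * L\<psi>\<close>.
\<close>

lemma Langle_mono:
  assumes "Langle \<theta>" "\<nu> < z1" "z1 \<le> z2"
  shows "\<theta> z1 - Ls z1 \<le> \<theta> z2 - Ls z2" "\<theta> z2 - Ls z2 + 2 * L\<delta> z2 \<le> \<theta> z1 - Ls z1 + 2 * L\<delta> z1"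
proof -
  have d\<theta>: "(\<theta> has_real_derivative L\<sigma> z * (1 + L\<psi> z * (cos (\<theta> z))\<^sup>2)) (at z)" if "z > \<nu>" for z
    using assms(1) that by (simp add: Langle_def)
  show "\<theta> z1 - Ls z1 \<le> \<theta> z2 - Ls z2"
  proof (rule DERIV_nonneg_imp_nondecreasing[OF assms(3), where f="\<lambda>z. \<theta> z - Ls z"])
    fix z assume "z1 \<le> z" "z \<le> z2"
    then have zn: "z > \<nu>" using assms by simp
    have "((\<lambda>z. \<theta> z - Ls z) has_real_derivative L\<sigma> z * (1 + L\<psi> z * (cos (\<theta> z))\<^sup>2) - L\<sigma> z) (at z)"
      by (intro DERIV_diff d\<theta> DERIV_Ls zn)
    moreover have "L\<sigma> z * (1 + L\<psi> z * (cos (\<theta> z))\<^sup>2) - L\<sigma> z = L\<sigma> z * L\<psi> z * (cos (\<theta> z))\<^sup>2" by (simp add: algebra_simps)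
    moreover have "\<dots> \<ge> 0" using L\<sigma>_pos[OF zn] L\<psi>_pos[OF zn] by simp
    ultimately show "\<exists>y. DERIV (\<lambda>z. \<theta> z - Ls z) z :> y \<and> 0 \<le> y" by metis
  qed
  show "\<theta> z2 - Ls z2 + 2 * L\<delta> z2 \<le> \<theta> z1 - Ls z1 + 2 * L\<delta> z1"
  proof (rule DERIV_nonpos_imp_nonincreasing[OF assms(3), where f="\<lambda>z. \<theta> z - Ls z + 2 * L\<delta> z"])
    fix z assume "z1 \<le> z" "z \<le> z2"
    then have zn: "z > \<nu>" using assms by simp
    have "((\<lambda>z. \<theta> z - Ls z + 2 * L\<delta> z) has_real_derivative L\<sigma> z * (1 + L\<psi> z * (cos (\<theta> z))\<^sup>2) - L\<sigma> z + 2 * - (L\<sigma> z * L\<psi> z / 2)) (at z)"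
      by (intro DERIV_add DERIV_diff DERIV_cmult d\<theta> DERIV_Ls DERIV_L\<delta> zn)
    moreover have "L\<sigma> z * (1 + L\<psi> z * (cos (\<theta> z))\<^sup>2) - L\<sigma> z + 2 * - (L\<sigma> z * L\<psi> z / 2) = - (L\<sigma> z * L\<psi> z * (sin (\<theta> z))\<^sup>2)"
      unfolding sin_squared_eq by (simp add: algebra_simps)
    moreover have "\<dots> \<le> 0" using L\<sigma>_pos[OF zn] L\<psi>_pos[OF zn] by simp
    ultimately show "\<exists>y. DERIV (\<lambda>z. \<theta> z - Ls z + 2 * L\<delta> z) z :> y \<and> y \<le> 0" by metis
  qed
qed

lemma Langle_tendsto:
  assumes "Langle \<theta>"
  obtains C where "((\<lambda>z. \<theta> z - Ls z) \<longlongrightarrow> C) at_top"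
    "\<And>z. z \<ge> zero_free_end \<nu> \<Longrightarrow> \<theta> z - Ls z \<le> C" "\<And>z. z \<ge> zero_free_end \<nu> \<Longrightarrow> C \<le> \<theta> z - Ls z + 2 * L\<delta> z"
proof -
  define b where "b = zero_free_end \<nu>"
  have b: "b > \<nu>" using zero_free_end_gt[OF \<nu>] by (simp add: b_def)
  have bd: "\<theta> z - Ls z \<le> \<theta> b - Ls b + 2 * L\<delta> b" if "b \<le> z" for z
    using Langle_mono(2)[OF assms b that] L\<delta>_pos[of z] b that by simp
  obtain C where C: "((\<lambda>z. \<theta> z - Ls z) \<longlongrightarrow> C) at_top" "\<And>z. b \<le> z \<Longrightarrow> \<theta> z - Ls z \<le> C"
    by (rule mono_bounded_tendsto_at_top[of b "\<lambda>z. \<theta> z - Ls z", OF Langle_mono(1)[OF assms] bd]) (use b in auto)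
  have "C \<le> \<theta> z - Ls z + 2 * L\<delta> z" if z: "b \<le> z" for z
  proof (rule tendsto_upperbound[OF C(1)])
    show "\<forall>\<^sub>F w in at_top. \<theta> w - Ls w \<le> \<theta> z - Ls z + 2 * L\<delta> z"
      using eventually_ge_at_top[of z]
    proof eventually_elim
      case (elim w)
      then show ?case using Langle_mono(2)[OF assms, of z w] L\<delta>_pos[of w] b z by simp
    qed
  qed simp
  with C that show ?thesis unfolding b_def by blast
qed

text \<open>
  In the derivative of \<open>\<theta> - Ls\<close> the factor \<open>(cos \<theta>)\<^sup>2\<close> has mean 1/2, which \<open>L\<delta>\<close> compensates; the oscillating rest
  \<open>cos (2 * \<theta>) / 2\<close> is integrated by parts, which produces the term with \<open>sin (2 * \<theta>)\<close>. What is left is of second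
  order: it is bounded by the decrease of \<open>L\<psi>\<close> and by the square of \<open>L\<psi>\<close>.
\<close>

lemma Langle_error:
  assumes ang: "Langle \<theta>" and C: "((\<lambda>z. \<theta> z - Ls z) \<longlongrightarrow> C) at_top" and z1: "z1 > \<nu>"
  shows "\<bar>\<theta> z1 - Ls z1 + L\<delta> z1 - L\<psi> z1 * sin (2 * \<theta> z1) / 4 - C\<bar> \<le> L\<psi> z1 / 4 + L\<psi> z1 * L\<delta> z1"
proof -
  have d\<theta>: "(\<theta> has_real_derivative L\<sigma> z * (1 + L\<psi> z * (cos (\<theta> z))\<^sup>2)) (at z)" if "z > \<nu>" for z
    using ang that by (simp add: Langle_def)
  define p where "p = L\<psi> z1"
  define d where "d z = - (z * (z ^ 4 + 10 * z\<^sup>2 * \<nu>\<^sup>2 + 4 * \<nu> ^ 4) / (2 * LD z ^ 4))" for z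
  have d\<psi>: "(L\<psi> has_real_derivative d z) (at z)" if "z > \<nu>" for z
    unfolding d_def by (rule DERIV_L\<psi>[OF that])
  have dneg: "d z \<le> 0" if "z > \<nu>" for z unfolding d_def using that \<nu> by simp
  \<comment> \<open>The corrected phase; \<open>Q'\<close> is its derivative.\<close>
  define Q where "Q z = \<theta> z - Ls z + L\<delta> z - L\<psi> z * sin (2 * \<theta> z) / 4" for z
  define Q' where "Q' z = - (d z * sin (2 * \<theta> z) / 4) - L\<sigma> z * (L\<psi> z)\<^sup>2 * cos (2 * \<theta> z) * (cos (\<theta> z))\<^sup>2 / 2" for z
  have dQ: "(Q has_real_derivative Q' z) (at z)" if z: "z > \<nu>" for z
  proof -
    have "((\<lambda>z. sin (2 * \<theta> z)) has_real_derivative cos (2 * \<theta> z) * (2 * (L\<sigma> z * (1 + L\<psi> z * (cos (\<theta> z))\<^sup>2)))) (at z)"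
      by (intro DERIV_chain2[OF DERIV_sin] DERIV_cmult d\<theta> z)
    then have "(Q has_real_derivative L\<sigma> z * (1 + L\<psi> z * (cos (\<theta> z))\<^sup>2) - L\<sigma> z + - (L\<sigma> z * L\<psi> z / 2)
       - (d z * sin (2 * \<theta> z) + cos (2 * \<theta> z) * (2 * (L\<sigma> z * (1 + L\<psi> z * (cos (\<theta> z))\<^sup>2))) * L\<psi> z) / 4) (at z)"
      unfolding Q_def by (intro DERIV_diff DERIV_add DERIV_cdivide DERIV_mult d\<theta> DERIV_Ls DERIV_L\<delta> d\<psi> z)
    moreover have c2: "(cos (\<theta> z))\<^sup>2 = (1 + cos (2 * \<theta> z)) / 2" by (simp add: cos_double_cos)
    have "L\<sigma> z * (1 + L\<psi> z * (cos (\<theta> z))\<^sup>2) - L\<sigma> z + - (L\<sigma> z * L\<psi> z / 2)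
       - (d z * sin (2 * \<theta> z) + cos (2 * \<theta> z) * (2 * (L\<sigma> z * (1 + L\<psi> z * (cos (\<theta> z))\<^sup>2))) * L\<psi> z) / 4 = Q' z"
      unfolding Q'_def c2 by (simp add: field_simps power2_eq_square)
    ultimately show ?thesis by simp
  qed
  have bQ: "\<bar>Q' z\<bar> \<le> - d z / 4 + p * (L\<sigma> z * L\<psi> z / 2)" if z: "z \<ge> z1" for z
  proof -
    have zn: "z > \<nu>" using z z1 by simp
    have "- d z * \<bar>sin (2 * \<theta> z)\<bar> \<le> - d z * 1"
      using dneg[OF zn] abs_sin_le_one[of "2 * \<theta> z"] by (intro mult_left_mono) auto
    then have "\<bar>d z * sin (2 * \<theta> z) / 4\<bar> \<le> - d z / 4"
      using dneg[OF zn] by (simp add: abs_mult)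
    moreover have "\<bar>L\<sigma> z * (L\<psi> z)\<^sup>2 * cos (2 * \<theta> z) * (cos (\<theta> z))\<^sup>2 / 2\<bar> \<le> p * (L\<sigma> z * L\<psi> z / 2)"
    proof -
      have c: "\<bar>cos (2 * \<theta> z) * (cos (\<theta> z))\<^sup>2\<bar> \<le> 1"
        unfolding abs_mult by (intro mult_le_one) (auto simp: abs_square_le_1 power2_abs)
      have "\<bar>L\<sigma> z * (L\<psi> z)\<^sup>2 * cos (2 * \<theta> z) * (cos (\<theta> z))\<^sup>2 / 2\<bar>
         = L\<sigma> z * (L\<psi> z)\<^sup>2 / 2 * \<bar>cos (2 * \<theta> z) * (cos (\<theta> z))\<^sup>2\<bar>"
        using L\<sigma>_pos[OF zn] by (simp add: abs_mult)
      also have "\<dots> \<le> L\<sigma> z * (L\<psi> z)\<^sup>2 / 2 * 1"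
        using L\<sigma>_pos[OF zn] by (intro mult_left_mono c) simp
      also have "\<dots> = L\<psi> z * (L\<sigma> z * L\<psi> z / 2)" by (simp add: power2_eq_square)
      also have "\<dots> \<le> p * (L\<sigma> z * L\<psi> z / 2)"
        using L\<psi>_mono[OF z1 z] L\<sigma>_pos[OF zn] L\<psi>_pos[OF zn] unfolding p_def by (intro mult_right_mono) auto
      finally show ?thesis .
    qed
    ultimately show ?thesis unfolding Q'_def by (simp add: abs_le_iff)
  qed
  have Qlim: "(Q \<longlongrightarrow> C) at_top"
  proof -
    have "((\<lambda>z. L\<psi> z * sin (2 * \<theta> z)) \<longlongrightarrow> 0) at_top"
      by (rule Lim_null_comparison[OF _ tendsto_rabs_zero[OF L_limits(2)]])
         (auto intro!: always_eventually simp: abs_mult mult_left_le)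
    then have "((\<lambda>z. (\<theta> z - Ls z) + L\<delta> z - L\<psi> z * sin (2 * \<theta> z) / 4) \<longlongrightarrow> C + 0 - 0 / 4) at_top"
      by (intro tendsto_intros C L_limits) auto
    then show ?thesis unfolding Q_def by simp
  qed
  have g: "((\<lambda>z. L\<psi> z / 4 + p * L\<delta> z) \<longlongrightarrow> 0 / 4 + p * 0) at_top"
    by (intro tendsto_intros L_limits) auto
  have dg: "((\<lambda>z. L\<psi> z / 4 + p * L\<delta> z) has_real_derivative - (- d z / 4 + p * (L\<sigma> z * L\<psi> z / 2))) (at z)" if z: "z > \<nu>" for z
    by (rule DERIV_cong[OF DERIV_add[OF DERIV_cdivide[OF d\<psi>[OF z]] DERIV_cmult[OF DERIV_L\<delta>[OF z]]]]) simp
  \<comment> \<open>\<open>L\<psi> / 4 + p * L\<delta>\<close> tends to 0 and decreases at least as fast as \<open>Q\<close> moves, so it bounds the distance of \<open>Q\<close> to its limit.\<close>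
  have up: "Q z2 + (L\<psi> z2 / 4 + p * L\<delta> z2) \<le> Q z1 + (L\<psi> z1 / 4 + p * L\<delta> z1)" if "z1 \<le> z2" for z2
  proof (rule DERIV_nonpos_imp_nonincreasing[OF that, where f="\<lambda>z. Q z + (L\<psi> z / 4 + p * L\<delta> z)"])
    fix z assume z: "z1 \<le> z" "z \<le> z2"
    have "((\<lambda>z. Q z + (L\<psi> z / 4 + p * L\<delta> z)) has_real_derivative Q' z + - (- d z / 4 + p * (L\<sigma> z * L\<psi> z / 2))) (at z)"
      by (intro DERIV_add dQ dg) (use z z1 in auto)
    moreover have "Q' z + - (- d z / 4 + p * (L\<sigma> z * L\<psi> z / 2)) \<le> 0" using bQ[OF z(1)] by linarith
    ultimately show "\<exists>y. DERIV (\<lambda>z. Q z + (L\<psi> z / 4 + p * L\<delta> z)) z :> y \<and> y \<le> 0" by blast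
  qed
  have down: "Q z1 - (L\<psi> z1 / 4 + p * L\<delta> z1) \<le> Q z2 - (L\<psi> z2 / 4 + p * L\<delta> z2)" if "z1 \<le> z2" for z2
  proof (rule DERIV_nonneg_imp_nondecreasing[OF that, where f="\<lambda>z. Q z - (L\<psi> z / 4 + p * L\<delta> z)"])
    fix z assume z: "z1 \<le> z" "z \<le> z2"
    have "((\<lambda>z. Q z - (L\<psi> z / 4 + p * L\<delta> z)) has_real_derivative Q' z - - (- d z / 4 + p * (L\<sigma> z * L\<psi> z / 2))) (at z)"
      by (intro DERIV_diff dQ dg) (use z z1 in auto)
    moreover have "Q' z - - (- d z / 4 + p * (L\<sigma> z * L\<psi> z / 2)) \<ge> 0" using bQ[OF z(1)] by linarith
    ultimately show "\<exists>y. DERIV (\<lambda>z. Q z - (L\<psi> z / 4 + p * L\<delta> z)) z :> y \<and> 0 \<le> y" by blast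
  qed
  have "C + (0 / 4 + p * 0) \<le> Q z1 + (L\<psi> z1 / 4 + p * L\<delta> z1)"
    by (rule tendsto_upperbound[OF tendsto_add[OF Qlim g]])
       (use eventually_mono[OF eventually_ge_at_top[of z1] up] in auto)
  moreover have "C - (0 / 4 + p * 0) \<ge> Q z1 - (L\<psi> z1 / 4 + p * L\<delta> z1)"
    by (rule tendsto_lowerbound[OF tendsto_diff[OF Qlim g]])
       (use eventually_mono[OF eventually_ge_at_top[of z1] down] in auto)
  ultimately show ?thesis unfolding Q_def p_def by (simp add: abs_le_iff)
qed

end

section \<open>Laplace transforms\<close>

text \<open>
  The transform of \<open>t ^ n * h t\<close>; up to sign, the \<open>n\<close>-th derivative of the transform of \<open>h\<close>.
\<close>

definition laplace :: "(real \<Rightarrow> real) \<Rightarrow> nat \<Rightarrow> complex \<Rightarrow> complex" where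
  "laplace h n p = (LBINT t:{0<..}. complex_of_real (t ^ n * h t) * exp (- p * complex_of_real t))"

lemma set_integrable_bound_exp:
  fixes f :: "real \<Rightarrow> complex"
  assumes cont: "continuous_on {0<..} f" and bd: "\<And>t. t > 0 \<Longrightarrow> norm (f t) \<le> M * (t ^ n * exp (- c * t))" and c: "c > 0"
  shows "set_integrable lborel {0<..} f"
  unfolding set_integrable_def
proof (rule Bochner_Integration.integrable_bound)
  show "integrable lborel (\<lambda>t. M * (indicat_real {0<..} t *\<^sub>R (t ^ n * exp (- c * t))))"
    using set_integrable_power_exp[OF c, of n] by (intro integrable_mult_right) (simp add: set_integrable_def)
  show "(\<lambda>t. indicat_real {0<..} t *\<^sub>R f t) \<in> borel_measurable lborel"
    using borel_measurable_continuous_on_indicator[OF _ cont] by simp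
  show "AE t in lborel. norm (indicat_real {0<..} t *\<^sub>R f t) \<le> norm (M * (indicat_real {0<..} t *\<^sub>R (t ^ n * exp (- c * t))))"
  proof (rule AE_I2)
    fix t :: real
    show "norm (indicat_real {0<..} t *\<^sub>R f t) \<le> norm (M * (indicat_real {0<..} t *\<^sub>R (t ^ n * exp (- c * t))))"
      using order_trans[OF bd abs_ge_self, of t] by (cases "t > 0") auto
  qed
qed

context
  fixes h :: "real \<Rightarrow> real" and M :: real
  assumes cont: "continuous_on {0<..} h" and bd_all: "\<forall>t>0. \<bar>h t\<bar> \<le> M"
begin

private lemma bd: "t > 0 \<Longrightarrow> \<bar>h t\<bar> \<le> M"
  using bd_all by blast

lemma norm_laplace_integrand:
  assumes "t > 0"
  shows "norm (complex_of_real (t ^ n * h t) * exp (- p * complex_of_real t)) \<le> M * (t ^ n * exp (- Re p * t))"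
proof -
  have "norm (complex_of_real (t ^ n * h t) * exp (- p * complex_of_real t)) = \<bar>h t\<bar> * (t ^ n * exp (- Re p * t))"
    using assms by (simp add: norm_mult norm_power abs_mult)
  also have "\<dots> \<le> M * (t ^ n * exp (- Re p * t))"
    using bd[OF assms] assms by (intro mult_right_mono) auto
  finally show ?thesis .
qed

lemma integrable_laplace:
  assumes "Re p > 0"
  shows "set_integrable lborel {0<..} (\<lambda>t. complex_of_real (t ^ n * h t) * exp (- p * complex_of_real t))"
  by (rule set_integrable_bound_exp[OF _ norm_laplace_integrand assms])
     (intro continuous_intros cont)

lemma DERIV_laplace:
  assumes p: "Re p > 0"
  shows "(laplace h n has_field_derivative - laplace h (Suc n) p) (at p)"
proof -
  define f where "f p t = indicat_real {0<..} t *\<^sub>R (complex_of_real (t ^ n * h t) * exp (- p * complex_of_real t))" for p t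
  define f' where "f' p t = - (indicat_real {0<..} t *\<^sub>R (complex_of_real (t ^ Suc n * h t) * exp (- p * complex_of_real t)))" for p t
  define g where "g t = M * (indicat_real {0<..} t *\<^sub>R (t ^ Suc n * exp (- (Re p / 2) * t)))" for t
  have Re: "Re w \<ge> Re p / 2" if "w \<in> ball p (Re p / 2)" for w
  proof -
    have "\<bar>Re (p - w)\<bar> \<le> norm (p - w)" by (rule abs_Re_le_cmod)
    then show ?thesis using that by (auto simp: dist_norm)
  qed
  have r: "Re p / 2 > 0" using p by simp
  have 1: "integrable lborel (f w)" if "w \<in> ball p (Re p / 2)" for w
    using integrable_laplace[of w n] Re[OF that] p unfolding f_def set_integrable_def by simp
  have 2: "((\<lambda>w. f w t) has_field_derivative f' w t) (at w)" for w t
    unfolding f_def f'_def scaleR_conv_of_real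
    by (auto intro!: derivative_eq_intros simp: algebra_simps)
  have 3: "norm (f' w t) \<le> g t" if "w \<in> ball p (Re p / 2)" for w t
  proof (cases "t > 0")
    case True
    have "norm (complex_of_real (t ^ Suc n * h t) * exp (- w * complex_of_real t)) \<le> M * (t ^ Suc n * exp (- Re w * t))"
      by (rule norm_laplace_integrand[OF True])
    also have "\<dots> \<le> M * (t ^ Suc n * exp (- (Re p / 2) * t))"
    proof (intro mult_left_mono)
      show "exp (- Re w * t) \<le> exp (- (Re p / 2) * t)" using Re[OF that] True by simp
      show "0 \<le> t ^ Suc n" using True by simp
      show "0 \<le> M" using bd[OF True] by linarith
    qed
    finally show ?thesis using True unfolding f'_def g_def by simp
  qed (simp add: f'_def g_def)
  have 4: "integrable lborel g" unfolding g_def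
    using set_integrable_power_exp[OF r, of "Suc n"] by (intro integrable_mult_right) (simp add: set_integrable_def)
  have "((\<lambda>w. integral\<^sup>L lborel (f w)) has_field_derivative integral\<^sup>L lborel (f' p)) (at p)"
    by (rule has_field_derivative_integral_dominated(1)[OF r 1 2 3 4])
  then show ?thesis unfolding f_def[abs_def] f'_def laplace_def[abs_def] set_lebesgue_integral_def by simp
qed

lemma laplace_bound:
  fixes c :: real
  assumes c: "c > 0"
  shows "norm (laplace h 0 (of_real c)) \<le> M / c" "norm (laplace h 1 (of_real c)) \<le> M / c\<^sup>2"
proof -
  have b: "norm (laplace h n (of_real c)) \<le> M * (LBINT t:{0<..}. t ^ n * exp (- c * t))" for n
  proof -
    define f where "f t = indicat_real {0<..} t *\<^sub>R (complex_of_real (t ^ n * h t) * exp (- complex_of_real c * complex_of_real t))" for t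
    have i: "integrable lborel f"
      using integrable_laplace[of "of_real c" n] c unfolding f_def set_integrable_def by simp
    have "norm (laplace h n (of_real c)) \<le> (\<integral>t. norm (f t) \<partial>lborel)"
      unfolding laplace_def set_lebesgue_integral_def f_def[symmetric] by (rule integral_norm_bound)
    also have "\<dots> \<le> (\<integral>t. M * (indicat_real {0<..} t *\<^sub>R (t ^ n * exp (- c * t))) \<partial>lborel)"
    proof (rule integral_mono)
      show "integrable lborel (\<lambda>t. norm (f t))" using i by (rule integrable_norm)
      show "integrable lborel (\<lambda>t. M * (indicat_real {0<..} t *\<^sub>R (t ^ n * exp (- c * t))))"
        using set_integrable_power_exp[OF c, of n] by (intro integrable_mult_right) (simp add: set_integrable_def)
      show "norm (f t) \<le> M * (indicat_real {0<..} t *\<^sub>R (t ^ n * exp (- c * t)))" for t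
        using norm_laplace_integrand[of t n "of_real c"] unfolding f_def by (cases "t > 0") auto
    qed
    finally show ?thesis by (simp add: set_lebesgue_integral_def)
  qed
  have "(LBINT t:{0<..}. t ^ 0 * exp (- c * t)) = 0 - (- (1 / c))"
  proof (rule integral_Ioi_FTC[where F="\<lambda>t. - exp (- c * t) / c"])
    show "((\<lambda>t. - exp (- c * t) / c) has_vector_derivative t ^ 0 * exp (- c * t)) (at t)" for t
      unfolding has_real_derivative_iff_has_vector_derivative[symmetric]
      using c by (auto intro!: derivative_eq_intros)
    show "((\<lambda>t. - exp (- c * t) / c) \<longlongrightarrow> - (1 / c)) (at_right 0)"
      using c by (auto intro!: tendsto_eq_intros)
    show "((\<lambda>t. - exp (- c * t) / c) \<longlongrightarrow> 0) at_top" using c by real_asymp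
  qed (use set_integrable_power_exp[OF c, of 0] in \<open>auto intro!: continuous_intros\<close>)
  then show "norm (laplace h 0 (of_real c)) \<le> M / c" using b[of 0] by simp
  have "(LBINT t:{0<..}. t ^ 1 * exp (- c * t)) = 0 - (- (1 / c\<^sup>2))"
  proof (rule integral_Ioi_FTC[where F="\<lambda>t. - exp (- c * t) * (t / c + 1 / c\<^sup>2)"])
    show "((\<lambda>t. - exp (- c * t) * (t / c + 1 / c\<^sup>2)) has_vector_derivative t ^ 1 * exp (- c * t)) (at t)" for t
      unfolding has_real_derivative_iff_has_vector_derivative[symmetric]
      using c by (auto intro!: derivative_eq_intros simp: field_simps power2_eq_square)
    show "((\<lambda>t. - exp (- c * t) * (t / c + 1 / c\<^sup>2)) \<longlongrightarrow> - (1 / c\<^sup>2)) (at_right 0)"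
      using c by (auto intro!: tendsto_eq_intros)
    show "((\<lambda>t. - exp (- c * t) * (t / c + 1 / c\<^sup>2)) \<longlongrightarrow> 0) at_top" using c by real_asymp
  qed (use set_integrable_power_exp[OF c, of 1] in \<open>auto intro!: continuous_intros\<close>)
  then show "norm (laplace h 1 (of_real c)) \<le> M / c\<^sup>2" using b[of 1] by simp
qed

end

lemma Gamma_set_integral:
  fixes a :: real
  assumes "a > 0"
  shows "(LBINT t:{0<..}. t powr (a - 1) * exp (- 1 * t)) = Gamma a"
proof -
  let ?f = "\<lambda>t::real. t powr (a - 1) / exp t"
  have hi0: "(?f has_integral Gamma a) {0..}" by (rule Gamma_integral_real[OF assms])
  have "{t::real \<in> {0<..} - {0..}. ?f t \<noteq> 0} = {}" "{t::real \<in> {0..} - {0<..}. ?f t \<noteq> 0} = {}" by auto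
  with hi0 have "(?f has_integral Gamma a) {0<..}"
    by (subst has_integral_spike_set_eq[where T="{0..}"]) (simp_all only: negligible_empty)
  moreover have "?f = (\<lambda>t. t powr (a - 1) * exp (- 1 * t))" by (auto simp: exp_minus divide_inverse)
  ultimately have "integral {0<..} (\<lambda>t. t powr (a - 1) * exp (- 1 * t)) = Gamma a" by (simp add: has_integral_iff)
  moreover have "set_integrable lborel {0<..} (\<lambda>t. t powr (a - 1) * exp (- 1 * t))"
    by (rule set_integrable_powr_exp) (use assms in auto)
  ultimately show ?thesis using set_borel_integral_eq_integral(2) by metis
qed

text \<open>
  Scaling \<open>t = \<tau> / \<epsilon>\<close> turns the left-hand side into the integral of \<open>\<tau> powr (- 1/2) * exp (- \<tau>)\<close> against
  \<open>sqrt (\<tau> / \<epsilon>) * H (\<tau> / \<epsilon>)\<close>, which tends to \<open>L\<close> for every \<open>\<tau>\<close>.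
\<close>

lemma abelian_sqrt:
  fixes H :: "real \<Rightarrow> complex"
  assumes cont: "continuous_on {0<..} H" and bd: "\<And>t. t > 0 \<Longrightarrow> norm (of_real (sqrt t) * H t) \<le> M"
    and lim: "((\<lambda>t. of_real (sqrt t) * H t) \<longlongrightarrow> L) at_top"
  shows "((\<lambda>\<epsilon>. of_real (sqrt \<epsilon>) * (LBINT t:{0<..}. exp (- of_real (\<epsilon> * t)) * H t)) \<longlongrightarrow> of_real (Gamma (1 / 2)) * L) (at_right 0)"
proof -
  define G where "G t = of_real (sqrt t) * H t" for t
  have cG: "continuous_on {0<..} G" unfolding G_def by (intro continuous_intros cont)
  define k where "k \<tau> = indicat_real {0<..} \<tau> *\<^sub>R (\<tau> powr (1 / 2 - 1) * exp (- 1 * \<tau>))" for \<tau> :: real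
  have ki: "integrable lborel k"
    using set_integrable_powr_exp[of "1/2 - 1" 1] unfolding k_def set_integrable_def by simp
  have kI: "integral\<^sup>L lborel k = Gamma (1 / 2)"
    using Gamma_set_integral[of "1/2"] unfolding k_def set_lebesgue_integral_def by simp
  have k0: "k \<tau> \<ge> 0" for \<tau> unfolding k_def by simp
  have "((\<lambda>\<epsilon>. \<integral>\<tau>. k \<tau> *\<^sub>R G (\<tau> / \<epsilon>) \<partial>lborel) \<longlongrightarrow> (\<integral>\<tau>. k \<tau> *\<^sub>R L \<partial>lborel)) (at_right 0)"
  proof (rule integral_tendsto_within_dominated[where w="\<lambda>\<tau>. M * k \<tau>"])
    fix \<epsilon> :: real assume e: "\<epsilon> \<in> {0<..}"
    have "continuous_on {0<..} (\<lambda>\<tau>. (\<tau> powr (1 / 2 - 1) * exp (- 1 * \<tau>)) *\<^sub>R G (\<tau> / \<epsilon>))"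
      by (intro continuous_intros continuous_on_compose2[OF cG]) (use e in auto)
    from borel_measurable_continuous_on_indicator[OF _ this]
    show "(\<lambda>\<tau>. k \<tau> *\<^sub>R G (\<tau> / \<epsilon>)) \<in> borel_measurable lborel" unfolding k_def by simp
    show "norm (k \<tau> *\<^sub>R G (\<tau> / \<epsilon>)) \<le> M * k \<tau>" for \<tau>
    proof (cases "\<tau> > 0")
      case True
      then have "norm (G (\<tau> / \<epsilon>)) \<le> M" using bd[of "\<tau> / \<epsilon>"] e by (simp add: G_def)
      then have "norm (G (\<tau> / \<epsilon>)) * k \<tau> \<le> M * k \<tau>" by (rule mult_right_mono[OF _ k0])
      then show ?thesis using k0[of \<tau>] by (simp add: mult.commute)
    qed (simp add: k_def)
  next
    show "integrable lborel (\<lambda>\<tau>. M * k \<tau>)" using ki by simp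
    show "(\<lambda>\<tau>. k \<tau> *\<^sub>R L) \<in> borel_measurable lborel" using ki by simp
    show "((\<lambda>\<epsilon>. k \<tau> *\<^sub>R G (\<tau> / \<epsilon>)) \<longlongrightarrow> k \<tau> *\<^sub>R L) (at_right 0)" for \<tau>
    proof (cases "\<tau> > 0")
      case True
      have "filterlim (\<lambda>\<epsilon>. \<tau> / \<epsilon>) at_top (at_right 0)" using True by real_asymp
      then show ?thesis using lim by (intro tendsto_scaleR tendsto_const) (auto simp: G_def[abs_def] intro: filterlim_compose)
    qed (simp add: k_def)
  qed
  moreover have "(\<integral>\<tau>. k \<tau> *\<^sub>R L \<partial>lborel) = of_real (Gamma (1 / 2)) * L"
    using ki by (simp add: kI scaleR_conv_of_real)
  moreover have "\<forall>\<^sub>F \<epsilon> in at_right 0. (\<integral>\<tau>. k \<tau> *\<^sub>R G (\<tau> / \<epsilon>) \<partial>lborel) = of_real (sqrt \<epsilon>) * (LBINT t:{0<..}. exp (- of_real (\<epsilon> * t)) * H t)"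
    unfolding eventually_at_right_field
  proof (intro exI[of _ 1] conjI allI impI)
    fix \<epsilon> :: real assume e: "0 < \<epsilon>" "\<epsilon> < 1"
    have eq: "k \<tau> *\<^sub>R G (\<tau> / \<epsilon>) = (1 / sqrt \<epsilon>) *\<^sub>R (indicat_real {0<..} (0 + (1 / \<epsilon>) * \<tau>) *\<^sub>R (exp (- of_real (\<epsilon> * (0 + (1 / \<epsilon>) * \<tau>))) * H (0 + (1 / \<epsilon>) * \<tau>)))" for \<tau>
    proof (cases "\<tau> > 0")
      case True
      have p: "\<tau> powr (- (1 / 2)) = 1 / sqrt \<tau>" using True by (simp add: powr_minus powr_half_sqrt inverse_eq_divide)
      show ?thesis using True e unfolding k_def G_def
        by (simp add: p real_sqrt_divide scaleR_conv_of_real zero_less_divide_iff exp_of_real[symmetric] field_simps)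
    qed (use e in \<open>simp add: k_def zero_less_divide_iff\<close>)
    have "(LBINT t:{0<..}. exp (- of_real (\<epsilon> * t)) * H t) = \<bar>1 / \<epsilon>\<bar> *\<^sub>R
       (\<integral>\<tau>. indicat_real {0<..} (0 + (1 / \<epsilon>) * \<tau>) *\<^sub>R (exp (- of_real (\<epsilon> * (0 + (1 / \<epsilon>) * \<tau>))) * H (0 + (1 / \<epsilon>) * \<tau>)) \<partial>lborel)"
      unfolding set_lebesgue_integral_def by (rule lborel_integral_real_affine) (use e in auto)
    then have "of_real (sqrt \<epsilon>) * (LBINT t:{0<..}. exp (- of_real (\<epsilon> * t)) * H t) = (sqrt \<epsilon> / \<epsilon>) *\<^sub>R
       (\<integral>\<tau>. indicat_real {0<..} (0 + (1 / \<epsilon>) * \<tau>) *\<^sub>R (exp (- of_real (\<epsilon> * (0 + (1 / \<epsilon>) * \<tau>))) * H (0 + (1 / \<epsilon>) * \<tau>)) \<partial>lborel)"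
      using e by (simp add: scaleR_conv_of_real)
    also have "sqrt \<epsilon> / \<epsilon> = 1 / sqrt \<epsilon>" using e by (simp add: real_div_sqrt field_simps)
    finally show "(\<integral>\<tau>. k \<tau> *\<^sub>R G (\<tau> / \<epsilon>) \<partial>lborel) = of_real (sqrt \<epsilon>) * (LBINT t:{0<..}. exp (- of_real (\<epsilon> * t)) * H t)"
      unfolding eq by (simp only: integral_scaleR_right)
  qed simp
  ultimately show ?thesis using Lim_transform_eventually by fastforce
qed

lemma bounded_Ioi:
  fixes f :: "real \<Rightarrow> 'a::real_normed_vector"
  assumes cont: "continuous_on {0<..} f"
    and 0: "\<forall>\<^sub>F t in at_right 0. norm (f t) \<le> B0" and 1: "\<forall>\<^sub>F t in at_top. norm (f t) \<le> B1"
  shows "\<exists>M. \<forall>t>0. norm (f t) \<le> M"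
proof -
  obtain e where e: "e > 0" "\<And>t. 0 < t \<Longrightarrow> t < e \<Longrightarrow> norm (f t) \<le> B0"
    using 0 unfolding eventually_at_right_field by auto
  obtain T where T: "\<And>t. t \<ge> T \<Longrightarrow> norm (f t) \<le> B1" using 1 unfolding eventually_at_top_linorder by auto
  have "compact (f ` {e / 2..T})"
    by (intro compact_continuous_image continuous_on_subset[OF cont]) (use e in auto)
  then obtain B where B: "\<And>t. t \<in> {e / 2..T} \<Longrightarrow> norm (f t) \<le> B"
    using compact_imp_bounded bounded_iff by (metis imageI)
  have "norm (f t) \<le> max B0 (max B1 B)" if "t > 0" for t
    using e(2)[OF that] T[of t] B[of t] e(1) by (cases "t < e"; cases "t \<ge> T") (auto simp: max_def)
  then show ?thesis by blast
qed

section \<open>The phase at infinity\<close>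

context
  fixes \<nu> :: real
  assumes \<nu>: "\<nu> \<ge> 1"
begin

private lemma \<nu>0: "\<nu> > 0" using \<nu> by simp

lemma LE_bound: obtains B where "\<forall>\<^sub>F z in at_top. \<bar>Ly \<nu> z\<bar> \<le> B" "\<forall>\<^sub>F z in at_top. \<bar>Lv \<nu> z\<bar> \<le> B"
proof -
  obtain A where A: "A > 0" "(LE \<nu> \<longlongrightarrow> A) at_top" using LE_tendsto[OF \<nu>0] .
  have ev: "\<forall>\<^sub>F z in at_top. LE \<nu> z < A + 1" by (rule order_tendstoD(2)[OF A(2)]) simp
  have *: "\<bar>u\<bar> \<le> sqrt (A + 1)" if "u\<^sup>2 \<le> LE \<nu> z" "LE \<nu> z < A + 1" for u z
    using that real_sqrt_le_mono[of "u\<^sup>2" "A + 1"] by simp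
  have "\<forall>\<^sub>F z in at_top. \<bar>Ly \<nu> z\<bar> \<le> sqrt (A + 1)"
    by (rule eventually_mono[OF ev], erule *[rotated]) (simp add: LE_def[OF \<nu>0])
  moreover have "\<forall>\<^sub>F z in at_top. \<bar>Lv \<nu> z\<bar> \<le> sqrt (A + 1)"
    by (rule eventually_mono[OF ev], erule *[rotated]) (simp add: LE_def[OF \<nu>0])
  ultimately show ?thesis by (rule that)
qed

lemma besselJ_near_0: "\<forall>\<^sub>F z in at_right 0. \<bar>besselJ \<nu> z / z\<bar> \<le> 2 powr (- \<nu>) * rGamma (\<nu> + 1) + 1"
proof -
  have l: "((\<lambda>z. z powr (- \<nu>) * besselJ \<nu> z) \<longlongrightarrow> 2 powr (- \<nu>) * rGamma (\<nu> + 1)) (at_right 0)"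
    using bessel_cyl_tendsto_0[of \<nu> "- 1"] by (simp add: besselJ_eq_cyl)
  have g: "rGamma (\<nu> + 1) > 0" using \<nu> by (simp add: rGamma_inverse_Gamma)
  have 1: "\<forall>\<^sub>F z in at_right 0. z powr (- \<nu>) * besselJ \<nu> z < 2 powr (- \<nu>) * rGamma (\<nu> + 1) + 1"
    by (rule order_tendstoD(2)[OF l]) simp
  have 2: "\<forall>\<^sub>F z in at_right 0. 0 < z powr (- \<nu>) * besselJ \<nu> z"
    by (rule order_tendstoD(1)[OF l]) (use g in simp)
  have 3: "\<forall>\<^sub>F z::real in at_right 0. z \<in> {0<..<1}" by (rule eventually_at_right_real) simp
  from 1 2 3 show ?thesis
  proof eventually_elim
    case (elim z)
    define u where "u = z powr (- \<nu>) * besselJ \<nu> z"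
    have z: "0 < z" "z < 1" using elim by auto
    have "besselJ \<nu> z / z = z powr (\<nu> - 1) * u"
      using z unfolding u_def by (simp add: powr_diff powr_minus field_simps)
    moreover have "z powr (\<nu> - 1) \<le> 1" using z \<nu> by (intro powr_le1) auto
    ultimately have "\<bar>besselJ \<nu> z / z\<bar> \<le> 1 * u"
      using elim(2) by (simp add: abs_mult u_def[symmetric] mult_right_mono)
    then show ?case using elim(1) by (simp add: u_def)
  qed
qed

lemma L_ratio_limits:
  "((\<lambda>z. sqrt z / Lr \<nu> z) \<longlongrightarrow> 1) at_top" "((\<lambda>z. Lr \<nu> z / sqrt z) \<longlongrightarrow> 1) at_top"
  "((\<lambda>z. z * sqrt z / (2 * LD \<nu> z * Lr \<nu> z)) \<longlongrightarrow> 0) at_top" "filterlim (Lr \<nu>) at_top at_top"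
  unfolding Lr_def[OF \<nu>0, abs_def] LD_def[OF \<nu>0, abs_def] by real_asymp+

lemma besselJ_eq_Ly: "z > \<nu> \<Longrightarrow> besselJ \<nu> z = Ly \<nu> z / Lr \<nu> z"
  using Lr_pos[OF \<nu>0, of z] by (simp add: Ly_def[OF \<nu>0])

lemma besselJ_zderiv_eq_Lv:
  "z > \<nu> \<Longrightarrow> besselJ_zderiv \<nu> z = Lr \<nu> z * Lv \<nu> z - z\<^sup>2 / (2 * LD \<nu> z) * besselJ \<nu> z"
  using Lr_pos[OF \<nu>0, of z] by (simp add: Lv_def[OF \<nu>0])

lemma besselJ_div_bounded: "\<exists>M. \<forall>t>0. \<bar>besselJ \<nu> t / t\<bar> \<le> M"
proof -
  obtain B where B: "\<forall>\<^sub>F z in at_top. \<bar>Ly \<nu> z\<bar> \<le> B" using LE_bound by blast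
  have "\<forall>\<^sub>F z in at_top. Lr \<nu> z \<ge> 1" using L_ratio_limits(4) by (simp add: filterlim_at_top)
  with B eventually_gt_at_top[of \<nu>] have far: "\<forall>\<^sub>F z in at_top. norm (besselJ \<nu> z / z) \<le> B"
  proof eventually_elim
    case (elim z)
    then have "\<bar>Ly \<nu> z\<bar> * 1 \<le> B * (Lr \<nu> z * z)"
      using \<nu> by (intro mult_mono) (auto intro!: order_trans[of 1 "1 * 1" "Lr \<nu> z * z"] mult_mono)
    then show ?case using elim \<nu> unfolding besselJ_eq_Ly[OF elim(2)]
      by (simp add: abs_mult divide_le_eq mult_ac)
  qed
  have near: "\<forall>\<^sub>F z in at_right 0. norm (besselJ \<nu> z / z) \<le> 2 powr (- \<nu>) * rGamma (\<nu> + 1) + 1"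
    using besselJ_near_0 by simp
  have c: "continuous_on {0<..} (\<lambda>z. besselJ \<nu> z / z)"
    by (intro continuous_intros continuous_on_besselJ) auto
  show ?thesis using bounded_Ioi[OF c near far] by simp
qed

text \<open>
  The function \<open>J - \<i> * J'\<close> with the oscillation \<open>exp (\<i> * t)\<close> removed: multiplied by \<open>sqrt t\<close> it converges, and the
  argument of the limit contains the unknown phase constant.
\<close>

definition LH :: "real \<Rightarrow> complex" where
  "LH t = exp (- (\<i> * of_real t)) * (of_real (besselJ \<nu> t) - \<i> * of_real (besselJ_zderiv \<nu> t / t))"

lemma continuous_on_zderiv: "continuous_on {0<..} (besselJ_zderiv \<nu>)"
  by (intro continuous_at_imp_continuous_on ballI DERIV_isCont[OF DERIV_besselJ_zderiv]) auto

lemma continuous_on_LH: "continuous_on {0<..} LH"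
  unfolding LH_def by (intro continuous_intros continuous_on_zderiv continuous_on_besselJ) auto

text \<open>
  The coefficients of \<open>Ly\<close> and \<open>- \<i> * Lv\<close> tend to 1, the last one tends to 0.
\<close>

lemma LH_eq:
  assumes t: "t > \<nu>"
  shows "of_real (sqrt t) * LH t = exp (- (\<i> * of_real t)) *
    (of_real (sqrt t / Lr \<nu> t) * of_real (Ly \<nu> t) - \<i> * of_real (Lr \<nu> t / sqrt t) * of_real (Lv \<nu> t)
     + \<i> * of_real (t * sqrt t / (2 * LD \<nu> t * Lr \<nu> t)) * of_real (Ly \<nu> t))"
proof -
  have t0: "t > 0" using t \<nu> by simp
  have r: "Lr \<nu> t > 0" using Lr_pos[OF \<nu>0 t] .
  have D: "LD \<nu> t > 0" using LD_pos[OF \<nu>0 t] .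
  have 1: "sqrt t * besselJ \<nu> t = sqrt t / Lr \<nu> t * Ly \<nu> t" using besselJ_eq_Ly[OF t] by simp
  have 2: "sqrt t * (besselJ_zderiv \<nu> t / t) = Lr \<nu> t / sqrt t * Lv \<nu> t - t * sqrt t / (2 * LD \<nu> t * Lr \<nu> t) * Ly \<nu> t"
  proof -
    have "sqrt t * (besselJ_zderiv \<nu> t / t) = (sqrt t / t) * (Lr \<nu> t * Lv \<nu> t) - sqrt t * (t\<^sup>2 / t) / (2 * LD \<nu> t) * (Ly \<nu> t / Lr \<nu> t)"
      unfolding besselJ_zderiv_eq_Lv[OF t] besselJ_eq_Ly[OF t] by (simp add: algebra_simps diff_divide_distrib)
    moreover have "sqrt t / t = 1 / sqrt t" using t0 by (simp add: real_div_sqrt field_simps)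
    moreover have "t\<^sup>2 / t = t" using t0 by (simp add: power2_eq_square)
    ultimately show ?thesis by (simp add: mult_ac)
  qed
  have "of_real (sqrt t) * LH t = exp (- (\<i> * of_real t)) *
     (of_real (sqrt t * besselJ \<nu> t) - \<i> * of_real (sqrt t * (besselJ_zderiv \<nu> t / t)))"
    unfolding LH_def by (simp add: algebra_simps)
  then show ?thesis unfolding 1 2 by (simp add: algebra_simps)
qed

text \<open>
  The accumulated phase is \<open>t - \<nu> * pi / 2\<close> up to a vanishing error.
\<close>

lemma Ls_asymp: "((\<lambda>t. Ls \<nu> t - t) \<longlongrightarrow> - \<nu> * (pi / 2)) at_top"
proof -
  have "((\<lambda>t. (\<nu> * sqrt ((t / \<nu>)\<^sup>2 - 1) - t) - \<nu> * arccos (1 / (t / \<nu>))) \<longlongrightarrow> 0 - \<nu> * (pi / 2)) at_top"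
  proof (intro tendsto_diff tendsto_mult tendsto_const)
    show "((\<lambda>t. \<nu> * sqrt ((t / \<nu>)\<^sup>2 - 1) - t) \<longlongrightarrow> 0) at_top" using \<nu>0 by real_asymp
    have "filterlim (\<lambda>t. t / \<nu>) at_top at_top" using \<nu>0 by real_asymp
    then show "((\<lambda>t. arccos (1 / (t / \<nu>))) \<longlongrightarrow> pi / 2) at_top"
      by (rule filterlim_compose[OF Debye_limits(4)])
  qed
  then show ?thesis unfolding Ls_def[OF \<nu>0, abs_def] Debye_phase_def by (simp add: algebra_simps)
qed

lemma LH_lim:
  assumes ang: "Langle \<nu> \<theta>" and C: "((\<lambda>z. \<theta> z - Ls \<nu> z) \<longlongrightarrow> C) at_top" and A: "(LE \<nu> \<longlongrightarrow> A) at_top"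
  shows "((\<lambda>t. of_real (sqrt t) * LH t) \<longlongrightarrow> of_real (sqrt A) * cis (C - \<nu> * (pi / 2))) at_top"
proof -
  obtain B where B: "\<forall>\<^sub>F z in at_top. \<bar>Ly \<nu> z\<bar> \<le> B" "\<forall>\<^sub>F z in at_top. \<bar>Lv \<nu> z\<bar> \<le> B" by (rule LE_bound)
  define R where "R t = \<bar>sqrt t / Lr \<nu> t - 1\<bar> * B + \<bar>Lr \<nu> t / sqrt t - 1\<bar> * B + \<bar>t * sqrt t / (2 * LD \<nu> t * Lr \<nu> t)\<bar> * B" for t
  have R0: "(R \<longlongrightarrow> \<bar>1 - 1\<bar> * B + \<bar>1 - 1\<bar> * B + \<bar>0\<bar> * B) at_top"
    unfolding R_def by (intro tendsto_intros L_ratio_limits)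
  have main: "((\<lambda>t. of_real (sqrt (LE \<nu> t)) * cis ((\<theta> t - Ls \<nu> t) + (Ls \<nu> t - t))) \<longlongrightarrow> of_real (sqrt A) * cis (C + - \<nu> * (pi / 2))) at_top"
    by (intro tendsto_intros tendsto_cis C A Ls_asymp)
  have "((\<lambda>t. of_real (sqrt t) * LH t - of_real (sqrt (LE \<nu> t)) * cis ((\<theta> t - Ls \<nu> t) + (Ls \<nu> t - t))) \<longlongrightarrow> 0) at_top"
  proof (rule Lim_null_comparison)
    show "(R \<longlongrightarrow> 0) at_top" using R0 by simp
    show "\<forall>\<^sub>F t in at_top. norm (of_real (sqrt t) * LH t - of_real (sqrt (LE \<nu> t)) * cis ((\<theta> t - Ls \<nu> t) + (Ls \<nu> t - t))) \<le> R t"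
      using B eventually_gt_at_top[of \<nu>]
    proof eventually_elim
      case (elim t)
      define \<alpha> where "\<alpha> = sqrt t / Lr \<nu> t"
      define \<beta> where "\<beta> = Lr \<nu> t / sqrt t"
      define \<gamma> where "\<gamma> = t * sqrt t / (2 * LD \<nu> t * Lr \<nu> t)"
      have y: "Ly \<nu> t = sqrt (LE \<nu> t) * cos (\<theta> t)" and v: "Lv \<nu> t = - sqrt (LE \<nu> t) * sin (\<theta> t)"
        using ang elim(3) unfolding Langle_def[OF \<nu>0] by auto
      have "of_real (sqrt (LE \<nu> t)) * cis ((\<theta> t - Ls \<nu> t) + (Ls \<nu> t - t)) = of_real (sqrt (LE \<nu> t)) * (cis (- t) * cis (\<theta> t))"
        by (simp add: cis_mult)
      also have "\<dots> = cis (- t) * (of_real (Ly \<nu> t) - \<i> * of_real (Lv \<nu> t))"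
        unfolding y v by (simp add: complex_eq_iff algebra_simps)
      also have "cis (- t) = exp (- (\<i> * of_real t))" by (simp add: cis_conv_exp)
      finally have e: "of_real (sqrt (LE \<nu> t)) * cis ((\<theta> t - Ls \<nu> t) + (Ls \<nu> t - t))
         = exp (- (\<i> * of_real t)) * (of_real (Ly \<nu> t) - \<i> * of_real (Lv \<nu> t))" .
      have "of_real (sqrt t) * LH t - of_real (sqrt (LE \<nu> t)) * cis ((\<theta> t - Ls \<nu> t) + (Ls \<nu> t - t))
         = exp (- (\<i> * of_real t)) * (of_real ((\<alpha> - 1) * Ly \<nu> t) - \<i> * of_real ((\<beta> - 1) * Lv \<nu> t) + \<i> * of_real (\<gamma> * Ly \<nu> t))"
        unfolding LH_eq[OF elim(3)] e \<alpha>_def \<beta>_def \<gamma>_def by (simp add: algebra_simps)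
      also have "norm \<dots> = norm (of_real ((\<alpha> - 1) * Ly \<nu> t) - \<i> * of_real ((\<beta> - 1) * Lv \<nu> t) + \<i> * of_real (\<gamma> * Ly \<nu> t))"
        by (simp only: norm_mult norm_exp_eq_Re) simp
      also have "\<dots> \<le> norm (complex_of_real ((\<alpha> - 1) * Ly \<nu> t)) + norm (\<i> * complex_of_real ((\<beta> - 1) * Lv \<nu> t)) + norm (\<i> * complex_of_real (\<gamma> * Ly \<nu> t))"
        by (intro order_trans[OF norm_triangle_ineq] add_right_mono norm_triangle_ineq4)
      also have "\<dots> = \<bar>\<alpha> - 1\<bar> * \<bar>Ly \<nu> t\<bar> + \<bar>\<beta> - 1\<bar> * \<bar>Lv \<nu> t\<bar> + \<bar>\<gamma>\<bar> * \<bar>Ly \<nu> t\<bar>"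
        by (simp only: norm_mult norm_of_real abs_mult norm_ii mult_1)
      also have "\<dots> \<le> R t" unfolding R_def \<alpha>_def[symmetric] \<beta>_def[symmetric] \<gamma>_def[symmetric]
        using elim(1,2) by (intro add_mono mult_left_mono) auto
      finally show ?case .
    qed
  qed
  from tendsto_add[OF this main] show ?thesis by simp
qed

lemma norm_LH: "norm (LH t) = norm (of_real (besselJ \<nu> t) - \<i> * of_real (besselJ_zderiv \<nu> t / t))"
  unfolding LH_def by (simp only: norm_mult norm_exp_eq_Re) simp

lemma zderiv_near_0:
  assumes Ma: "\<forall>t>0. \<bar>besselJ \<nu> t / t\<bar> \<le> M"
  shows "\<forall>\<^sub>F t in at_right 0. \<bar>besselJ_zderiv \<nu> t / t\<bar> \<le> \<nu> * M + 1"
proof -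
  have M: "\<And>t. t > 0 \<Longrightarrow> \<bar>besselJ \<nu> t / t\<bar> \<le> M" using Ma by blast
  have l: "((\<lambda>z. z powr (\<nu> + 1) * (z powr (- (\<nu> + 1)) * besselJ (\<nu> + 1) z)) \<longlongrightarrow> 0 * (2 powr (- (\<nu> + 1)) * rGamma (\<nu> + 1 + 1))) (at_right 0)"
    unfolding besselJ_eq_cyl by (intro tendsto_mult bessel_cyl_tendsto_0) (use \<nu> in real_asymp)
  have "\<forall>\<^sub>F z in at_right 0. \<bar>z powr (\<nu> + 1) * (z powr (- (\<nu> + 1)) * besselJ (\<nu> + 1) z)\<bar> < 1"
    using order_tendstoD(2)[OF tendsto_rabs[OF l], of 1] by simp
  moreover have "\<forall>\<^sub>F z::real in at_right 0. z \<in> {0<..<1}" by (rule eventually_at_right_real) simp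
  ultimately show ?thesis
  proof eventually_elim
    case (elim t)
    have t: "t > 0" using elim(2) by simp
    have "t powr (\<nu> + 1) * t powr (- (\<nu> + 1)) = 1" using t by (simp flip: powr_add)
    then have "\<bar>besselJ (\<nu> + 1) t\<bar> < 1" using elim(1) by (simp flip: mult.assoc)
    moreover have "besselJ_zderiv \<nu> t / t = \<nu> * (besselJ \<nu> t / t) - besselJ (\<nu> + 1) t"
      using t by (simp add: besselJ_zderiv_def diff_divide_distrib)
    moreover have "\<bar>\<nu> * (besselJ \<nu> t / t)\<bar> \<le> \<nu> * M"
    proof -
      have "\<nu> * \<bar>besselJ \<nu> t / t\<bar> \<le> \<nu> * M" using M[OF t] \<nu> by (intro mult_left_mono) auto
      then show ?thesis using \<nu> by (simp add: abs_mult)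
    qed
    ultimately show ?case by linarith
  qed
qed

lemma LH_bounded:
  assumes L: "((\<lambda>t. of_real (sqrt t) * LH t) \<longlongrightarrow> L) at_top"
  shows "\<exists>K. \<forall>t>0. norm (of_real (sqrt t) * LH t) \<le> K"
proof -
  obtain M where Ma: "\<forall>t>0. \<bar>besselJ \<nu> t / t\<bar> \<le> M" using besselJ_div_bounded by blast
  have M: "\<And>t. t > 0 \<Longrightarrow> \<bar>besselJ \<nu> t / t\<bar> \<le> M" using Ma by blast
  have "\<forall>\<^sub>F z::real in at_right 0. z \<in> {0<..<1}" by (rule eventually_at_right_real) simp
  with zderiv_near_0[OF Ma] have near: "\<forall>\<^sub>F t in at_right 0. norm (of_real (sqrt t) * LH t) \<le> M + (\<nu> * M + 1)"
  proof eventually_elim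
    case (elim t)
    have t: "0 < t" "t < 1" using elim(2) by auto
    have "\<bar>besselJ \<nu> t\<bar> = \<bar>besselJ \<nu> t / t\<bar> * t" using t by simp
    also have "\<dots> \<le> M * 1" using M[OF t(1)] t order_trans[OF abs_ge_zero M[OF t(1)]] by (intro mult_mono) auto
    finally have J: "\<bar>besselJ \<nu> t\<bar> \<le> M" by simp
    have "norm (LH t) \<le> norm (complex_of_real (besselJ \<nu> t)) + norm (\<i> * complex_of_real (besselJ_zderiv \<nu> t / t))"
      unfolding norm_LH by (rule norm_triangle_ineq4)
    also have "\<dots> \<le> M + (\<nu> * M + 1)" using J elim(1) by (simp add: norm_mult norm_divide)
    finally have b: "norm (LH t) \<le> M + (\<nu> * M + 1)" .
    have "sqrt t * norm (LH t) \<le> 1 * (M + (\<nu> * M + 1))" using t b by (intro mult_mono) auto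
    then show ?case using t by (simp add: norm_mult)
  qed
  have far: "\<forall>\<^sub>F t in at_top. norm (of_real (sqrt t) * LH t) \<le> norm L + 1"
    using order_tendstoD(2)[OF tendsto_norm[OF L], of "norm L + 1"] by (auto elim: eventually_mono)
  have c: "continuous_on {0<..} (\<lambda>t. of_real (sqrt t) * LH t)"
    by (intro continuous_intros continuous_on_LH)
  show ?thesis by (rule bounded_Ioi[OF c near far])
qed

lemma zderiv_bounded:
  assumes L: "((\<lambda>t. of_real (sqrt t) * LH t) \<longlongrightarrow> L) at_top"
  shows "\<exists>K. \<forall>t>0. \<bar>besselJ_zderiv \<nu> t / t\<bar> \<le> K"
proof -
  obtain M where Ma: "\<forall>t>0. \<bar>besselJ \<nu> t / t\<bar> \<le> M" using besselJ_div_bounded by blast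
  have M: "\<And>t. t > 0 \<Longrightarrow> \<bar>besselJ \<nu> t / t\<bar> \<le> M" using Ma by blast
  obtain K where K: "\<forall>t>0. norm (of_real (sqrt t) * LH t) \<le> K" using LH_bounded[OF L] by blast
  have far: "\<forall>\<^sub>F t in at_top. norm (besselJ_zderiv \<nu> t / t) \<le> K"
    using eventually_ge_at_top[of 1]
  proof eventually_elim
    case (elim t)
    have "\<bar>besselJ_zderiv \<nu> t / t\<bar> = \<bar>Im (of_real (besselJ \<nu> t) - \<i> * of_real (besselJ_zderiv \<nu> t / t))\<bar>" by simp
    also have "\<dots> \<le> norm (LH t)" unfolding norm_LH by (rule abs_Im_le_cmod)
    also have "\<dots> \<le> sqrt t * norm (LH t)" using elim mult_right_mono[of 1 "sqrt t" "norm (LH t)"] by simp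
    also have "\<dots> \<le> K" using K elim by (auto simp: norm_mult)
    finally show ?case by simp
  qed
  have near: "\<forall>\<^sub>F t in at_right 0. norm (besselJ_zderiv \<nu> t / t) \<le> \<nu> * M + 1" using zderiv_near_0[OF Ma] by simp
  have c: "continuous_on {0<..} (\<lambda>t. besselJ_zderiv \<nu> t / t)"
    by (intro continuous_intros continuous_on_zderiv) auto
  show ?thesis using bounded_Ioi[OF c near far] by simp
qed

lemma has_vector_derivative_exp_mult:
  fixes f :: "real \<Rightarrow> real"
  assumes "(f has_real_derivative f') (at t)"
  shows "((\<lambda>t. exp (- p * complex_of_real t) * complex_of_real (f t)) has_vector_derivative
     exp (- p * complex_of_real t) * (complex_of_real f' - p * complex_of_real (f t))) (at t)"
proof -
  have 1: "((\<lambda>t. exp (- p * complex_of_real t)) has_vector_derivative - p * exp (- p * complex_of_real t)) (at t)"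
    by (rule has_vector_derivative_real_field) (auto intro!: derivative_eq_intros)
  have 2: "((\<lambda>t. complex_of_real (f t)) has_vector_derivative complex_of_real f') (at t)"
    using assms by (intro bounded_linear.has_vector_derivative[OF bounded_linear_of_real])
      (simp add: has_real_derivative_iff_has_vector_derivative)
  show ?thesis
    using has_vector_derivative_mult[OF 1 2] by (simp add: algebra_simps)
qed

lemma exp_mult_tendsto:
  fixes f :: "real \<Rightarrow> real" and p :: complex
  assumes p: "Re p > 0" and bd: "\<And>t. t > 0 \<Longrightarrow> \<bar>f t\<bar> \<le> K * t"
  shows "((\<lambda>t. exp (- p * complex_of_real t) * complex_of_real (f t)) \<longlongrightarrow> 0) (at_right 0)"
    and "((\<lambda>t. exp (- p * complex_of_real t) * complex_of_real (f t)) \<longlongrightarrow> 0) at_top"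
proof -
  have b: "norm (exp (- p * complex_of_real t) * complex_of_real (f t)) \<le> K * (t * exp (- Re p * t))" if "t > 0" for t
  proof -
    have "norm (exp (- p * complex_of_real t) * complex_of_real (f t)) = exp (- Re p * t) * \<bar>f t\<bar>"
      by (simp add: norm_mult)
    also have "\<dots> \<le> exp (- Re p * t) * (K * t)" by (intro mult_left_mono bd that) simp
    finally show ?thesis by (simp add: mult_ac)
  qed
  have 0: "((\<lambda>t. K * (t * exp (- Re p * t))) \<longlongrightarrow> K * (0 * exp (- Re p * 0))) (at_right 0)"
    by (intro tendsto_intros)
  show "((\<lambda>t. exp (- p * complex_of_real t) * complex_of_real (f t)) \<longlongrightarrow> 0) (at_right 0)"
    by (rule Lim_null_comparison[OF _ 0[simplified]])
       (use b in \<open>auto simp: eventually_at_right_field intro!: exI[of _ 1]\<close>)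
  have 1: "((\<lambda>t. K * (t * exp (- Re p * t))) \<longlongrightarrow> K * 0) at_top"
    by (intro tendsto_mult_left) (use p in real_asymp)
  show "((\<lambda>t. exp (- p * complex_of_real t) * complex_of_real (f t)) \<longlongrightarrow> 0) at_top"
  proof (rule Lim_null_comparison)
    show "((\<lambda>t. K * (t * exp (- Re p * t))) \<longlongrightarrow> 0) at_top" using 1 by simp
    show "\<forall>\<^sub>F t in at_top. norm (exp (- p * complex_of_real t) * complex_of_real (f t)) \<le> K * (t * exp (- Re p * t))"
      using eventually_gt_at_top[of 0] by eventually_elim (rule b)
  qed
qed

lemma set_integrable_exp_mult:
  fixes f :: "real \<Rightarrow> real"
  assumes p: "Re p > 0" and c: "continuous_on {0<..} f" and bd: "\<And>t. t > 0 \<Longrightarrow> \<bar>f t\<bar> \<le> K * t ^ n"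
  shows "set_integrable lborel {0<..} (\<lambda>t. exp (- p * complex_of_real t) * complex_of_real (f t))"
proof (rule set_integrable_bound_exp[OF _ _ p])
  show "continuous_on {0<..} (\<lambda>t. exp (- p * complex_of_real t) * complex_of_real (f t))"
    by (intro continuous_intros c)
  show "norm (exp (- p * complex_of_real t) * complex_of_real (f t)) \<le> K * (t ^ n * exp (- Re p * t))" if "t > 0" for t
  proof -
    have "norm (exp (- p * complex_of_real t) * complex_of_real (f t)) = exp (- Re p * t) * \<bar>f t\<bar>"
      by (simp add: norm_mult)
    also have "\<dots> \<le> exp (- Re p * t) * (K * t ^ n)" by (intro mult_left_mono bd that) simp
    finally show ?thesis by (simp add: mult_ac)
  qed
qed

text \<open>
  Integration by parts; the boundary terms vanish because \<open>J\<close> is bounded by a multiple of \<open>t\<close>, which holds near 0 for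
  \<open>\<nu> \<ge> 1\<close>.
\<close>

lemma laplace_deriv_besselJ:
  assumes p: "Re p > 0" and Ka: "\<forall>t>0. \<bar>besselJ_zderiv \<nu> t / t\<bar> \<le> K"
  shows "(LBINT t:{0<..}. exp (- p * complex_of_real t) * complex_of_real (besselJ_zderiv \<nu> t / t)) = p * laplace (\<lambda>t. besselJ \<nu> t / t) 1 p"
    and "set_integrable lborel {0<..} (\<lambda>t. exp (- p * complex_of_real t) * complex_of_real (besselJ_zderiv \<nu> t / t))"
    and "set_integrable lborel {0<..} (\<lambda>t. exp (- p * complex_of_real t) * complex_of_real (besselJ \<nu> t))"
    and "laplace (\<lambda>t. besselJ \<nu> t / t) 1 p = (LBINT t:{0<..}. exp (- p * complex_of_real t) * complex_of_real (besselJ \<nu> t))"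
proof -
  have K: "\<And>t. t > 0 \<Longrightarrow> \<bar>besselJ_zderiv \<nu> t / t\<bar> \<le> K" using Ka by blast
  obtain M where Ma: "\<forall>t>0. \<bar>besselJ \<nu> t / t\<bar> \<le> M" using besselJ_div_bounded by blast
  have M: "\<And>t. t > 0 \<Longrightarrow> \<bar>besselJ \<nu> t / t\<bar> \<le> M" using Ma by blast
  have bJ: "\<bar>besselJ \<nu> t\<bar> \<le> M * t" if "t > 0" for t using M[OF that] that by (simp add: divide_le_eq)
  have cW: "continuous_on {0<..} (\<lambda>t. besselJ_zderiv \<nu> t / t)"
    by (intro continuous_intros continuous_on_zderiv) auto
  show i1: "set_integrable lborel {0<..} (\<lambda>t. exp (- p * complex_of_real t) * complex_of_real (besselJ_zderiv \<nu> t / t))"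
    by (rule set_integrable_exp_mult[OF p cW, of K 0]) (use K in simp)
  show i2: "set_integrable lborel {0<..} (\<lambda>t. exp (- p * complex_of_real t) * complex_of_real (besselJ \<nu> t))"
    by (rule set_integrable_exp_mult[OF p continuous_on_besselJ, of _ M 1]) (use bJ in simp)
  show e: "laplace (\<lambda>t. besselJ \<nu> t / t) 1 p = (LBINT t:{0<..}. exp (- p * complex_of_real t) * complex_of_real (besselJ \<nu> t))"
    unfolding laplace_def by (rule set_lebesgue_integral_cong) (auto simp: mult.commute)
  have cc: "continuous_on {0<..} (\<lambda>t. exp (- p * complex_of_real t) * (complex_of_real (besselJ_zderiv \<nu> t / t) - p * complex_of_real (besselJ \<nu> t)))"
    by (intro continuous_intros cW continuous_on_besselJ)
  have eq: "exp (- p * complex_of_real t) * (complex_of_real (besselJ_zderiv \<nu> t / t) - p * complex_of_real (besselJ \<nu> t))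
    = exp (- p * complex_of_real t) * complex_of_real (besselJ_zderiv \<nu> t / t) - p * (exp (- p * complex_of_real t) * complex_of_real (besselJ \<nu> t))" for t
    by (simp add: algebra_simps)
  have "(LBINT t:{0<..}. exp (- p * complex_of_real t) * (complex_of_real (besselJ_zderiv \<nu> t / t) - p * complex_of_real (besselJ \<nu> t))) = 0 - 0"
  proof (rule integral_Ioi_FTC)
    show "((\<lambda>t. exp (- p * complex_of_real t) * complex_of_real (besselJ \<nu> t)) has_vector_derivative
       exp (- p * complex_of_real t) * (complex_of_real (besselJ_zderiv \<nu> t / t) - p * complex_of_real (besselJ \<nu> t))) (at t)" if "t > 0" for t
      by (rule has_vector_derivative_exp_mult[OF DERIV_besselJ[OF that]])
    show "isCont (\<lambda>t. exp (- p * complex_of_real t) * (complex_of_real (besselJ_zderiv \<nu> t / t) - p * complex_of_real (besselJ \<nu> t))) t" if "t > 0" for t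
      using cc that by (simp add: continuous_on_eq_continuous_at)
    show "set_integrable lborel {0<..} (\<lambda>t. exp (- p * complex_of_real t) * (complex_of_real (besselJ_zderiv \<nu> t / t) - p * complex_of_real (besselJ \<nu> t)))"
      unfolding eq by (intro set_integral_diff set_integrable_mult_right i1 i2)
  qed (rule exp_mult_tendsto[OF p bJ]; assumption)+
  then show "(LBINT t:{0<..}. exp (- p * complex_of_real t) * complex_of_real (besselJ_zderiv \<nu> t / t)) = p * laplace (\<lambda>t. besselJ \<nu> t / t) 1 p"
    unfolding eq e by (subst (asm) set_integral_diff(2)) (use i1 i2 in \<open>auto intro!: set_integrable_mult_right\<close>)
qed

text \<open>
  By Bessel's equation the integrand of the left-hand side is the derivative of \<open>- exp (- p * t) * (t * J' + p * t * J)\<close>,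
  which vanishes at both ends. Since the three transforms are successive derivatives up to sign, this is a
  differential equation for the transform of \<open>J / t\<close>; the transform of \<open>J\<close> itself would satisfy a more complicated one.
\<close>

lemma laplace_ODE:
  assumes p: "Re p > 0" and Ka: "\<forall>t>0. \<bar>besselJ_zderiv \<nu> t / t\<bar> \<le> K"
  defines "h \<equiv> \<lambda>t. besselJ \<nu> t / t"
  shows "(1 + p\<^sup>2) * laplace h 2 p - p * laplace h 1 p - of_real (\<nu>\<^sup>2) * laplace h 0 p = 0"
proof -
  have K: "\<And>t. t > 0 \<Longrightarrow> \<bar>besselJ_zderiv \<nu> t / t\<bar> \<le> K" using Ka by blast
  obtain M where Ma: "\<forall>t>0. \<bar>h t\<bar> \<le> M" using besselJ_div_bounded unfolding h_def by blast
  have M: "\<And>t. t > 0 \<Longrightarrow> \<bar>h t\<bar> \<le> M" using Ma by blast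
  have ch: "continuous_on {0<..} h" unfolding h_def by (intro continuous_intros continuous_on_besselJ) auto
  note il = integrable_laplace[OF ch Ma p]
  have bW: "\<bar>besselJ_zderiv \<nu> t\<bar> \<le> K * t" if "t > 0" for t using K[OF that] that by (simp add: divide_le_eq)
  define F where "F t = - (exp (- p * complex_of_real t) * complex_of_real (besselJ_zderiv \<nu> t) + p * (exp (- p * complex_of_real t) * complex_of_real (t * besselJ \<nu> t)))" for t
  define f where "f t = (1 + p\<^sup>2) * (complex_of_real (t ^ 2 * h t) * exp (- p * complex_of_real t))
     - p * (complex_of_real (t ^ 1 * h t) * exp (- p * complex_of_real t)) - of_real (\<nu>\<^sup>2) * (complex_of_real (t ^ 0 * h t) * exp (- p * complex_of_real t))" for t
  have "(LBINT t:{0<..}. f t) = 0 - 0"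
  proof (rule integral_Ioi_FTC[where F=F])
    fix t :: real assume t: "t > 0"
    have 1: "((\<lambda>t. exp (- p * complex_of_real t) * complex_of_real (besselJ_zderiv \<nu> t)) has_vector_derivative
       exp (- p * complex_of_real t) * (complex_of_real (- ((t\<^sup>2 - \<nu>\<^sup>2) / t * besselJ \<nu> t)) - p * complex_of_real (besselJ_zderiv \<nu> t))) (at t)"
      by (rule has_vector_derivative_exp_mult[OF DERIV_besselJ_zderiv[OF t]])
    have 2: "((\<lambda>t. exp (- p * complex_of_real t) * complex_of_real (t * besselJ \<nu> t)) has_vector_derivative
       exp (- p * complex_of_real t) * (complex_of_real (1 * besselJ \<nu> t + besselJ_zderiv \<nu> t / t * t) - p * complex_of_real (t * besselJ \<nu> t))) (at t)"
      by (rule has_vector_derivative_exp_mult[OF DERIV_mult[OF DERIV_ident DERIV_besselJ[OF t]]])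
    have 3: "((\<lambda>t. p * (exp (- p * complex_of_real t) * complex_of_real (t * besselJ \<nu> t))) has_vector_derivative
       p * (exp (- p * complex_of_real t) * (complex_of_real (1 * besselJ \<nu> t + besselJ_zderiv \<nu> t / t * t) - p * complex_of_real (t * besselJ \<nu> t)))) (at t)"
      by (rule has_vector_derivative_mult_right[OF 2])
    have "besselJ \<nu> t = t * h t" using t by (simp add: h_def)
    then have 4: "f t = - (exp (- p * complex_of_real t) * (complex_of_real (- ((t\<^sup>2 - \<nu>\<^sup>2) / t * besselJ \<nu> t)) - p * complex_of_real (besselJ_zderiv \<nu> t))
       + p * (exp (- p * complex_of_real t) * (complex_of_real (1 * besselJ \<nu> t + besselJ_zderiv \<nu> t / t * t) - p * complex_of_real (t * besselJ \<nu> t))))"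
      unfolding f_def using t by (simp add: field_simps power2_eq_square)
    show "(F has_vector_derivative f t) (at t)"
      unfolding F_def 4 by (rule has_vector_derivative_minus[OF has_vector_derivative_add[OF 1 3]])
    have "continuous_on {0<..} f" unfolding f_def by (intro continuous_intros ch)
    then show "isCont f t" using t by (simp add: continuous_on_eq_continuous_at)
  next
    show "set_integrable lborel {0<..} f"
      unfolding f_def by (intro set_integral_diff set_integrable_mult_right il)
    have bJ: "\<bar>t * besselJ \<nu> t\<bar> \<le> M * t\<^sup>2" if "t > 0" for t
      using M[OF that] that by (simp add: h_def abs_mult divide_le_eq power2_eq_square)
    have n: "((\<lambda>t. exp (- p * complex_of_real t) * complex_of_real (t * besselJ \<nu> t)) \<longlongrightarrow> 0) (at_right 0)"
         "((\<lambda>t. exp (- p * complex_of_real t) * complex_of_real (t * besselJ \<nu> t)) \<longlongrightarrow> 0) at_top"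
    proof -
      have b: "norm (exp (- p * complex_of_real t) * complex_of_real (t * besselJ \<nu> t)) \<le> M * (t\<^sup>2 * exp (- Re p * t))" if "t > 0" for t
      proof -
        have "norm (exp (- p * complex_of_real t) * complex_of_real (t * besselJ \<nu> t)) = exp (- Re p * t) * \<bar>t * besselJ \<nu> t\<bar>"
          by (simp only: norm_mult norm_exp_eq_Re norm_of_real) simp
        also have "\<dots> \<le> exp (- Re p * t) * (M * t\<^sup>2)" by (intro mult_left_mono bJ that) simp
        finally show ?thesis by (simp add: mult_ac)
      qed
      have 0: "((\<lambda>t. M * (t\<^sup>2 * exp (- Re p * t))) \<longlongrightarrow> M * (0\<^sup>2 * exp (- Re p * 0))) (at_right 0)"
        by (intro tendsto_intros)
      show "((\<lambda>t. exp (- p * complex_of_real t) * complex_of_real (t * besselJ \<nu> t)) \<longlongrightarrow> 0) (at_right 0)"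
        by (rule Lim_null_comparison[OF _ 0[simplified]])
           (use b in \<open>auto simp: eventually_at_right_field intro!: exI[of _ 1]\<close>)
      have 1: "((\<lambda>t. M * (t\<^sup>2 * exp (- Re p * t))) \<longlongrightarrow> M * 0) at_top"
        by (intro tendsto_mult_left) (use p in real_asymp)
      show "((\<lambda>t. exp (- p * complex_of_real t) * complex_of_real (t * besselJ \<nu> t)) \<longlongrightarrow> 0) at_top"
      proof (rule Lim_null_comparison)
        show "((\<lambda>t. M * (t\<^sup>2 * exp (- Re p * t))) \<longlongrightarrow> 0) at_top" using 1 by simp
        show "\<forall>\<^sub>F t in at_top. norm (exp (- p * complex_of_real t) * complex_of_real (t * besselJ \<nu> t)) \<le> M * (t\<^sup>2 * exp (- Re p * t))"
          using eventually_gt_at_top[of 0] by eventually_elim (rule b)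
      qed
    qed
    show "(F \<longlongrightarrow> 0) (at_right 0)"
      unfolding F_def using tendsto_minus[OF tendsto_add[OF exp_mult_tendsto(1)[OF p bW] tendsto_mult_left[OF n(1), of p]]] by simp
    show "(F \<longlongrightarrow> 0) at_top"
      unfolding F_def using tendsto_minus[OF tendsto_add[OF exp_mult_tendsto(2)[OF p bW] tendsto_mult_left[OF n(2), of p]]] by simp
  qed
  also have "(LBINT t:{0<..}. f t) = (1 + p\<^sup>2) * laplace h 2 p - p * laplace h 1 p - of_real (\<nu>\<^sup>2) * laplace h 0 p"
    unfolding f_def laplace_def
    by (simp only: set_integral_diff(2) set_integrable_mult_right il set_integral_mult_right set_integral_diff(1))
  finally show ?thesis by simp
qed

text \<open>
  In the variable \<open>q = Ln (p + sqrt (1 + p\<^sup>2))\<close> the transform \<open>N0\<close> of \<open>J / t\<close> satisfies \<open>N0'' = \<nu>\<^sup>2 * N0\<close>. The solution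
  growing like \<open>exp (\<nu> * q)\<close> is excluded by the decay of the transform along the positive axis, so \<open>N0\<close> is a multiple of
  \<open>exp (- \<nu> * q)\<close>. The constant is real because \<open>N0\<close> is real on the real axis; for the phase only its being real matters.
\<close>

lemma laplace_besselJ_closed_form:
  assumes Ka: "\<forall>t>0. \<bar>besselJ_zderiv \<nu> t / t\<bar> \<le> K"
  defines "h \<equiv> \<lambda>t. besselJ \<nu> t / t"
  shows "\<exists>u::real. \<forall>p. Re p > 0 \<longrightarrow>
     csqrt (1 + p\<^sup>2) * laplace h 1 p = of_real (\<nu> * u) * exp (- of_real \<nu> * Ln (p + csqrt (1 + p\<^sup>2)))"
proof -
  obtain M where M: "\<forall>t>0. \<bar>h t\<bar> \<le> M" using besselJ_div_bounded unfolding h_def by blast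
  have ch: "continuous_on {0<..} h" unfolding h_def by (intro continuous_intros continuous_on_besselJ) auto
  define N0 where "N0 = laplace h 0"
  define N1 where "N1 = laplace h 1"
  define N2 where "N2 = laplace h 2"
  define c where "c p = csqrt (1 + p\<^sup>2)" for p
  define q where "q p = Ln (p + c p)" for p
  define S where "S = {p. Re p > 0}"
  have S: "convex S" "open S" unfolding S_def by (auto simp: convex_halfspace_Re_gt open_halfspace_Re_gt)
  have ODE: "(1 + p\<^sup>2) * N2 p - p * N1 p - of_real (\<nu>\<^sup>2) * N0 p = 0" if "p \<in> S" for p
    using laplace_ODE[OF _ Ka, of p] that unfolding S_def N0_def N1_def N2_def h_def by simp
  have d0: "(N0 has_field_derivative - N1 p) (at p)" if "p \<in> S" for p
    using DERIV_laplace[OF ch M, of p 0] that unfolding N0_def N1_def S_def by simp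
  have d1: "(N1 has_field_derivative - N2 p) (at p)" if "p \<in> S" for p
    using DERIV_laplace[OF ch M, of p 1] that unfolding N1_def N2_def S_def by (simp add: numeral_2_eq_2)
  have np: "1 + p\<^sup>2 \<notin> \<real>\<^sub>\<le>\<^sub>0" if "p \<in> S" for p
  proof
    assume "1 + p\<^sup>2 \<in> \<real>\<^sub>\<le>\<^sub>0"
    then have i: "2 * (Re p * Im p) = 0" and r: "1 + ((Re p)\<^sup>2 - (Im p)\<^sup>2) \<le> 0"
      by (auto simp: complex_nonpos_Reals_iff power2_eq_square)
    from i that have "Im p = 0" by (auto simp: S_def)
    with r show False using zero_le_power2[of "Re p"] by simp
  qed
  have cp: "c p * c p = 1 + p\<^sup>2" for p unfolding c_def by (simp flip: power2_eq_square)
  have c0: "c p \<noteq> 0" if "p \<in> S" for p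
    using np[OF that] unfolding c_def by auto
  have dc: "(c has_field_derivative p / c p) (at p)" if "p \<in> S" for p
  proof -
    have "((\<lambda>p. csqrt (1 + p\<^sup>2)) has_field_derivative inverse (2 * csqrt (1 + p\<^sup>2)) * (2 * p)) (at p)"
      by (rule DERIV_chain2[where f = csqrt and g = "\<lambda>p. 1 + p\<^sup>2", OF has_field_derivative_csqrt[OF np[OF that]]]) (auto intro!: derivative_eq_intros)
    then show ?thesis unfolding c_def[abs_def] by (rule DERIV_cong) (simp add: field_simps)
  qed
  have pc: "Re (p + c p) > 0" if "p \<in> S" for p
  proof -
    have "Re (c p) \<ge> 0" unfolding c_def by (rule Re_csqrt)
    then show ?thesis using that by (simp add: S_def)
  qed
  have dq: "(q has_field_derivative 1 / c p) (at p)" if "p \<in> S" for p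
  proof -
    have n: "p + c p \<notin> \<real>\<^sub>\<le>\<^sub>0" using pc[OF that] by (auto simp: complex_nonpos_Reals_iff)
    have "(q has_field_derivative inverse (p + c p) * (1 + p / c p)) (at p)"
      unfolding q_def by (rule DERIV_chain2[where f = Ln and g = "\<lambda>p. p + c p", OF has_field_derivative_Ln[OF n]])
        (auto intro!: derivative_eq_intros dc that)
    moreover have "inverse (p + c p) * (1 + p / c p) = 1 / c p"
    proof -
      have "p + c p \<noteq> 0" using pc[OF that] by (metis less_irrefl zero_complex.simps(1))
      then show ?thesis using c0[OF that] by (simp add: field_simps)
    qed
    ultimately show ?thesis by simp
  qed
  have dexp: "((\<lambda>p. exp (a * q p)) has_field_derivative exp (a * q p) * (a * (1 / c p))) (at p)" if "p \<in> S" for a p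
    by (rule DERIV_chain2[where f = exp and g = "\<lambda>p. a * q p", OF DERIV_exp DERIV_cmult[OF dq[OF that]]])
  \<comment> \<open>\<open>- N1\<close> is the derivative of \<open>N0\<close> and \<open>c p\<close> is \<open>dp/dq\<close>, so the bracket is the growing component of the solution; \<open>V\<close> is its constant coefficient.\<close>
  define V where "V p = (of_real \<nu> * N0 p - c p * N1 p) * exp (- of_real \<nu> * q p)" for p
  have "(V has_field_derivative 0) (at p)" if p: "p \<in> S" for p
  proof -
    have "(V has_field_derivative
       (of_real \<nu> * (- N1 p) - (p / c p * N1 p + - N2 p * c p)) * exp (- of_real \<nu> * q p)
       + exp (- of_real \<nu> * q p) * (- of_real \<nu> * (1 / c p)) * (of_real \<nu> * N0 p - c p * N1 p)) (at p)"
      unfolding V_def by (intro DERIV_mult DERIV_diff DERIV_cmult dc d0 d1 dexp p)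
    moreover have "(of_real \<nu> * (- N1 p) - (p / c p * N1 p + - N2 p * c p)) * exp (- of_real \<nu> * q p)
       + exp (- of_real \<nu> * q p) * (- of_real \<nu> * (1 / c p)) * (of_real \<nu> * N0 p - c p * N1 p)
       = exp (- of_real \<nu> * q p) / c p * ((c p * c p) * N2 p - p * N1 p - of_real (\<nu>\<^sup>2) * N0 p)"
      using c0[OF p] by (simp add: field_simps power2_eq_square)
    ultimately show ?thesis using ODE[OF p] unfolding cp by simp
  qed
  then obtain v where v: "V p = v" if "p \<in> S" for p
    using has_field_derivative_zero_constant[OF S(1), of V] has_field_derivative_at_within by metis
  have "((\<lambda>r. V (of_real r)) \<longlongrightarrow> 0) at_top"
  proof (rule Lim_null_comparison)
    show "\<forall>\<^sub>F r in at_top. norm (V (of_real r)) \<le> \<nu> * (M / r) + sqrt (1 + r\<^sup>2) * (M / r\<^sup>2)"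
      using eventually_ge_at_top[of 1]
    proof eventually_elim
      case (elim r)
      then have r: "r > 0" "of_real r \<in> S" by (auto simp: S_def)
      have cr: "c (of_real r) = of_real (sqrt (1 + r\<^sup>2))"
      proof -
        have "1 + (complex_of_real r)\<^sup>2 = of_real (1 + r\<^sup>2)" by simp
        then show ?thesis unfolding c_def by (simp only:) (rule of_real_sqrt[symmetric], simp add: add_nonneg_nonneg)
      qed
      have "norm (exp (- of_real \<nu> * q (of_real r))) \<le> 1"
      proof -
        have "q (of_real r) = of_real (ln (r + sqrt (1 + r\<^sup>2)))"
          unfolding q_def cr using r by (simp flip: of_real_add add: Ln_of_real add_pos_nonneg)
        moreover have "ln (r + sqrt (1 + r\<^sup>2)) \<ge> 0" using elim by (intro ln_ge_zero) (auto intro: add_increasing2)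
        ultimately show ?thesis using \<nu> by (simp add: norm_exp_eq_Re)
      qed
      then have "norm (V (of_real r)) \<le> norm (of_real \<nu> * N0 (of_real r) - c (of_real r) * N1 (of_real r)) * 1"
        unfolding V_def norm_mult by (intro mult_left_mono) auto
      also have "\<dots> \<le> norm (of_real \<nu> * N0 (of_real r)) + norm (c (of_real r) * N1 (of_real r))"
        using norm_triangle_ineq4 by simp
      also have "\<dots> = \<nu> * norm (N0 (of_real r)) + sqrt (1 + r\<^sup>2) * norm (N1 (of_real r))"
        unfolding cr norm_mult using \<nu> by (simp add: add_nonneg_nonneg)
      also have "\<dots> \<le> \<nu> * (M / r) + sqrt (1 + r\<^sup>2) * (M / r\<^sup>2)"
        using laplace_bound[OF ch M r(1)] \<nu> unfolding N0_def N1_def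
        by (intro add_mono mult_left_mono) (auto intro: add_nonneg_nonneg)
      finally show ?case .
    qed
    have "((\<lambda>r. \<nu> * M * (1 / r) + M * (sqrt (1 + r\<^sup>2) / r\<^sup>2)) \<longlongrightarrow> \<nu> * M * 0 + M * 0) at_top"
      by (intro tendsto_add tendsto_mult_left) real_asymp+
    then show "((\<lambda>r. \<nu> * (M / r) + sqrt (1 + r\<^sup>2) * (M / r\<^sup>2)) \<longlongrightarrow> 0) at_top" by (simp add: mult_ac)
  qed
  moreover have "\<forall>\<^sub>F r in at_top. V (of_real r) = v"
    using eventually_gt_at_top[of 0] by eventually_elim (rule v, simp add: S_def)
  ultimately have "v = 0" using tendsto_cong[of "\<lambda>r. V (of_real r)" "\<lambda>_. v" at_top 0] by (simp add: tendsto_const_iff)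
  then have cN: "c p * N1 p = of_real \<nu> * N0 p" if "p \<in> S" for p
    using v[OF that] unfolding V_def by simp
  \<comment> \<open>The coefficient of the decaying component.\<close>
  define U where "U p = N0 p * exp (of_real \<nu> * q p)" for p
  have "(U has_field_derivative 0) (at p)" if p: "p \<in> S" for p
  proof -
    have "(U has_field_derivative - N1 p * exp (of_real \<nu> * q p) + exp (of_real \<nu> * q p) * (of_real \<nu> * (1 / c p)) * N0 p) (at p)"
      unfolding U_def by (intro DERIV_mult d0 dexp p)
    moreover have "- N1 p * exp (of_real \<nu> * q p) + exp (of_real \<nu> * q p) * (of_real \<nu> * (1 / c p)) * N0 p
       = exp (of_real \<nu> * q p) / c p * (of_real \<nu> * N0 p - c p * N1 p)"
      using c0[OF p] by (simp add: field_simps)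
    ultimately show ?thesis using cN[OF p] by simp
  qed
  then obtain u where u: "U p = u" if "p \<in> S" for p
    using has_field_derivative_zero_constant[OF S(1), of U] has_field_derivative_at_within by metis
  have "u \<in> \<real>"
  proof -
    have 1: "1 \<in> S" by (simp add: S_def)
    have "N0 1 = of_real (LBINT t:{0<..}. h t * exp (- t))"
      unfolding N0_def laplace_def set_lebesgue_integral_def
      by (subst integral_complex_of_real[symmetric]) (auto intro!: Bochner_Integration.integral_cong simp: scaleR_conv_of_real exp_of_real[symmetric])
    moreover have "c 1 = of_real (sqrt 2)"
      unfolding c_def by (metis of_real_numeral of_real_sqrt one_add_one one_power2 zero_le_numeral)
    then have "q 1 = of_real (ln (1 + sqrt 2))"
      using Ln_of_real[of "1 + sqrt 2"] by (simp add: q_def add_pos_nonneg)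
    ultimately have "U 1 = of_real ((LBINT t:{0<..}. h t * exp (- t)) * exp (\<nu> * ln (1 + sqrt 2)))"
      unfolding U_def by (simp add: exp_of_real[symmetric])
    then show ?thesis using u[OF 1] by (metis Reals_of_real)
  qed
  then obtain w where w: "u = of_real w" by (auto elim: Reals_cases)
  have "csqrt (1 + p\<^sup>2) * laplace h 1 p = of_real (\<nu> * w) * exp (- of_real \<nu> * Ln (p + csqrt (1 + p\<^sup>2)))" if "Re p > 0" for p
  proof -
    have p: "p \<in> S" using that by (simp add: S_def)
    have "N0 p = of_real w * exp (- (of_real \<nu> * q p))"
      using u[OF p] unfolding w U_def by (simp add: exp_minus field_simps)
    then show ?thesis using cN[OF p] unfolding c_def N1_def q_def by simp
  qed
  then show ?thesis by blast
qed

text \<open>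
  The Laplace transform of \<open>J\<close> is evaluated near its singularity \<open>p = \<i>\<close> in two ways. By the Abelian theorem
  \<open>sqrt \<epsilon>\<close> times its value at \<open>\<epsilon> + \<i>\<close> tends to a positive multiple of \<open>cis (C - \<nu> * pi / 2)\<close>. The closed form is
  \<open>exp (- \<nu> * q) / sqrt (1 + p\<^sup>2)\<close> with \<open>q\<close> near \<open>Ln \<i>\<close> and \<open>1 + p\<^sup>2\<close> near \<open>2 * \<i> * \<epsilon>\<close>. Squaring both, which
  avoids branches of the root and the sign of the real constant, and comparing arguments gives \<open>2 * C = - pi / 2\<close> modulo \<open>2 * pi\<close>.
\<close>

lemma phase_constant_cis:
  assumes ang: "Langle \<nu> \<theta>" and C: "((\<lambda>z. \<theta> z - Ls \<nu> z) \<longlongrightarrow> C) at_top"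
  shows "cis (2 * C) = - \<i>"
proof -
  obtain A where A: "A > 0" "(LE \<nu> \<longlongrightarrow> A) at_top" using LE_tendsto[OF \<nu>0] .
  define L where "L = of_real (sqrt A) * cis (C - \<nu> * (pi / 2))"
  have L: "((\<lambda>t. of_real (sqrt t) * LH t) \<longlongrightarrow> L) at_top"
    unfolding L_def by (rule LH_lim[OF ang C A(2)])
  obtain B where B: "\<forall>t>0. norm (of_real (sqrt t) * LH t) \<le> B" using LH_bounded[OF L] by blast
  obtain K where K: "\<forall>t>0. \<bar>besselJ_zderiv \<nu> t / t\<bar> \<le> K" using zderiv_bounded[OF L] by blast
  define h where "h t = besselJ \<nu> t / t" for t
  obtain u :: real where u: "\<And>p. Re p > 0 \<Longrightarrow>
     csqrt (1 + p\<^sup>2) * laplace h 1 p = of_real (\<nu> * u) * exp (- of_real \<nu> * Ln (p + csqrt (1 + p\<^sup>2)))"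
    using laplace_besselJ_closed_form[OF K] unfolding h_def[abs_def] by blast
  define G where "G = Gamma (1 / 2 :: real)"
  have G: "G > 0" by (simp add: G_def)
  define pe where "pe \<epsilon> = of_real \<epsilon> + \<i>" for \<epsilon> :: real
  define Z where "Z \<epsilon> = of_real (sqrt \<epsilon>) * laplace h 1 (pe \<epsilon>)" for \<epsilon>
  \<comment> \<open>The transform of \<open>J - \<i> * J'\<close> is \<open>1 - \<i> * p\<close> times that of \<open>J\<close>, and \<open>1 - \<i> * p = 2 - \<i> * \<epsilon>\<close> for \<open>p = \<epsilon> + \<i>\<close>.\<close>
  have e: "(LBINT t:{0<..}. exp (- of_real (\<epsilon> * t)) * LH t) = (2 - \<i> * of_real \<epsilon>) * laplace h 1 (pe \<epsilon>)" if eps: "\<epsilon> > 0" for \<epsilon>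
  proof -
    have R: "Re (pe \<epsilon>) > 0" using eps by (simp add: pe_def)
    note l = laplace_deriv_besselJ[OF R K, folded h_def[abs_def]]
    have "(LBINT t:{0<..}. exp (- of_real (\<epsilon> * t)) * LH t) =
       (LBINT t:{0<..}. exp (- pe \<epsilon> * complex_of_real t) * complex_of_real (besselJ \<nu> t) - \<i> * (exp (- pe \<epsilon> * complex_of_real t) * complex_of_real (besselJ_zderiv \<nu> t / t)))"
    proof (rule set_lebesgue_integral_cong)
      show "\<forall>t. t \<in> {0<..} \<longrightarrow> exp (- of_real (\<epsilon> * t)) * LH t =
        exp (- pe \<epsilon> * complex_of_real t) * complex_of_real (besselJ \<nu> t) - \<i> * (exp (- pe \<epsilon> * complex_of_real t) * complex_of_real (besselJ_zderiv \<nu> t / t))"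
      proof (intro allI impI)
        fix t :: real
        have "exp (- pe \<epsilon> * complex_of_real t) = exp (- of_real (\<epsilon> * t)) * exp (- (\<i> * of_real t))"
          by (simp add: pe_def algebra_simps flip: exp_add)
        then show "exp (- of_real (\<epsilon> * t)) * LH t =
          exp (- pe \<epsilon> * complex_of_real t) * complex_of_real (besselJ \<nu> t) - \<i> * (exp (- pe \<epsilon> * complex_of_real t) * complex_of_real (besselJ_zderiv \<nu> t / t))"
          unfolding LH_def by (simp add: algebra_simps)
      qed
    qed simp
    also have "\<dots> = laplace h 1 (pe \<epsilon>) - \<i> * (pe \<epsilon> * laplace h 1 (pe \<epsilon>))"
      by (subst set_integral_diff(2)[OF l(3) set_integrable_mult_right[OF l(2)]]) (simp only: set_integral_mult_right l(1,4))
    also have "\<dots> = (2 - \<i> * of_real \<epsilon>) * laplace h 1 (pe \<epsilon>)"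
      by (simp add: pe_def algebra_simps)
    finally show ?thesis .
  qed
  have "((\<lambda>\<epsilon>. of_real (sqrt \<epsilon>) * (LBINT t:{0<..}. exp (- of_real (\<epsilon> * t)) * LH t)) \<longlongrightarrow> of_real G * L) (at_right 0)"
    unfolding G_def by (rule abelian_sqrt[OF continuous_on_LH _ L]) (use B in blast)
  moreover have "\<forall>\<^sub>F \<epsilon> in at_right 0. of_real (sqrt \<epsilon>) * (LBINT t:{0<..}. exp (- of_real (\<epsilon> * t)) * LH t) = (2 - \<i> * of_real \<epsilon>) * Z \<epsilon>"
    using eventually_at_right_less[of 0] by eventually_elim (simp only: e Z_def mult.left_commute)
  ultimately have "((\<lambda>\<epsilon>. (2 - \<i> * of_real \<epsilon>) * Z \<epsilon>) \<longlongrightarrow> of_real G * L) (at_right 0)"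
    by (rule Lim_transform_eventually)
  moreover have "((\<lambda>\<epsilon>. 2 - \<i> * complex_of_real \<epsilon>) \<longlongrightarrow> 2 - \<i> * of_real 0) (at_right 0)"
    by (intro tendsto_intros)
  ultimately have "((\<lambda>\<epsilon>. ((2 - \<i> * of_real \<epsilon>) * Z \<epsilon>) / (2 - \<i> * complex_of_real \<epsilon>)) \<longlongrightarrow> (of_real G * L) / (2 - \<i> * of_real 0)) (at_right 0)"
    by (rule tendsto_divide) simp
  moreover have "((2 - \<i> * of_real \<epsilon>) * Z \<epsilon>) / (2 - \<i> * complex_of_real \<epsilon>) = Z \<epsilon>" for \<epsilon>
    by (rule nonzero_mult_div_cancel_left) (simp add: complex_eq_iff)
  ultimately have Z: "(Z \<longlongrightarrow> of_real G * L / 2) (at_right 0)" by simp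
  have lim1: "((\<lambda>\<epsilon>. (Z \<epsilon>)\<^sup>2 * (of_real \<epsilon> + 2 * \<i>)) \<longlongrightarrow> (of_real G * L / 2)\<^sup>2 * (of_real 0 + 2 * \<i>)) (at_right 0)"
    by (intro tendsto_intros Z)
  have lim2: "((\<lambda>\<epsilon>. of_real ((\<nu> * u)\<^sup>2) * (exp (- of_real \<nu> * Ln (pe \<epsilon> + csqrt (1 + (pe \<epsilon>)\<^sup>2))))\<^sup>2)
     \<longlongrightarrow> of_real ((\<nu> * u)\<^sup>2) * (exp (- of_real \<nu> * Ln \<i>))\<^sup>2) (at_right 0)"
  proof (intro tendsto_intros)
    have pe: "(pe \<longlongrightarrow> of_real 0 + \<i>) (at_right 0)" unfolding pe_def by (intro tendsto_intros)
    have "((\<lambda>\<epsilon>. csqrt (1 + (pe \<epsilon>)\<^sup>2)) \<longlongrightarrow> 0) (at_right 0)"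
    proof (rule tendsto_norm_zero_cancel)
      have "((\<lambda>\<epsilon>. sqrt (norm (1 + (pe \<epsilon>)\<^sup>2))) \<longlongrightarrow> sqrt (norm (1 + (of_real 0 + \<i>)\<^sup>2))) (at_right 0)"
        by (intro tendsto_intros pe)
      then show "((\<lambda>\<epsilon>. norm (csqrt (1 + (pe \<epsilon>)\<^sup>2))) \<longlongrightarrow> 0) (at_right 0)" by (simp add: norm_csqrt)
    qed
    from tendsto_add[OF pe this] show "((\<lambda>\<epsilon>. pe \<epsilon> + csqrt (1 + (pe \<epsilon>)\<^sup>2)) \<longlongrightarrow> \<i>) (at_right 0)" by simp
    show "\<i> \<notin> \<real>\<^sub>\<le>\<^sub>0" by (simp add: complex_nonpos_Reals_iff)
  qed
  have ev: "\<forall>\<^sub>F \<epsilon> in at_right 0. of_real ((\<nu> * u)\<^sup>2) * (exp (- of_real \<nu> * Ln (pe \<epsilon> + csqrt (1 + (pe \<epsilon>)\<^sup>2))))\<^sup>2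
      = (Z \<epsilon>)\<^sup>2 * (of_real \<epsilon> + 2 * \<i>)"
    unfolding eventually_at_right_field
  proof (intro exI[of _ 1] conjI allI impI)
    fix \<epsilon> :: real assume eps: "0 < \<epsilon>" "\<epsilon> < 1"
    have R: "Re (pe \<epsilon>) > 0" using eps by (simp add: pe_def)
    have "of_real ((\<nu> * u)\<^sup>2) * (exp (- of_real \<nu> * Ln (pe \<epsilon> + csqrt (1 + (pe \<epsilon>)\<^sup>2))))\<^sup>2
      = (csqrt (1 + (pe \<epsilon>)\<^sup>2) * laplace h 1 (pe \<epsilon>))\<^sup>2"
      unfolding u[OF R] by (simp add: power_mult_distrib)
    also have "\<dots> = (1 + (pe \<epsilon>)\<^sup>2) * (laplace h 1 (pe \<epsilon>))\<^sup>2"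
      by (simp add: power_mult_distrib)
    also have "\<dots> = (Z \<epsilon>)\<^sup>2 * (of_real \<epsilon> + 2 * \<i>)"
    proof -
      have fac: "1 + (pe \<epsilon>)\<^sup>2 = of_real \<epsilon> * (of_real \<epsilon> + 2 * \<i>)"
        by (simp add: pe_def power2_eq_square algebra_simps)
      have "complex_of_real \<epsilon> = (of_real (sqrt \<epsilon>))\<^sup>2" using eps by (simp flip: of_real_power)
      then show ?thesis unfolding Z_def fac by (simp add: power_mult_distrib mult_ac)
    qed
    finally show "of_real ((\<nu> * u)\<^sup>2) * (exp (- of_real \<nu> * Ln (pe \<epsilon> + csqrt (1 + (pe \<epsilon>)\<^sup>2))))\<^sup>2
      = (Z \<epsilon>)\<^sup>2 * (of_real \<epsilon> + 2 * \<i>)" .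
  qed simp
  have eq: "(of_real G * L / 2)\<^sup>2 * (of_real 0 + 2 * \<i>) = of_real ((\<nu> * u)\<^sup>2) * (exp (- of_real \<nu> * Ln \<i>))\<^sup>2"
    by (rule tendsto_unique[OF trivial_limit_at_right_real lim1 Lim_transform_eventually[OF lim2 ev]])
  have x1: "(exp (- of_real \<nu> * Ln \<i>))\<^sup>2 = cis (- (\<nu> * pi))"
  proof -
    have "(exp (- of_real \<nu> * Ln \<i>))\<^sup>2 = exp (2 * (- of_real \<nu> * Ln \<i>))" by (rule exp_double[symmetric])
    also have "2 * (- of_real \<nu> * Ln \<i>) = \<i> * of_real (- (\<nu> * pi))" by simp
    finally show ?thesis by (simp add: cis_conv_exp)
  qed
  have x2: "L\<^sup>2 = of_real A * (cis (2 * C) * cis (- (\<nu> * pi)))"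
  proof -
    have "L\<^sup>2 = (of_real (sqrt A))\<^sup>2 * (cis (C - \<nu> * (pi / 2)) * cis (C - \<nu> * (pi / 2)))"
      unfolding L_def by (simp add: power2_eq_square mult_ac)
    also have "(complex_of_real (sqrt A))\<^sup>2 = of_real A" using A by (simp flip: of_real_power)
    also have "cis (C - \<nu> * (pi / 2)) * cis (C - \<nu> * (pi / 2)) = cis (2 * C) * cis (- (\<nu> * pi))"
      by (simp add: cis_mult algebra_simps)
    finally show ?thesis .
  qed
  have "of_real (G\<^sup>2 * A / 2) * \<i> * cis (2 * C) * cis (- (\<nu> * pi)) = of_real ((\<nu> * u)\<^sup>2) * cis (- (\<nu> * pi))"
    using eq unfolding power_mult_distrib power_divide x1 x2 by (simp add: mult_ac)
  then have *: "of_real (G\<^sup>2 * A / 2) * \<i> * cis (2 * C) = of_real ((\<nu> * u)\<^sup>2)" by (simp, simp add: mult.assoc)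
  then have "norm (of_real (G\<^sup>2 * A / 2) * \<i> * cis (2 * C)) = norm (complex_of_real ((\<nu> * u)\<^sup>2))" by simp
  then have "G\<^sup>2 * A / 2 = (\<nu> * u)\<^sup>2" using A G by (simp add: norm_mult norm_power power_mult_distrib)
  with * have "of_real (G\<^sup>2 * A / 2) * (\<i> * cis (2 * C)) = complex_of_real (G\<^sup>2 * A / 2) * 1" by (simp add: mult.assoc)
  moreover have "complex_of_real (G\<^sup>2 * A / 2) \<noteq> 0" using A G by simp
  ultimately have "\<i> * cis (2 * C) = 1" by (simp only: mult_cancel_left) simp
  then have "- \<i> * (\<i> * cis (2 * C)) = - \<i>" by simp
  then show ?thesis by simp
qed

text \<open>
  With \<open>m = sqrt (b\<^sup>2 - \<nu>\<^sup>2)\<close>, the accumulated phase at \<open>b\<close> is at most \<open>m ^ 3 / (2 * \<nu>\<^sup>2)\<close> and the correction contains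
  \<open>\<nu>\<^sup>2 / m ^ 3\<close>. The choice \<open>m ^ 3 = \<nu>\<^sup>2\<close> balances the two, so both are bounded uniformly in \<open>\<nu>\<close>.
\<close>

lemma zero_free_end_values:
  "0 \<le> Ls \<nu> (zero_free_end \<nu>)" "Ls \<nu> (zero_free_end \<nu>) \<le> 1 / 2" "2 * L\<delta> \<nu> (zero_free_end \<nu>) \<le> 2 / 3"
proof -
  define m where "m = \<nu> powr (2/3)"
  define b where "b = zero_free_end \<nu>"
  have m1: "m \<ge> 1" using \<nu> unfolding m_def by (simp add: ge_one_powr_ge_zero)
  have b2: "b\<^sup>2 = \<nu>\<^sup>2 + m\<^sup>2" by (simp add: b_def zero_free_end_def m_def)
  have bn: "b > \<nu>" unfolding b_def by (rule zero_free_end_gt[OF \<nu>0])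
  have m3: "m ^ 3 = \<nu>\<^sup>2"
  proof -
    have "m ^ 3 = \<nu> powr (2 / 3 * 3)" unfolding m_def powr_powr[symmetric] using \<nu>0 by (simp add: powr_realpow)
    then show ?thesis using \<nu>0 by (simp add: powr_numeral)
  qed
  have D: "sqrt (LD \<nu> b) = m" unfolding LD_def[OF \<nu>0] b2 using m1 by simp
  have t: "b / \<nu> > 1" using bn \<nu>0 by simp
  show "0 \<le> Ls \<nu> (zero_free_end \<nu>)"
    using Debye_phase_pos[OF t] \<nu>0 unfolding Ls_def[OF \<nu>0] b_def by simp
  have "Debye_phase (b / \<nu>) \<le> (b / \<nu> - 1) * sqrt ((b / \<nu>)\<^sup>2 - 1)"
  proof -
    define T where "T = b / \<nu>"
    have T: "T > 1" using t by (simp add: T_def)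
    obtain z where z: "1 < z" "z < T" "Debye_phase T - Debye_phase 1 = (T - 1) * (sqrt (z\<^sup>2 - 1) / z)"
    proof -
      have "\<exists>l z. 1 < z \<and> z < T \<and> DERIV Debye_phase z :> l \<and> Debye_phase T - Debye_phase 1 = (T - 1) * l"
      proof (rule MVT[OF T])
        show "continuous_on {1..T} Debye_phase" by (rule continuous_on_subset[OF continuous_on_Debye_phase]) auto
        show "Debye_phase differentiable (at x)" if "1 < x" "x < T" for x
          using DERIV_Debye_phase[OF that(1)] real_differentiable_def by blast
      qed
      then obtain l z where lz: "1 < z" "z < T" "DERIV Debye_phase z :> l" "Debye_phase T - Debye_phase 1 = (T - 1) * l" by blast
      moreover have "l = sqrt (z\<^sup>2 - 1) / z" using DERIV_unique[OF lz(3) DERIV_Debye_phase[OF lz(1)]] .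
      ultimately show thesis using that by blast
    qed
    have "z\<^sup>2 \<le> T\<^sup>2" using z by (intro power_mono) auto
    then have s: "sqrt (z\<^sup>2 - 1) \<le> sqrt (T\<^sup>2 - 1)" by simp
    have "sqrt (z\<^sup>2 - 1) / z \<le> sqrt (z\<^sup>2 - 1) / 1" using z by (intro divide_left_mono) (auto intro: less_imp_le sq_gt_1)
    then have "sqrt (z\<^sup>2 - 1) / z \<le> sqrt (T\<^sup>2 - 1)" using order_trans[OF _ s] by simp
    then have "(T - 1) * (sqrt (z\<^sup>2 - 1) / z) \<le> (T - 1) * sqrt (T\<^sup>2 - 1)" using T by (intro mult_left_mono) auto
    then show ?thesis using z(3) Debye_phase_1 unfolding T_def[symmetric] by simp
  qed
  also have "sqrt ((b / \<nu>)\<^sup>2 - 1) = m / \<nu>"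
  proof -
    have "(b / \<nu>)\<^sup>2 - 1 = (m / \<nu>)\<^sup>2" using \<nu>0 by (simp add: power_divide b2 field_simps)
    then show ?thesis using m1 \<nu>0 by simp
  qed
  also have "(b / \<nu> - 1) * (m / \<nu>) \<le> (m / \<nu>)\<^sup>2 / 2 * (m / \<nu>)"
  proof (rule mult_right_mono)
    have "(b / \<nu>)\<^sup>2 = 1 + (m / \<nu>)\<^sup>2" using \<nu>0 by (simp add: power_divide b2 field_simps)
    moreover have "x - 1 \<le> y / 2" if "x\<^sup>2 = 1 + y" for x y :: real
      using that zero_le_power2[of "x - 1"] by (simp add: power2_diff)
    ultimately show "b / \<nu> - 1 \<le> (m / \<nu>)\<^sup>2 / 2" by blast
  qed (use m1 \<nu>0 in simp)
  finally have "\<nu> * Debye_phase (b / \<nu>) \<le> \<nu> * ((m / \<nu>)\<^sup>2 / 2 * (m / \<nu>))" using \<nu>0 by (intro mult_left_mono) auto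
  also have "\<nu> * ((m / \<nu>)\<^sup>2 / 2 * (m / \<nu>)) = m ^ 3 / (2 * \<nu>\<^sup>2)" using \<nu>0 by (simp add: field_simps eval_nat_numeral)
  also have "\<dots> = 1 / 2" unfolding m3 using \<nu>0 by simp
  finally show "Ls \<nu> (zero_free_end \<nu>) \<le> 1 / 2" unfolding Ls_def[OF \<nu>0] b_def .
  have "L\<delta> \<nu> b = 1 / (8 * m) + 5 / 24" unfolding L\<delta>_def[OF \<nu>0] D m3 using \<nu>0 by simp
  moreover have "1 / (8 * m) \<le> 1 / 8" using m1 by (simp add: field_simps)
  ultimately show "2 * L\<delta> \<nu> (zero_free_end \<nu>) \<le> 2 / 3" unfolding b_def[symmetric] by simp
qed

text \<open>
  \<open>phase_constant_cis\<close> determines the limit modulo \<open>pi\<close>. At the end of the zero-free interval the angle lies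
  between \<open>- pi / 2\<close> and \<open>pi / 2\<close>, and by the preceding bounds the limit differs from it by at most 2/3; this leaves
  only \<open>- pi / 4\<close>.
\<close>

lemma phase_constant:
  assumes ang: "Langle \<nu> \<theta>"
  shows "((\<lambda>z. \<theta> z - Ls \<nu> z) \<longlongrightarrow> - pi / 4) at_top"
    and "\<And>z. z \<ge> zero_free_end \<nu> \<Longrightarrow> \<theta> z - Ls \<nu> z \<le> - pi / 4"
proof -
  define b where "b = zero_free_end \<nu>"
  obtain C where C: "((\<lambda>z. \<theta> z - Ls \<nu> z) \<longlongrightarrow> C) at_top"
    "\<And>z. z \<ge> b \<Longrightarrow> \<theta> z - Ls \<nu> z \<le> C" "\<And>z. z \<ge> b \<Longrightarrow> C \<le> \<theta> z - Ls \<nu> z + 2 * L\<delta> \<nu> z"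
    using Langle_tendsto[OF \<nu>0 ang] unfolding b_def by metis
  have tb: "- pi / 2 < \<theta> b" "\<theta> b < pi / 2" using ang unfolding Langle_def[OF \<nu>0] b_def by auto
  note v = zero_free_end_values[folded b_def]
  have "C < pi / 2 + 2 / 3" using C(3)[of b] tb v by simp
  moreover have "C > - pi / 2 - 1 / 2" using C(2)[of b] tb v by simp
  moreover have "cis (2 * C) = - \<i>" by (rule phase_constant_cis[OF ang C(1)])
  then have "cis (2 * C) * cis (pi / 2) = 1" by (simp add: cis_pi_half)
  then have "cis (2 * C + pi / 2) = 1" by (simp only: cis_mult)
  then have "cos (2 * C + pi / 2) = 1" by (simp add: complex_eq_iff)
  then obtain n :: int where n: "2 * C + pi / 2 = of_int n * 2 * pi" using cos_one_2pi_int by blast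
  ultimately have "n = 0"
  proof -
    assume u: "C < pi / 2 + 2 / 3" and l: "C > - pi / 2 - 1 / 2"
    have "of_int n * 2 * pi < 2 * pi" using u n pi_gt3 by linarith
    then have "real_of_int n < 1" by simp
    moreover have "(of_int n + 1) * (2 * pi) > 0" using l n pi_gt3 by (simp add: algebra_simps)
    then have "real_of_int n > - 1" by (simp add: zero_less_mult_iff)
    ultimately show ?thesis by linarith
  qed
  then have "C = - pi / 4" using n by simp
  with C show "((\<lambda>z. \<theta> z - Ls \<nu> z) \<longlongrightarrow> - pi / 4) at_top"
    "\<And>z. z \<ge> zero_free_end \<nu> \<Longrightarrow> \<theta> z - Ls \<nu> z \<le> - pi / 4" by (auto simp: b_def)
qed

lemma Langle_DERIV_pos:
  assumes "Langle \<nu> \<theta>" "z > \<nu>"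
  shows "\<exists>d. (\<theta> has_real_derivative d) (at z) \<and> d > 0"
proof -
  have "(\<theta> has_real_derivative L\<sigma> \<nu> z * (1 + L\<psi> \<nu> z * (cos (\<theta> z))\<^sup>2)) (at z)"
    using assms unfolding Langle_def[OF \<nu>0] by blast
  moreover have "L\<sigma> \<nu> z * (1 + L\<psi> \<nu> z * (cos (\<theta> z))\<^sup>2) > 0"
    using L\<sigma>_pos[OF \<nu>0 assms(2)] L\<psi>_pos[OF \<nu>0 assms(2)] by (intro mult_pos_pos add_pos_nonneg) auto
  ultimately show ?thesis by blast
qed

lemma Langle_strict_mono:
  assumes "Langle \<nu> \<theta>" "\<nu> < z1" "z1 < z2"
  shows "\<theta> z1 < \<theta> z2"
  by (rule DERIV_pos_imp_increasing[OF assms(3)]) (use Langle_DERIV_pos[OF assms(1)] assms in force)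

lemma besselJ_zero_iff_phase:
  assumes "Langle \<nu> \<theta>" "z > \<nu>"
  shows "besselJ \<nu> z = 0 \<longleftrightarrow> cos (\<theta> z) = 0"
proof -
  have "Lr \<nu> z * besselJ \<nu> z = sqrt (LE \<nu> z) * cos (\<theta> z)"
    using assms unfolding Langle_def[OF \<nu>0] Ly_def[OF \<nu>0] by blast
  then show ?thesis using Lr_pos[OF \<nu>0 assms(2)] LE_pos[OF \<nu>0 assms(2)] by auto
qed

text \<open>
  The angle increases from below \<open>pi / 2\<close> to infinity, and the zeros beyond \<open>\<nu>\<close> are the points where it is an odd
  multiple of \<open>pi / 2\<close>. As there are no zeros before the end of the zero-free interval, this enumerates all of them.
\<close>

lemma besselJ_zero_phase:
  assumes ang: "Langle \<nu> \<theta>" and k: "k \<ge> 1"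
  shows "besselJ_zero \<nu> k > zero_free_end \<nu> \<and> \<theta> (besselJ_zero \<nu> k) = (real k - 1 / 2) * pi"
proof -
  define b where "b = zero_free_end \<nu>"
  have b: "b > \<nu>" unfolding b_def by (rule zero_free_end_gt[OF \<nu>0])
  have tb: "- pi / 2 < \<theta> b" "\<theta> b < pi / 2" using ang unfolding Langle_def[OF \<nu>0] b_def by auto
  have mono: "\<theta> z1 < \<theta> z2" if "b \<le> z1" "z1 < z2" for z1 z2
    by (rule Langle_strict_mono[OF ang]) (use that b in auto)
  have c\<theta>: "continuous_on {b..w} \<theta>" for w
    by (intro continuous_at_imp_continuous_on ballI) (metis Langle_DERIV_pos[OF ang] b DERIV_isCont atLeastAtMost_iff order_less_le_trans)
  have inf: "filterlim \<theta> at_top at_top"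
  proof -
    have "filterlim (\<lambda>z. ((\<theta> z - Ls \<nu> z) + (Ls \<nu> z - z)) + z) at_top at_top"
      by (rule filterlim_tendsto_add_at_top[OF tendsto_add[OF phase_constant(1)[OF ang] Ls_asymp] filterlim_ident])
    then show ?thesis by simp
  qed
  have "\<exists>z>b. \<theta> z = (real m - 1 / 2) * pi" if m: "m \<ge> 1" for m :: nat
  proof -
    have "(real m - 1 / 2) * pi \<ge> (1 / 2) * pi" using m by (intro mult_right_mono) auto
    then have lt: "\<theta> b < (real m - 1 / 2) * pi" using tb by linarith
    obtain w where w: "w \<ge> b" "\<theta> w \<ge> (real m - 1 / 2) * pi"
    proof -
      have "\<forall>\<^sub>F z in at_top. (real m - 1 / 2) * pi \<le> \<theta> z \<and> b \<le> z"
        by (intro eventually_conj inf[unfolded filterlim_at_top, rule_format] eventually_ge_at_top)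
      from eventually_happens[OF this] show thesis using that by auto
    qed
    obtain z where "b \<le> z" "z \<le> w" "\<theta> z = (real m - 1 / 2) * pi"
      using IVT'[of \<theta> b "(real m - 1 / 2) * pi" w] lt w c\<theta> by auto
    moreover have "z \<noteq> b" using lt calculation by auto
    ultimately show ?thesis by (intro exI[of _ z]) auto
  qed
  then obtain Z :: "nat \<Rightarrow> real" where Z: "\<And>m. m \<ge> 1 \<Longrightarrow> Z m > b \<and> \<theta> (Z m) = (real m - 1 / 2) * pi" by metis
  have Zmono: "Z m < Z n" if "1 \<le> m" "m < n" for m n
  proof (rule ccontr)
    assume "\<not> Z m < Z n"
    then have "\<theta> (Z n) \<le> \<theta> (Z m)" using mono[of "Z n" "Z m"] Z[of n] that by (cases "Z n = Z m") auto
    moreover have "\<theta> (Z m) < \<theta> (Z n)" using Z[of m] Z[of n] that by simp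
    ultimately show False by simp
  qed
  have zeros: "0 < z \<and> besselJ \<nu> z = 0 \<longleftrightarrow> (\<exists>m\<ge>1. z = Z m)" for z
  proof
    assume z: "0 < z \<and> besselJ \<nu> z = 0"
    then have zb: "z > b" using besselJ_pos_initial[OF \<nu>0, of z] unfolding b_def by force
    then have "cos (\<theta> z) = 0" using besselJ_zero_iff_phase[OF ang, of z] z b by simp
    then obtain i :: int where i: "\<theta> z = of_int i * pi + pi / 2" using cos_zero_iff_int2 by blast
    have "\<theta> z > - pi / 2" using mono[of b z] zb tb by simp
    then have "(of_int i + 1) * pi > 0" using i by (simp add: algebra_simps)
    then have "real_of_int i + 1 > 0" by (simp add: zero_less_mult_iff)
    then have i0: "i \<ge> 0" by linarith
    define m where "m = nat i + 1"
    have m: "m \<ge> 1" "\<theta> z = (real m - 1 / 2) * pi" using i i0 by (auto simp: m_def algebra_simps)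
    have "z = Z m"
      using mono[of z "Z m"] mono[of "Z m" z] Z[OF m(1)] m(2) zb by (cases z "Z m" rule: linorder_cases) auto
    then show "\<exists>m\<ge>1. z = Z m" using m(1) by blast
  next
    assume "\<exists>m\<ge>1. z = Z m"
    then obtain m where m: "m \<ge> 1" "z = Z m" by blast
    have "cos (\<theta> z) = 0" unfolding cos_zero_iff_int2
      using Z[OF m(1)] m by (intro exI[of _ "int m - 1"]) (simp add: algebra_simps)
    then show "0 < z \<and> besselJ \<nu> z = 0" using besselJ_zero_iff_phase[OF ang, of z] Z[OF m(1)] m(2) b \<nu>0 by simp
  qed
  have card: "card {w. 0 < w \<and> w \<le> Z m \<and> besselJ \<nu> w = 0} = m" if m: "m \<ge> 1" for m
  proof -
    have "{w. 0 < w \<and> w \<le> Z m \<and> besselJ \<nu> w = 0} = Z ` {1..m}"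
    proof (intro equalityI subsetI)
      fix w assume "w \<in> {w. 0 < w \<and> w \<le> Z m \<and> besselJ \<nu> w = 0}"
      then obtain n where n: "n \<ge> 1" "w = Z n" "Z n \<le> Z m" using zeros[of w] by auto
      then have "n \<le> m" using Zmono[of m n] m by force
      then show "w \<in> Z ` {1..m}" using n by auto
    next
      fix w assume "w \<in> Z ` {1..m}"
      then obtain n where n: "1 \<le> n" "n \<le> m" "w = Z n" by auto
      then have "Z n \<le> Z m" using Zmono[of n m] by (cases "n = m") auto
      then show "w \<in> {w. 0 < w \<and> w \<le> Z m \<and> besselJ \<nu> w = 0}" using zeros[of w] n by auto
    qed
    moreover have "inj_on Z {1..m}"
      by (rule linorder_inj_onI') (use Zmono in force)
    ultimately show ?thesis by (simp add: card_image)
  qed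
  have "besselJ_zero \<nu> k = Z k"
    unfolding besselJ_zero_def
  proof (rule the_equality)
    show "0 < Z k \<and> besselJ \<nu> (Z k) = 0 \<and> card {w. 0 < w \<and> w \<le> Z k \<and> besselJ \<nu> w = 0} = k"
      using zeros[of "Z k"] card[OF k] k by blast
    fix z assume z: "0 < z \<and> besselJ \<nu> z = 0 \<and> card {w. 0 < w \<and> w \<le> z \<and> besselJ \<nu> w = 0} = k"
    then obtain m where m: "m \<ge> 1" "z = Z m" using zeros[of z] by blast
    then show "z = Z k" using card[OF m(1)] z by simp
  qed
  then show ?thesis using Z[OF k] by (simp add: b_def)
qed

end

section \<open>The expansion of the zeros\<close>

text \<open>
  The inverse of \<open>Debye_phase\<close>, expressed through \<open>f_fun\<close>.
\<close>

definition phase_inv :: "real \<Rightarrow> real" where "phase_inv p = f_fun (pi / p)"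

lemma phase_inv_props:
  assumes "p > 0"
  shows "phase_inv p > 1" "Debye_phase (phase_inv p) = p"
  using f_fun_props[of "pi / p"] assms by (auto simp: phase_inv_def)

lemma phase_inv_Debye: "t > 1 \<Longrightarrow> phase_inv (Debye_phase t) = t"
  unfolding phase_inv_def by (rule f_fun_left_inv)

lemma DERIV_phase_inv:
  assumes p: "p > 0"
  shows "(phase_inv has_real_derivative phase_inv p / sqrt ((phase_inv p)\<^sup>2 - 1)) (at p)"
proof -
  define t where "t = f_fun (pi / p)"
  have t: "t > 1" "Debye_phase t = p" using phase_inv_props[OF p] by (auto simp: t_def phase_inv_def)
  have d: "(f_fun has_real_derivative - (Debye_phase t)\<^sup>2 * t / (pi * sqrt (t\<^sup>2 - 1))) (at (pi / p))"
    unfolding t_def by (rule DERIV_f_fun) (use p in simp)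
  have dp: "((\<lambda>p. pi / p) has_real_derivative - (pi / p\<^sup>2)) (at p)"
    using p by (auto intro!: derivative_eq_intros simp: power2_eq_square)
  have "(phase_inv has_real_derivative (- (Debye_phase t)\<^sup>2 * t / (pi * sqrt (t\<^sup>2 - 1))) * (- (pi / p\<^sup>2))) (at p)"
    unfolding phase_inv_def[abs_def] by (rule DERIV_chain2[OF d dp])
  moreover have "(- (Debye_phase t)\<^sup>2 * t / (pi * sqrt (t\<^sup>2 - 1))) * (- (pi / p\<^sup>2)) = t / sqrt (t\<^sup>2 - 1)"
    unfolding t(2) using p by (simp add: field_simps)
  ultimately show ?thesis by (simp add: t_def phase_inv_def)
qed

lemma DERIV_phase_inv':
  assumes p: "p > 0"
  shows "((\<lambda>p. phase_inv p / sqrt ((phase_inv p)\<^sup>2 - 1)) has_real_derivative - (phase_inv p / sqrt ((phase_inv p)\<^sup>2 - 1) ^ 4)) (at p)"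
proof -
  define t where "t = phase_inv p"
  define q where "q = sqrt (t\<^sup>2 - 1)"
  have t: "t > 1" using phase_inv_props[OF p] by (simp add: t_def)
  have q: "q > 0" "q * q = t\<^sup>2 - 1" using sq_gt_1[OF t] by (auto simp: q_def)
  have "((\<lambda>t. t / sqrt (t\<^sup>2 - 1)) has_real_derivative (1 * q - t * (t / q)) / (q * q)) (at t)"
    unfolding q_def by (rule DERIV_divide[OF DERIV_ident DERIV_sqrt_sq_minus_1[OF t]]) (use q in \<open>simp add: q_def\<close>)
  from DERIV_chain2[where f="\<lambda>t. t / sqrt (t\<^sup>2 - 1)" and g=phase_inv, OF this[unfolded t_def] DERIV_phase_inv[OF p]]
  have "((\<lambda>p. phase_inv p / sqrt ((phase_inv p)\<^sup>2 - 1)) has_real_derivative (1 * q - t * (t / q)) / (q * q) * (t / q)) (at p)"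
    unfolding t_def[symmetric] q_def[symmetric] .
  moreover have "(1 * q - t * (t / q)) / (q * q) * (t / q) = - (t / q ^ 4)"
  proof -
    have "1 * q - t * (t / q) = (q * q - t\<^sup>2) / q" using q(1) by (simp add: field_simps power2_eq_square)
    then have "1 * q - t * (t / q) = - 1 / q" using q(2) by simp
    then show ?thesis using q(1) by (simp add: eval_nat_numeral)
  qed
  ultimately show ?thesis by (simp add: t_def q_def)
qed

lemma phase_inv_Taylor:
  assumes p0: "p0 > 0" and p: "0 < p" "p < p0"
  obtains \<xi> where "p < \<xi>" "\<xi> < p0"
    "phase_inv p = phase_inv p0 + phase_inv p0 / sqrt ((phase_inv p0)\<^sup>2 - 1) * (p - p0)
      - phase_inv \<xi> / sqrt ((phase_inv \<xi>)\<^sup>2 - 1) ^ 4 / 2 * (p - p0)\<^sup>2"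
proof -
  define diff :: "nat \<Rightarrow> real \<Rightarrow> real" where
    "diff m = (if m = 0 then phase_inv else if m = 1 then (\<lambda>p. phase_inv p / sqrt ((phase_inv p)\<^sup>2 - 1))
       else (\<lambda>p. - (phase_inv p / sqrt ((phase_inv p)\<^sup>2 - 1) ^ 4)))" for m
  have D: "DERIV (diff m) t :> diff (Suc m) t" if "m < 2" "p \<le> t" "t \<le> p0" for m t
  proof -
    have t: "t > 0" using that p by simp
    have "m = 0 \<or> m = 1" using that(1) by auto
    then show ?thesis using DERIV_phase_inv[OF t] DERIV_phase_inv'[OF t] by (auto simp: diff_def)
  qed
  have "\<exists>t. (if p < p0 then p < t \<and> t < p0 else p0 < t \<and> t < p) \<and>
      phase_inv p = (\<Sum>m<2. diff m p0 / fact m * (p - p0) ^ m) + diff 2 t / fact 2 * (p - p0) ^ 2"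
    by (rule Taylor[where a=p and b=p0]) (use D p in \<open>auto simp: diff_def[of 0]\<close>)
  then obtain \<xi> where \<xi>: "p < \<xi>" "\<xi> < p0"
    "phase_inv p = (\<Sum>m<2. diff m p0 / fact m * (p - p0) ^ m) + diff 2 \<xi> / fact 2 * (p - p0) ^ 2"
    using p by auto
  have "(\<Sum>m<2. diff m p0 / fact m * (p - p0) ^ m) = diff 0 p0 + diff 1 p0 * (p - p0)"
    by (simp add: numeral_2_eq_2)
  then show ?thesis using that[OF \<xi>(1,2)] \<xi>(3) by (simp add: diff_def)
qed

text \<open>
  \<open>L\<delta>\<close> and \<open>L\<psi>\<close> in the scaled variable \<open>t = z / \<nu>\<close>; see \<open>L_scaled\<close>.
\<close>

definition Debye_corr :: "real \<Rightarrow> real" where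
  "Debye_corr t = (3 / sqrt (t\<^sup>2 - 1) + 5 / sqrt (t\<^sup>2 - 1) ^ 3) / 24"

definition Debye_psi :: "real \<Rightarrow> real" where
  "Debye_psi t = t\<^sup>2 * (t\<^sup>2 + 4) / (4 * sqrt (t\<^sup>2 - 1) ^ 6)"

lemma L_scaled:
  assumes \<nu>: "\<nu> > 0" and t: "t > 1"
  shows "L\<delta> \<nu> (\<nu> * t) = Debye_corr t / \<nu>" "L\<psi> \<nu> (\<nu> * t) = Debye_psi t / \<nu>\<^sup>2" "Ls \<nu> (\<nu> * t) = \<nu> * Debye_phase t"
proof -
  define q where "q = sqrt (t\<^sup>2 - 1)"
  have q: "q > 0" "q\<^sup>2 = t\<^sup>2 - 1" using sq_gt_1[OF t] by (auto simp: q_def)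
  have D: "LD \<nu> (\<nu> * t) = (\<nu> * q)\<^sup>2" unfolding LD_def[OF \<nu>] power_mult_distrib q(2) by (simp add: algebra_simps)
  have sD: "sqrt (LD \<nu> (\<nu> * t)) = \<nu> * q" unfolding D using \<nu> q by simp
  show "L\<delta> \<nu> (\<nu> * t) = Debye_corr t / \<nu>"
    unfolding L\<delta>_def[OF \<nu>] sD Debye_corr_def q_def[symmetric] using \<nu> q(1)
    by (simp add: field_simps eval_nat_numeral)
  show "L\<psi> \<nu> (\<nu> * t) = Debye_psi t / \<nu>\<^sup>2"
    unfolding L\<psi>_def[OF \<nu>] D Debye_psi_def q_def[symmetric] using \<nu> q(1)
    by (simp add: field_simps eval_nat_numeral)
  show "Ls \<nu> (\<nu> * t) = \<nu> * Debye_phase t" unfolding Ls_def[OF \<nu>] using \<nu> by simp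
qed

lemma Debye_corr_bounds:
  assumes "1 < s" "s \<le> t"
  shows "0 < Debye_corr t" "Debye_corr t \<le> Debye_corr s" "0 < Debye_psi t" "Debye_psi t \<le> Debye_psi s"
proof -
  have st: "t > 1" using assms by simp
  define q r where "q = sqrt (s\<^sup>2 - 1)" and "r = sqrt (t\<^sup>2 - 1)"
  have qr: "0 < q" "q \<le> r" "s\<^sup>2 = q\<^sup>2 + 1" "t\<^sup>2 = r\<^sup>2 + 1"
    using sq_gt_1[OF assms(1)] sq_gt_1[OF st] assms by (auto simp: q_def r_def intro: power_mono)
  have i: "0 < 1 / r" "1 / r \<le> 1 / q" using qr by (auto simp: field_simps)
  show "0 < Debye_corr t" unfolding Debye_corr_def r_def[symmetric] using qr by (simp add: add_pos_pos)
  have c: "Debye_corr t = (3 * (1 / r) + 5 * (1 / r) ^ 3) / 24" "Debye_corr s = (3 * (1 / q) + 5 * (1 / q) ^ 3) / 24"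
    unfolding Debye_corr_def q_def r_def by (simp_all add: power_one_over)
  show "Debye_corr t \<le> Debye_corr s" unfolding c
    using i by (intro divide_right_mono add_mono mult_left_mono power_mono) auto
  have p: "Debye_psi t = ((1 / r)\<^sup>2 + 6 * (1 / r) ^ 4 + 5 * (1 / r) ^ 6) / 4" "Debye_psi s = ((1 / q)\<^sup>2 + 6 * (1 / q) ^ 4 + 5 * (1 / q) ^ 6) / 4"
    unfolding Debye_psi_def q_def[symmetric] r_def[symmetric] qr(3,4) using qr(1,2)
    by (simp_all add: field_simps eval_nat_numeral)
  show "0 < Debye_psi t" unfolding p(1) using i by (intro divide_pos_pos add_pos_pos mult_pos_pos) auto
  show "Debye_psi t \<le> Debye_psi s" unfolding p
    using i by (intro divide_right_mono add_mono mult_left_mono power_mono) auto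
qed

text \<open>
  At a zero \<open>sin (2 * \<theta>)\<close> vanishes, so the oscillating term of \<open>Langle_error\<close> drops out and Debye's correction is the
  only one of order \<open>1 / \<nu>\<close>.
\<close>

lemma besselJ_zero_Debye:
  assumes \<nu>: "\<nu> \<ge> 1" and k: "k \<ge> 1"
  defines "t \<equiv> besselJ_zero \<nu> k / \<nu>"
  shows "t > 1" "\<nu> * Debye_phase t \<ge> real k * pi - pi / 4"
    "\<bar>real k * pi - pi / 4 - \<nu> * Debye_phase t + Debye_corr t / \<nu>\<bar> \<le> Debye_psi t / \<nu>\<^sup>2 / 4 + Debye_psi t / \<nu>\<^sup>2 * (Debye_corr t / \<nu>)"
proof -
  have \<nu>0: "\<nu> > 0" using \<nu> by simp
  obtain \<theta> where ang: "Langle \<nu> \<theta>" using Langle_exists[OF \<nu>0] .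
  define z where "z = besselJ_zero \<nu> k"
  have z: "z > zero_free_end \<nu>" "\<theta> z = (real k - 1 / 2) * pi"
    using besselJ_zero_phase[OF \<nu> ang k] by (auto simp: z_def)
  have zn: "z > \<nu>" using zero_free_end_gt[OF \<nu>0] z by simp
  show t1: "t > 1" using zn \<nu>0 unfolding t_def z_def[symmetric] by simp
  have zt: "z = \<nu> * t" using \<nu>0 by (simp add: t_def z_def)
  have s: "Ls \<nu> z = \<nu> * Debye_phase t" "L\<delta> \<nu> z = Debye_corr t / \<nu>" "L\<psi> \<nu> z = Debye_psi t / \<nu>\<^sup>2"
    unfolding zt using L_scaled[OF \<nu>0 t1] by auto
  have "\<theta> z - Ls \<nu> z \<le> - pi / 4" by (rule phase_constant(2)[OF \<nu> ang]) (use z in simp)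
  then show "\<nu> * Debye_phase t \<ge> real k * pi - pi / 4" unfolding z(2) s by (simp add: algebra_simps)
  have sin0: "sin (2 * \<theta> z) = 0"
  proof -
    have "2 * \<theta> z = of_int (2 * int k - 1) * pi" unfolding z(2) by (simp add: algebra_simps)
    then show ?thesis using sin_zero_iff_int2 by blast
  qed
  have "\<bar>\<theta> z - Ls \<nu> z + L\<delta> \<nu> z - L\<psi> \<nu> z * sin (2 * \<theta> z) / 4 - - pi / 4\<bar> \<le> L\<psi> \<nu> z / 4 + L\<psi> \<nu> z * L\<delta> \<nu> z"
    by (rule Langle_error[OF \<nu>0 ang phase_constant(1)[OF \<nu> ang] zn])
  moreover have "\<theta> z - Ls \<nu> z + L\<delta> \<nu> z - L\<psi> \<nu> z * sin (2 * \<theta> z) / 4 - - pi / 4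
     = real k * pi - pi / 4 - \<nu> * Debye_phase t + Debye_corr t / \<nu>"
    unfolding sin0 unfolding z(2) s by (simp add: algebra_simps)
  ultimately show "\<bar>real k * pi - pi / 4 - \<nu> * Debye_phase t + Debye_corr t / \<nu>\<bar> \<le> Debye_psi t / \<nu>\<^sup>2 / 4 + Debye_psi t / \<nu>\<^sup>2 * (Debye_corr t / \<nu>)"
    unfolding s by simp
qed

text \<open>
  For \<open>\<nu> = x * k\<close> the scaled phase \<open>p k\<close> of the zero is \<open>p0 - p0 / (4 * k) + Debye_corr / (x * k)\<^sup>2\<close> with \<open>p0 = pi / x\<close>, up to
  an error of order \<open>1 / k ^ 3\<close>. The second-order Taylor expansion of the inverse phase at \<open>p0\<close> turns this into the expansion
  of the zero: the first term of the limit is the correction, the second one comes from the square of \<open>p0 / (4 * k)\<close>.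
\<close>

lemma besselJ_zero_expansion:
  assumes x: "x > 0"
  defines "f \<equiv> f_fun x" and "q \<equiv> sqrt ((f_fun x)\<^sup>2 - 1)"
  shows "(\<lambda>k. (real k)\<^sup>2 * (besselJ_zero (x * real k) k / real k - iota x + pi / (4 * real k) * (f / q)))
    \<longlonglongrightarrow> f / q * Debye_corr f / x - pi\<^sup>2 / (32 * x) * (f / q ^ 4)"
proof -
  have f1: "f > 1" and Pf: "Debye_phase f = pi / x" unfolding f_def using f_fun_props[OF x] by auto
  have q0: "q > 0" using sq_gt_1[OF f1] by (simp add: q_def f_def)
  define p0 where "p0 = pi / x"
  have p0: "p0 > 0" using x by (simp add: p0_def)
  have fp0: "phase_inv p0 = f" unfolding phase_inv_def p0_def f_def by simp
  define t where "t k = besselJ_zero (x * real k) k / (x * real k)" for k :: nat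
  define p where "p k = Debye_phase (t k)" for k
  \<comment> \<open>A lower bound for all \<open>t k\<close>, on which the error terms are uniformly bounded: \<open>p k\<close> is at least
    \<open>p0 - p0 / (4 * k)\<close>, hence at least \<open>3 / 4 * p0\<close>.\<close>
  define \<tau> where "\<tau> = phase_inv (3 / 4 * p0)"
  have \<tau>: "\<tau> > 1" "Debye_phase \<tau> = 3 / 4 * p0" using phase_inv_props[of "3 / 4 * p0"] p0 by (auto simp: \<tau>_def)
  define B where "B = Debye_psi \<tau> / (4 * x ^ 3) + Debye_psi \<tau> * Debye_corr \<tau> / x ^ 4"
  have ev: "\<forall>\<^sub>F k in sequentially. real k \<ge> 1 \<and> x * real k \<ge> 1"
  proof -
    have "filterlim (\<lambda>k. x * real k) at_top sequentially" using x by real_asymp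
    then have "\<forall>\<^sub>F k in sequentially. x * real k \<ge> 1" by (simp add: filterlim_at_top)
    moreover have "\<forall>\<^sub>F k in sequentially. real k \<ge> 1" using eventually_ge_at_top[of 1] by eventually_elim simp
    ultimately show ?thesis by eventually_elim simp
  qed
  have main: "t k \<ge> \<tau> \<and> p k \<ge> p0 - p0 / (4 * real k) \<and>
      \<bar>(real k)\<^sup>2 * (p k - p0 + p0 / (4 * real k)) - Debye_corr (t k) / x\<^sup>2\<bar> \<le> B / real k"
    if k: "real k \<ge> 1" "x * real k \<ge> 1" for k
  proof -
    define \<nu> where "\<nu> = x * real k"
    have \<nu>: "\<nu> \<ge> 1" "\<nu> > 0" using k by (auto simp: \<nu>_def)
    have k1: "k \<ge> 1" using k by simp
    have tk: "t k = besselJ_zero \<nu> k / \<nu>" by (simp add: t_def \<nu>_def)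
    note z = besselJ_zero_Debye[OF \<nu>(1) k1, folded tk]
    have pk: "p k \<ge> p0 - p0 / (4 * real k)"
    proof -
      have "x * real k * p k \<ge> real k * pi - pi / 4" using z(2) by (simp add: p_def \<nu>_def)
      then have "(real k * pi - pi / 4) / (x * real k) \<le> p k" using k x by (simp add: divide_le_eq mult.commute)
      moreover have "(real k * pi - pi / 4) / (x * real k) = p0 - p0 / (4 * real k)"
        using k x by (simp add: p0_def field_simps)
      ultimately show ?thesis by simp
    qed
    have "p0 / (4 * real k) \<le> p0 / 4" using p0 k by (simp add: field_simps)
    then have "Debye_phase \<tau> \<le> Debye_phase (t k)" using pk \<tau>(2) by (simp add: p_def)
    then have tt: "\<tau> \<le> t k" using Debye_phase_strict_mono[of "t k" \<tau>] z(1) by force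
    note b = Debye_corr_bounds[OF \<tau>(1) tt]
    define R where "R = real k * pi - pi / 4 - \<nu> * p k + Debye_corr (t k) / \<nu>"
    have R: "\<bar>R\<bar> \<le> Debye_psi \<tau> / \<nu>\<^sup>2 / 4 + Debye_psi \<tau> / \<nu>\<^sup>2 * (Debye_corr \<tau> / \<nu>)"
    proof -
      have "\<bar>R\<bar> \<le> Debye_psi (t k) / \<nu>\<^sup>2 / 4 + Debye_psi (t k) / \<nu>\<^sup>2 * (Debye_corr (t k) / \<nu>)"
        using z(3) unfolding R_def p_def .
      also have "\<dots> \<le> Debye_psi \<tau> / \<nu>\<^sup>2 / 4 + Debye_psi \<tau> / \<nu>\<^sup>2 * (Debye_corr \<tau> / \<nu>)"
        using b \<nu> by (intro add_mono mult_mono divide_right_mono) (auto intro: less_imp_le order_trans)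
      finally show ?thesis .
    qed
    have e: "(real k)\<^sup>2 * (p k - p0 + p0 / (4 * real k)) - Debye_corr (t k) / x\<^sup>2 = - (real k / x) * R"
      unfolding R_def \<nu>_def p0_def using k x by (simp add: field_simps power2_eq_square)
    have "\<bar>(real k)\<^sup>2 * (p k - p0 + p0 / (4 * real k)) - Debye_corr (t k) / x\<^sup>2\<bar> = real k / x * \<bar>R\<bar>"
      unfolding e using k x by (simp add: abs_mult)
    also have "\<dots> \<le> real k / x * (Debye_psi \<tau> / \<nu>\<^sup>2 / 4 + Debye_psi \<tau> / \<nu>\<^sup>2 * (Debye_corr \<tau> / \<nu>))"
      using k x by (intro mult_left_mono R) auto
    also have "\<dots> = Debye_psi \<tau> / (4 * x ^ 3) / real k + Debye_psi \<tau> * Debye_corr \<tau> / x ^ 4 / (real k * real k)"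
      unfolding \<nu>_def using k x by (simp add: field_simps eval_nat_numeral)
    also have "\<dots> \<le> B / real k"
    proof -
      have pos: "Debye_psi \<tau> * Debye_corr \<tau> / x ^ 4 \<ge> 0"
        using Debye_corr_bounds[OF \<tau>(1) order_refl] x by simp
      have "real k * 1 \<le> real k * real k" using k by (intro mult_left_mono) auto
      then have "Debye_psi \<tau> * Debye_corr \<tau> / x ^ 4 / (real k * real k) \<le> Debye_psi \<tau> * Debye_corr \<tau> / x ^ 4 / real k"
        using k by (intro divide_left_mono pos) auto
      then show ?thesis unfolding B_def add_divide_distrib by simp
    qed
    finally show ?thesis using tt pk by blast
  qed
  define E where "E k = (real k)\<^sup>2 * (p k - p0 + p0 / (4 * real k)) - Debye_corr (t k) / x\<^sup>2" for k
  have E0: "E \<longlonglongrightarrow> 0"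
  proof (rule Lim_null_comparison)
    show "\<forall>\<^sub>F k in sequentially. norm (E k) \<le> B / real k"
      using ev by eventually_elim (use main in \<open>simp add: E_def\<close>)
    show "(\<lambda>k. B / real k) \<longlonglongrightarrow> 0" by (rule lim_const_over_n)
  qed
  have cb: "\<forall>\<^sub>F k in sequentially. norm (Debye_corr (t k)) \<le> Debye_corr \<tau>"
    using ev
  proof eventually_elim
    case (elim k)
    then have "\<tau> \<le> t k" using main by blast
    from Debye_corr_bounds[OF \<tau>(1) this] show ?case by simp
  qed
  have n0: "(\<lambda>k. 1 / real k) \<longlonglongrightarrow> 0" by (rule lim_const_over_n)
  have ek: "(\<lambda>k. real k * (p k - p0)) \<longlonglongrightarrow> - p0 / 4"
  proof -
    have "(\<lambda>k. Debye_corr (t k) * (1 / real k)) \<longlonglongrightarrow> 0"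
    proof (rule Lim_null_comparison)
      show "\<forall>\<^sub>F k in sequentially. norm (Debye_corr (t k) * (1 / real k)) \<le> Debye_corr \<tau> * (1 / real k)"
        using cb by eventually_elim (simp add: abs_mult divide_right_mono)
      show "(\<lambda>k. Debye_corr \<tau> * (1 / real k)) \<longlonglongrightarrow> 0" using tendsto_mult_left[OF n0, of "Debye_corr \<tau>"] by simp
    qed
    then have "(\<lambda>k. E k * (1 / real k) + Debye_corr (t k) * (1 / real k) / x\<^sup>2 - p0 / 4) \<longlonglongrightarrow> 0 * 0 + 0 / x\<^sup>2 - p0 / 4"
      by (intro tendsto_intros E0 n0) (use x in auto)
    moreover have "\<forall>\<^sub>F k in sequentially. E k * (1 / real k) + Debye_corr (t k) * (1 / real k) / x\<^sup>2 - p0 / 4 = real k * (p k - p0)"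
      using ev by eventually_elim (simp add: E_def field_simps power2_eq_square)
    ultimately show ?thesis using Lim_transform_eventually by fastforce
  qed
  have pk: "p \<longlonglongrightarrow> p0"
  proof -
    have "(\<lambda>k. real k * (p k - p0) * (1 / real k) + p0) \<longlonglongrightarrow> - p0 / 4 * 0 + p0"
      by (intro tendsto_intros ek n0)
    moreover have "\<forall>\<^sub>F k in sequentially. real k * (p k - p0) * (1 / real k) + p0 = p k"
      using ev by eventually_elim simp
    ultimately show ?thesis using Lim_transform_eventually by fastforce
  qed
  have tp: "\<forall>\<^sub>F k in sequentially. phase_inv (p k) = t k"
    using ev
  proof eventually_elim
    case (elim k)
    then have "t k \<ge> \<tau>" using main by blast
    then show ?case unfolding p_def using \<tau>(1) by (intro phase_inv_Debye) simp
  qed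
  have ci: "isCont phase_inv p0" by (rule DERIV_isCont[OF DERIV_phase_inv[OF p0]])
  have tk: "t \<longlonglongrightarrow> f"
    using Lim_transform_eventually[OF isCont_tendsto_compose[OF ci pk] tp] by (simp add: fp0)
  have dc: "(\<lambda>k. Debye_corr (t k)) \<longlonglongrightarrow> Debye_corr f"
    unfolding Debye_corr_def by (intro tendsto_intros tk) (use q0 in \<open>auto simp: q_def f_def\<close>)
  have L2: "(\<lambda>k. (real k)\<^sup>2 * (p k - p0 + p0 / (4 * real k))) \<longlonglongrightarrow> Debye_corr f / x\<^sup>2"
  proof -
    have "(\<lambda>k. E k + Debye_corr (t k) / x\<^sup>2) \<longlonglongrightarrow> 0 + Debye_corr f / x\<^sup>2"
      by (intro tendsto_intros E0 dc) (use x in auto)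
    then show ?thesis by (simp add: E_def)
  qed
  have pl: "\<forall>\<^sub>F k in sequentially. 0 < p k \<and> p k < p0"
  proof -
    have "\<forall>\<^sub>F k in sequentially. real k * (p k - p0) < 0" by (rule order_tendstoD(2)[OF ek]) (use p0 in simp)
    moreover have "\<forall>\<^sub>F k in sequentially. 0 < p k" by (rule order_tendstoD(1)[OF pk p0])
    ultimately show ?thesis using ev by eventually_elim (auto simp: mult_less_0_iff)
  qed
  have "\<forall>k. \<exists>\<xi>. 0 < p k \<and> p k < p0 \<longrightarrow> p k < \<xi> \<and> \<xi> < p0 \<and>
     phase_inv (p k) = f + f / q * (p k - p0) - phase_inv \<xi> / sqrt ((phase_inv \<xi>)\<^sup>2 - 1) ^ 4 / 2 * (p k - p0)\<^sup>2"
  proof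
    fix k
    show "\<exists>\<xi>. 0 < p k \<and> p k < p0 \<longrightarrow> p k < \<xi> \<and> \<xi> < p0 \<and>
     phase_inv (p k) = f + f / q * (p k - p0) - phase_inv \<xi> / sqrt ((phase_inv \<xi>)\<^sup>2 - 1) ^ 4 / 2 * (p k - p0)\<^sup>2"
    proof (cases "0 < p k \<and> p k < p0")
      case True
      then obtain \<xi> where "p k < \<xi>" "\<xi> < p0"
        "phase_inv (p k) = phase_inv p0 + phase_inv p0 / sqrt ((phase_inv p0)\<^sup>2 - 1) * (p k - p0)
          - phase_inv \<xi> / sqrt ((phase_inv \<xi>)\<^sup>2 - 1) ^ 4 / 2 * (p k - p0)\<^sup>2"
        using phase_inv_Taylor[OF p0, of "p k"] by blast
      then show ?thesis unfolding fp0 q_def f_def by blast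
    qed blast
  qed
  then obtain \<xi> where \<xi>: "\<And>k. 0 < p k \<and> p k < p0 \<Longrightarrow> p k < \<xi> k \<and> \<xi> k < p0 \<and>
     phase_inv (p k) = f + f / q * (p k - p0) - phase_inv (\<xi> k) / sqrt ((phase_inv (\<xi> k))\<^sup>2 - 1) ^ 4 / 2 * (p k - p0)\<^sup>2"
    by metis
  have x0: "\<xi> \<longlonglongrightarrow> p0"
  proof (rule tendsto_sandwich[OF _ _ pk tendsto_const])
    show "\<forall>\<^sub>F k in sequentially. p k \<le> \<xi> k" using pl by eventually_elim (use \<xi> in \<open>auto intro: less_imp_le\<close>)
    show "\<forall>\<^sub>F k in sequentially. \<xi> k \<le> p0" using pl by eventually_elim (use \<xi> in \<open>auto intro: less_imp_le\<close>)
  qed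
  have "(\<lambda>k. phase_inv (\<xi> k)) \<longlonglongrightarrow> f" using isCont_tendsto_compose[OF ci x0] by (simp add: fp0)
  then have x2: "(\<lambda>k. phase_inv (\<xi> k) / sqrt ((phase_inv (\<xi> k))\<^sup>2 - 1) ^ 4) \<longlonglongrightarrow> f / q ^ 4"
    unfolding q_def f_def[symmetric] by (intro tendsto_intros) (use q0 in \<open>auto simp: q_def f_def\<close>)
  have "(\<lambda>k. x * (f / q * ((real k)\<^sup>2 * (p k - p0 + p0 / (4 * real k)))
      - phase_inv (\<xi> k) / sqrt ((phase_inv (\<xi> k))\<^sup>2 - 1) ^ 4 / 2 * (real k * (p k - p0))\<^sup>2))
    \<longlonglongrightarrow> x * (f / q * (Debye_corr f / x\<^sup>2) - f / q ^ 4 / 2 * (- p0 / 4)\<^sup>2)"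
    by (intro tendsto_intros L2 x2 ek) auto
  moreover have "\<forall>\<^sub>F k in sequentially. x * (f / q * ((real k)\<^sup>2 * (p k - p0 + p0 / (4 * real k)))
      - phase_inv (\<xi> k) / sqrt ((phase_inv (\<xi> k))\<^sup>2 - 1) ^ 4 / 2 * (real k * (p k - p0))\<^sup>2)
     = (real k)\<^sup>2 * (besselJ_zero (x * real k) k / real k - iota x + pi / (4 * real k) * (f / q))"
    using ev pl tp
  proof eventually_elim
    case (elim k)
    define H where "H = phase_inv (\<xi> k) / sqrt ((phase_inv (\<xi> k))\<^sup>2 - 1) ^ 4 / 2"
    have T: "t k = f + f / q * (p k - p0) - H * (p k - p0)\<^sup>2"
      using \<xi>[OF elim(2)] elim(3) unfolding H_def by simp
    have B: "besselJ_zero (x * real k) k / real k = x * t k" using elim(1) x by (simp add: t_def)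
    have I: "iota x = x * f" by (simp add: iota_def f_def)
    have P: "pi / (4 * real k) = x * (p0 / (4 * real k))" using x by (simp add: p0_def)
    have "x * (a * (K\<^sup>2 * (d + e)) - H * (K * d)\<^sup>2) = K\<^sup>2 * (x * (f + a * d - H * d\<^sup>2) - x * f + x * e * a)" for a K d e
      by (simp add: algebra_simps power_mult_distrib)
    then show ?case unfolding H_def[symmetric] B I P T by blast
  qed
  ultimately have "(\<lambda>k. (real k)\<^sup>2 * (besselJ_zero (x * real k) k / real k - iota x + pi / (4 * real k) * (f / q)))
     \<longlonglongrightarrow> x * (f / q * (Debye_corr f / x\<^sup>2) - f / q ^ 4 / 2 * (- p0 / 4)\<^sup>2)"
    by (rule Lim_transform_eventually)
  moreover have "x * (f / q * (Debye_corr f / x\<^sup>2) - f / q ^ 4 / 2 * (- p0 / 4)\<^sup>2)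
     = f / q * Debye_corr f / x - pi\<^sup>2 / (32 * x) * (f / q ^ 4)"
    using x q0 by (simp add: p0_def field_simps power2_eq_square)
  ultimately show ?thesis by simp
qed

theorem theorem3p3:
  fixes x :: real
  assumes "x > 0"
  shows
    "(\<exists>\<zeta>::real.
        (\<lambda>k::nat. besselJ_zero (x * real k) k / real k - iota x
            - (- (pi / (4 * real k)) * (f_fun x / sqrt ((f_fun x)\<^sup>2 - 1)) + \<zeta> / (real k)\<^sup>2))
          \<in> o[sequentially](\<lambda>k. 1 / (real k)\<^sup>2)
        \<and> set_integrable lborel {0<..<x} Theta0
        \<and> \<zeta> = pi / 4 * (f_fun x / sqrt ((f_fun x)\<^sup>2 - 1)) *
               (1 / (2 * pi\<^sup>2) - (LBINT t:{0<..<x}. Theta0 t)))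
     \<and> (\<forall>\<^sub>F s in nhds 0. F_fun (iota x) x differentiable (at s))
     \<and> deriv (F_fun (iota x) x) differentiable (at 0)
     \<and> set_integrable lborel {0<..} (\<lambda>t. t ^ 3 * besselK 1 t * exp (- (x / iota x) * t))
     \<and> deriv (deriv (F_fun (iota x) x)) 0 =
         - (1 / (12 * (iota x)\<^sup>2)) *
           (LBINT t:{0<..}. t ^ 3 * besselK 1 t * exp (- (x / iota x) * t))
     \<and> deriv (deriv (F_fun (iota x) x)) 0 =
         - (1 / (12 * x\<^sup>2 * (f_fun x)\<^sup>2)) *
           (LBINT t:{0<..}. t ^ 3 * besselK 1 t * exp (- (t / f_fun x)))
     \<and> (\<forall>t>1. g_fun differentiable (at t) \<and> deriv g_fun differentiable (at t)
          \<and> deriv (deriv g_fun) t =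
              (3 * t * arccos (1 / t) - sqrt (1 - 1 / t\<^sup>2) - 2 * t * sqrt (t\<^sup>2 - 1))
                / (t\<^sup>2 - 1) powr (5 / 2))"
proof (intro conjI)
  define f where "f = f_fun x"
  define q where "q = sqrt ((f_fun x)\<^sup>2 - 1)"
  have f1: "f > 1" and Pf: "Debye_phase f = pi / x" unfolding f_def using f_fun_props[OF assms] by auto
  have q0: "q > 0" using sq_gt_1[OF f1] by (simp add: q_def f_def)
  have ip: "iota x > 0" using f1 assms by (simp add: iota_def f_def)
  define \<zeta> where "\<zeta> = pi / 4 * (f / q) * (1 / (2 * pi\<^sup>2) - (LBINT t:{0<..<x}. Theta0 t))"
  \<comment> \<open>By \<open>Theta0_integral\<close> the bracket in \<open>\<zeta>\<close> is \<open>- Theta_prim f\<close>, which is the limit in \<open>besselJ_zero_expansion\<close>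
    up to the factor \<open>pi / 4 * (f / q)\<close>; here \<open>Debye_phase f = pi / x\<close> is used.\<close>
  have \<zeta>: "\<zeta> = f / q * Debye_corr f / x - pi\<^sup>2 / (32 * x) * (f / q ^ 4)"
    unfolding \<zeta>_def Theta0_integral(2)[OF assms] Theta_prim_def Debye_corr_def f_def[symmetric] q_def[symmetric, folded f_def] Pf
    using assms q0 by (simp add: field_simps eval_nat_numeral)
  have lim: "(\<lambda>k. (real k)\<^sup>2 * (besselJ_zero (x * real k) k / real k - iota x + pi / (4 * real k) * (f / q))) \<longlonglongrightarrow> \<zeta>"
    unfolding \<zeta> unfolding f_def q_def by (rule besselJ_zero_expansion[OF assms])
  have "(\<lambda>k. besselJ_zero (x * real k) k / real k - iota x - (- (pi / (4 * real k)) * (f / q) + \<zeta> / (real k)\<^sup>2))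
      \<in> o[sequentially](\<lambda>k. 1 / (real k)\<^sup>2)"
  proof (rule smalloI_tendsto)
    show "\<forall>\<^sub>F k in sequentially. 1 / (real k)\<^sup>2 \<noteq> 0"
      using eventually_gt_at_top[of 0] by eventually_elim simp
    have "(\<lambda>k. (real k)\<^sup>2 * (besselJ_zero (x * real k) k / real k - iota x + pi / (4 * real k) * (f / q)) - \<zeta>) \<longlonglongrightarrow> \<zeta> - \<zeta>"
      by (intro tendsto_diff lim tendsto_const)
    moreover have "\<forall>\<^sub>F k in sequentially. (real k)\<^sup>2 * (besselJ_zero (x * real k) k / real k - iota x + pi / (4 * real k) * (f / q)) - \<zeta>
       = (besselJ_zero (x * real k) k / real k - iota x - (- (pi / (4 * real k)) * (f / q) + \<zeta> / (real k)\<^sup>2)) / (1 / (real k)\<^sup>2)"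
      using eventually_gt_at_top[of 0] by eventually_elim (simp add: algebra_simps)
    ultimately show "((\<lambda>k. (besselJ_zero (x * real k) k / real k - iota x - (- (pi / (4 * real k)) * (f / q) + \<zeta> / (real k)\<^sup>2)) / (1 / (real k)\<^sup>2)) \<longlongrightarrow> 0) sequentially"
      using Lim_transform_eventually by fastforce
  qed
  then show "\<exists>\<zeta>::real.
        (\<lambda>k::nat. besselJ_zero (x * real k) k / real k - iota x
            - (- (pi / (4 * real k)) * (f_fun x / sqrt ((f_fun x)\<^sup>2 - 1)) + \<zeta> / (real k)\<^sup>2))
          \<in> o[sequentially](\<lambda>k. 1 / (real k)\<^sup>2)
        \<and> set_integrable lborel {0<..<x} Theta0
        \<and> \<zeta> = pi / 4 * (f_fun x / sqrt ((f_fun x)\<^sup>2 - 1)) *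
               (1 / (2 * pi\<^sup>2) - (LBINT t:{0<..<x}. Theta0 t))"
    using Theta0_integral(1)[OF assms] unfolding \<zeta>_def f_def q_def by blast
  show "\<forall>\<^sub>F s in nhds 0. F_fun (iota x) x differentiable (at s)"
    using DERIV_F_fun[OF ip assms] by (intro always_eventually allI) (auto simp: real_differentiable_def)
  show "deriv (F_fun (iota x) x) differentiable (at 0)"
    "set_integrable lborel {0<..} (\<lambda>t. t ^ 3 * besselK 1 t * exp (- (x / iota x) * t))"
    by (rule F_fun_second_deriv[OF ip assms])+
  show 1: "deriv (deriv (F_fun (iota x) x)) 0 = - (1 / (12 * (iota x)\<^sup>2)) *
           (LBINT t:{0<..}. t ^ 3 * besselK 1 t * exp (- (x / iota x) * t))"
    by (rule F_fun_second_deriv(3)[OF ip assms])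
  have "x / iota x * t = t / f_fun x" for t using assms f1 by (simp add: iota_def f_def)
  then show "deriv (deriv (F_fun (iota x) x)) 0 = - (1 / (12 * x\<^sup>2 * (f_fun x)\<^sup>2)) *
           (LBINT t:{0<..}. t ^ 3 * besselK 1 t * exp (- (t / f_fun x)))"
    unfolding 1 by (simp add: iota_def power_mult_distrib)
  show "\<forall>t>1. g_fun differentiable (at t) \<and> deriv g_fun differentiable (at t)
          \<and> deriv (deriv g_fun) t =
              (3 * t * arccos (1 / t) - sqrt (1 - 1 / t\<^sup>2) - 2 * t * sqrt (t\<^sup>2 - 1))
                / (t\<^sup>2 - 1) powr (5 / 2)"
  proof (intro allI impI conjI)
    fix t :: real assume t: "t > 1"
    show "g_fun differentiable (at t)" "deriv g_fun differentiable (at t)"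
      using g_fun_derivs[OF t] by (auto simp: real_differentiable_def)
    show "deriv (deriv g_fun) t = (3 * t * arccos (1 / t) - sqrt (1 - 1 / t\<^sup>2) - 2 * t * sqrt (t\<^sup>2 - 1)) / (t\<^sup>2 - 1) powr (5 / 2)"
      unfolding sqrt_power5[OF t, symmetric] by (rule DERIV_imp_deriv[OF g_fun_derivs(2)[OF t]])
  qed
qed

end
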